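(* Let $A$ be a division Albert algebra over $K$ and let $L,L'\subset A$ be separable cubic field extensions of $K$ that are isomorphic over $K$. Then there exist a $9$-dimensional subalgebra $B_\sigma^+\subset A$ containing $L$ and $L'$ and an element $s\in\mathbf{Str}(A)(K)$ stabilizing $B_\sigma^+$ such that $s(L)=L'$. In particular there exists $g\in\mathbf{Str}(A)(K)$ with $g(L)=L'$.
   Context: $K$ is an infinite field of characteristic different from $2$ and $3$. A division Albert algebra is a $27$-dimensional exceptional Jordan algebra with anisotropic cubic norm $N$; $\mathbf{Str}(A)(K)$ is the group of $K$-linear bijections $x$ of $A$ with $N(x(a))=\nu(x)N(a)$ for a scalar $\nu(x)$ (functorially). Its $9$-dimensional subalgebras are of the form $B_\sigma^+$ ($\sigma$-symmetric elements of a degree $3$ algebra $B$ over a quadratic étale $E/K$ with involution of the second kind, Jordan product $\tfrac12(xy+yx)$). *)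

theory Defs
  imports "HOL-Computational_Algebra.Polynomial"
begin

text \<open>A (not necessarily associative) algebra is given by a vector space structure
  sc (scalar multiplication of the field 'k on the additive group 'a), a product m and
  an element e (the identity).\<close>

definition bilinear_prod :: "('k::field \<Rightarrow> 'a::ab_group_add \<Rightarrow> 'a) \<Rightarrow> ('a \<Rightarrow> 'a \<Rightarrow> 'a) \<Rightarrow> bool" where
  "bilinear_prod sc m \<longleftrightarrow>
     (\<forall>x y z. m (x + y) z = m x z + m y z \<and> m z (x + y) = m z x + m z y) \<and>
     (\<forall>c x y. m (sc c x) y = sc c (m x y) \<and> m x (sc c y) = sc c (m x y))"

definition jordan_algebra :: "('k::field \<Rightarrow> 'a::ab_group_add \<Rightarrow> 'a) \<Rightarrow> ('a \<Rightarrow> 'a \<Rightarrow> 'a) \<Rightarrow> 'a \<Rightarrow> bool" where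
  "jordan_algebra sc m e \<longleftrightarrow> vector_space sc \<and> bilinear_prod sc m \<and>
     (\<forall>x y. m x y = m y x) \<and> (\<forall>x. m e x = x) \<and>
     (\<forall>x y. m (m (m x x) y) x = m (m x x) (m y x))"

text \<open>Square matrices of size n over 'k, represented as functions vanishing outside n x n.\<close>
definition matmul :: "nat \<Rightarrow> (nat \<Rightarrow> nat \<Rightarrow> 'k::field) \<Rightarrow> (nat \<Rightarrow> nat \<Rightarrow> 'k) \<Rightarrow> nat \<Rightarrow> nat \<Rightarrow> 'k" where
  "matmul n M P = (\<lambda>i j. \<Sum>k<n. M i k * P k j)"

definition special_jordan :: "('k::field \<Rightarrow> 'a::ab_group_add \<Rightarrow> 'a) \<Rightarrow> ('a \<Rightarrow> 'a \<Rightarrow> 'a) \<Rightarrow> bool" where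
  "special_jordan sc m \<longleftrightarrow> (\<exists>(n::nat) (f :: 'a \<Rightarrow> nat \<Rightarrow> nat \<Rightarrow> 'k).
      (\<forall>x i j. \<not> (i < n \<and> j < n) \<longrightarrow> f x i j = 0) \<and>
      (\<forall>x y. f (x + y) = (\<lambda>i j. f x i j + f y i j)) \<and>
      (\<forall>c x. f (sc c x) = (\<lambda>i j. c * f x i j)) \<and>
      inj f \<and>
      (\<forall>x y. f (m x y) = (\<lambda>i j. (matmul n (f x) (f y) i j + matmul n (f y) (f x) i j) / 2)))"

definition linear_form :: "('k::field \<Rightarrow> 'a::ab_group_add \<Rightarrow> 'a) \<Rightarrow> ('a \<Rightarrow> 'k) \<Rightarrow> bool" where
  "linear_form sc T \<longleftrightarrow> (\<forall>x y. T (x + y) = T x + T y) \<and> (\<forall>c x. T (sc c x) = c * T x)"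

definition quadratic_form :: "('k::field \<Rightarrow> 'a::ab_group_add \<Rightarrow> 'a) \<Rightarrow> ('a \<Rightarrow> 'k) \<Rightarrow> bool" where
  "quadratic_form sc S \<longleftrightarrow> (\<exists>Q. (\<forall>y. linear_form sc (\<lambda>x. Q x y)) \<and> (\<forall>x y. Q x y = Q y x) \<and>
      (\<forall>x. S x = Q x x))"

definition cubic_form :: "('k::field \<Rightarrow> 'a::ab_group_add \<Rightarrow> 'a) \<Rightarrow> ('a \<Rightarrow> 'k) \<Rightarrow> bool" where
  "cubic_form sc N \<longleftrightarrow> (\<exists>C. (\<forall>y z. linear_form sc (\<lambda>x. C x y z)) \<and>
      (\<forall>x y z. C x y z = C y x z \<and> C x y z = C x z y) \<and> (\<forall>x. N x = C x x x))"

text \<open>Division Albert algebra with cubic norm N: a 27-dimensional exceptional Jordan algebra,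
  N its (generic) cubic norm, i.e. the cubic form with N e = 1 such that every x satisfies
  x^3 - T(x) x^2 + S(x) x - N(x) e = 0 for a linear form T and a quadratic form S,
  and N anisotropic.\<close>
definition division_albert :: "('k::field \<Rightarrow> 'a::ab_group_add \<Rightarrow> 'a) \<Rightarrow> ('a \<Rightarrow> 'a \<Rightarrow> 'a) \<Rightarrow> 'a \<Rightarrow> ('a \<Rightarrow> 'k) \<Rightarrow> bool" where
  "division_albert sc m e N \<longleftrightarrow> jordan_algebra sc m e \<and>
     vector_space.dim sc (UNIV :: 'a set) = 27 \<and>
     \<not> special_jordan sc m \<and>
     cubic_form sc N \<and> N e = 1 \<and>
     (\<exists>T S. linear_form sc T \<and> quadratic_form sc S \<and>
        (\<forall>x. m x (m x x) - sc (T x) (m x x) + sc (S x) x - sc (N x) e = 0)) \<and>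
     (\<forall>x. N x = 0 \<longrightarrow> x = 0)"

definition subalgebra :: "('k::field \<Rightarrow> 'a::ab_group_add \<Rightarrow> 'a) \<Rightarrow> ('a \<Rightarrow> 'a \<Rightarrow> 'a) \<Rightarrow> 'a \<Rightarrow> 'a set \<Rightarrow> bool" where
  "subalgebra sc m e B \<longleftrightarrow> module.subspace sc B \<and> e \<in> B \<and> (\<forall>x\<in>B. \<forall>y\<in>B. m x y \<in> B)"

fun jpow :: "('a \<Rightarrow> 'a \<Rightarrow> 'a) \<Rightarrow> 'a \<Rightarrow> 'a \<Rightarrow> nat \<Rightarrow> 'a" where
  "jpow m e x 0 = e"
| "jpow m e x (Suc n) = m x (jpow m e x n)"

definition peval :: "('k::field \<Rightarrow> 'a::ab_group_add \<Rightarrow> 'a) \<Rightarrow> ('a \<Rightarrow> 'a \<Rightarrow> 'a) \<Rightarrow> 'a \<Rightarrow> 'k poly \<Rightarrow> 'a \<Rightarrow> 'a" where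
  "peval sc m e p x = (\<Sum>i\<le>degree p. sc (coeff p i) (jpow m e x i))"

definition sep_cubic_subfield :: "('k::field \<Rightarrow> 'a::ab_group_add \<Rightarrow> 'a) \<Rightarrow> ('a \<Rightarrow> 'a \<Rightarrow> 'a) \<Rightarrow> 'a \<Rightarrow> 'a set \<Rightarrow> bool" where
  "sep_cubic_subfield sc m e L \<longleftrightarrow> subalgebra sc m e L \<and> vector_space.dim sc L = 3 \<and>
     (\<forall>x\<in>L. \<forall>y\<in>L. \<forall>z\<in>L. m (m x y) z = m x (m y z)) \<and>
     (\<forall>x\<in>L. x \<noteq> 0 \<longrightarrow> (\<exists>y\<in>L. m x y = e)) \<and>
     (\<forall>x\<in>L. \<exists>p. p \<noteq> 0 \<and> coprime p (pderiv p) \<and> peval sc m e p x = 0)"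

definition iso_over_K :: "('k::field \<Rightarrow> 'a::ab_group_add \<Rightarrow> 'a) \<Rightarrow> ('a \<Rightarrow> 'a \<Rightarrow> 'a) \<Rightarrow> 'a \<Rightarrow> 'a set \<Rightarrow> 'a set \<Rightarrow> bool" where
  "iso_over_K sc m e L L' \<longleftrightarrow> (\<exists>\<phi>. bij_betw \<phi> L L' \<and> \<phi> e = e \<and>
     (\<forall>x\<in>L. \<forall>y\<in>L. \<phi> (x + y) = \<phi> x + \<phi> y \<and> \<phi> (m x y) = m (\<phi> x) (\<phi> y)) \<and>
     (\<forall>c. \<forall>x\<in>L. \<phi> (sc c x) = sc c (\<phi> x)))"

definition Str :: "('k::field \<Rightarrow> 'a::ab_group_add \<Rightarrow> 'a) \<Rightarrow> ('a \<Rightarrow> 'k) \<Rightarrow> ('a \<Rightarrow> 'a) set" where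
  "Str sc N = {g. Vector_Spaces.linear sc sc g \<and> bij g \<and> (\<exists>\<nu>. \<forall>a. N (g a) = \<nu> * N a)}"

end

theory Submission
  imports Defs
begin

text \<open>
  The characteristic equation turns the Jordan algebra into a cubic norm structure, with adjoint
  \<open>ad\<close>, its polarisation \<open>cr\<close>, trace form \<open>t\<close> and trilinear form \<open>n3\<close>. For a cubic subfield \<open>L\<close> and
  \<open>v \<noteq> 0\<close> orthogonal to it, \<open>L\<close> and \<open>v\<close> generate a subalgebra \<open>B\<close> of dimension 9, since a smaller one
  would contain a zero of the norm; so \<open>L\<close> and \<open>L'\<close> lie in a common \<open>B\<close>.

  On the orthogonal complement \<open>C\<close> of \<open>B\<close> the operators \<open>a \<rhd> c = - cr a c\<close> form a special representation of \<open>B\<close>.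
  For a nonzero commutator \<open>D\<close> of two of them, the reduced norm of \<open>D\<close> is a skew operator \<open>E\<close> with \<open>E\<^sup>2\<close> a scalar \<open>d\<close>;
  it is unique up to scalars, commutes with everything, and the operators \<open>a + E a'\<close> form the associative envelope \<open>R\<close> of \<open>B\<close>,
  an algebra over the quadratic algebra \<open>K[E]\<close> with involution, of which \<open>C\<close> is a free module of rank one.
  The usual Skolem-Noether formula gives an invertible \<open>b\<close> in \<open>R\<close> with \<open>b l = l' b\<close>, and \<open>a \<mapsto> b a b\<^sup>*\<close> maps \<open>L\<close> to \<open>L'\<close>,
  because \<open>b b\<^sup>*\<close> centralises \<open>L'\<close>.

  This map extends to \<open>C = R c0\<close> by \<open>r c0 \<mapsto> adj(b\<^sup>*) r w c0\<close> as soon as \<open>w\<close> satisfies \<open>w u w\<^sup>* = u\<close>, where \<open>u\<close>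
  represents \<open>a \<mapsto> t (a \<rhd> c0) c0\<close>, and has reduced norm \<open>n(b) / n(b\<^sup>*)\<close>. A dimension count gives \<open>h \<noteq> 0\<close> in \<open>B\<close>
  with \<open>b h + h b\<^sup>*\<close> a multiple of \<open>u\<close>, and then \<open>w = (b h) (h b\<^sup>*)\<inverse>\<close> has both properties.
\<close>

section \<open>Jordan algebras with a cubic characteristic equation\<close>

text \<open>No scalar extension is made, and K[E] may split: anisotropy of the norm takes the place
  of structure theory, and the reduced norm of an operator on \<open>C\<close> is read off from the
  way it scales the trilinear form restricted to \<open>C\<close>. Commutators lead to the centre
  because a commutator D of self-adjoint operators is skew: the involution changes the sign of its
  reduced norm, which therefore spans the skew line of the centre. The isomorphism of
  \<open>L\<close> and \<open>L'\<close> enters only through a generator and its image having the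
  same characteristic polynomial. The obstacle is the extension from \<open>B\<close> to the whole
  algebra. Since N(a + c) = N(a) + N(c) - t (a \<rhd> c) c / 2, the map on \<open>C\<close> has to
  multiply both the cubic norm and this pairing by the scalar n(b) n(star b). The operator adj(star
  b) alone does so for the pairing, but it scales the cubic form by n(star b)^2, an element of K[E].
  The factor w repairs the cubic form and, being unitary, leaves the pairing alone.\<close>

definition functional :: "('k::field \<Rightarrow> 'b::ab_group_add \<Rightarrow> 'b) \<Rightarrow> ('b \<Rightarrow> 'k) \<Rightarrow> bool" where
  "functional s g \<longleftrightarrow> (\<forall>x y. g (x + y) = g x + g y) \<and> (\<forall>c x. g (s c x) = c * g x)"

context vector_space begin

lemma lin_simps:
  fixes g :: "'b \<Rightarrow> 'a"
  assumes "functional scale g"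
  shows "g (x + y) = g x + g y" "g (scale c x) = c * g x" "g (x - y) = g x - g y"
    "g (- x) = - g x" "g 0 = 0"
proof -
  have a: "g (x + y) = g x + g y" and s: "g (scale c x) = c * g x" for x y :: 'b and c :: 'a
    using assms by (auto simp: functional_def)
  show "g (x + y) = g x + g y" "g (scale c x) = c * g x" by (fact a s)+
  show "g (x - y) = g x - g y" using a[of x "scale (-1) y"] s[of "-1" y] by simp
  show "g (- x) = - g x" using s[of "-1" x] by simp
  show "g 0 = 0" using s[of 0 0] by simp
qed

text \<open>An arbitrary linear functional turns an identity of vectors into one of scalars, which
  is the form that \<open>algebra\<close> can decide.\<close>

lemma vec_eqI:
  assumes "\<And>g. functional scale g \<Longrightarrow> g u = g v"
  shows "u = v"
proof (rule ccontr)
  assume "u \<noteq> v"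
  interpret K: vector_space "(*) :: 'a \<Rightarrow> 'a \<Rightarrow> 'a"
    by unfold_locales (simp_all add: algebra_simps)
  interpret vp: vector_space_pair scale "(*) :: 'a \<Rightarrow> 'a \<Rightarrow> 'a" ..
  have "independent {u - v}" using \<open>u \<noteq> v\<close> by simp
  from vp.linear_independent_extend[OF this, of "\<lambda>_. 1"]
  obtain g where g: "Vector_Spaces.linear scale (*) g" "g (u - v) = 1" by auto
  interpret g: Vector_Spaces.linear scale "(*)" g by (rule g(1))
  have "g u = g v" by (rule assms) (simp add: functional_def g.add g.scale)
  with g(2) show False by (simp add: g.diff)
qed

text \<open>The multiplier is a certificate: after applying g, the goal is k times the known
  equation. The two variants that follow combine two and three equations.\<close>

lemma vec_eqI1:
  assumes "u1 = v1" and "\<And>g. functional scale g \<Longrightarrow> g u - g v = k * (g u1 - g v1)"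
  shows "u = v"
  by (rule vec_eqI) (use assms in force)

lemma vec_eqI2:
  assumes "u1 = v1" "u2 = v2"
    and "\<And>g. functional scale g \<Longrightarrow> g u - g v = k * (g u1 - g v1) + k' * (g u2 - g v2)"
  shows "u = v"
  by (rule vec_eqI) (use assms in force)

lemma vec_eqI3:
  assumes "u1 = v1" "u2 = v2" "u3 = v3"
    and "\<And>g. functional scale g \<Longrightarrow> g u - g v = k * (g u1 - g v1) + k' * (g u2 - g v2) + k'' * (g u3 - g v3)"
  shows "u = v"
  by (rule vec_eqI) (use assms in force)

text \<open>A relation x2 = t x - n e makes X^2 - t X + n a factor of the cubic; the remaining root
  T - t lies in the field, and \<open>root\<close> forces x to be a multiple of e. With
  \<open>x2\<close> and \<open>x3\<close> as bare vectors the result serves both for the given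
  product and for the one rebuilt from the cross product.\<close>

lemma cubic_independent:
  assumes e: "e \<noteq> 0" and x: "\<And>k. x \<noteq> scale k e"
    and cubic: "x3 - scale T x2 + scale S x - scale N e = 0"
    and power: "\<And>t n. x2 = scale t x - scale n e \<Longrightarrow> x3 = scale t x2 - scale n x"
    and root: "\<And>k. k^3 - k^2 * T + k * S - N = 0 \<Longrightarrow> x = scale k e"
    and z: "scale a e + scale b x + scale c x2 = 0"
  shows "a = 0 \<and> b = 0 \<and> c = 0"
proof -
  have lin: "a = 0 \<and> b = 0" if "scale a e + scale b x = 0" for a b
  proof (cases "b = 0")
    case True then show ?thesis using that e by simp
  next
    case False
    have "scale b x = scale (-a) e" using that by (simp add: eq_neg_iff_add_eq_0 add.commute)
    from arg_cong[OF this, of "scale (inverse b)"] False have "x = scale (inverse b * (-a)) e" by simp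
    with x show ?thesis by blast
  qed
  show ?thesis
  proof (cases "c = 0")
    case True then show ?thesis using z lin by simp
  next
    case False
    define t where "t = - b / c" define n where "n = a / c"
    have t: "c * t = - b" and n: "c * n = a" using False by (simp_all add: t_def n_def)
    have "scale c x2 = scale c (scale t x - scale n e)"
      unfolding scale_right_diff_distrib scale_scale t n
      by (rule vec_eqI1[OF z, where k = 1]) (simp only: lin_simps, algebra)
    then have sq: "x2 = scale t x - scale n e" using False by simp
    have "scale (- (t - T) * n - N) e + scale ((t - T) * t + S - n) x = 0"
      by (rule vec_eqI1[OF cubic, where k = 1]) (simp only: power[OF sq] lin_simps, simp only: sq lin_simps, algebra)
    from lin[OF this] have N: "N = - (t - T) * n" and S: "S = n - (t - T) * t" by (simp_all add: algebra_simps)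
    have "(T - t)^3 - (T - t)^2 * T + (T - t) * S - N = 0"
      unfolding N S by algebra
    from root[OF this] x show ?thesis by blast
  qed
qed

lemma scale_cancelI: "c \<noteq> 0 \<Longrightarrow> scale c u = scale c v \<Longrightarrow> u = v"
  by simp

end

text \<open>\<open>C\<close> is the polarised norm, \<open>Q\<close> the polarised quadratic
  coefficient. The assumption \<open>generic\<close> supplies one element whose square is outside
  the span of itself and \<open>e\<close>; it pins down T e = 3, on which the later uniqueness of
  the coefficients rests.\<close>

locale cubic_jordan = vector_space sc
  for sc :: "'k::field \<Rightarrow> 'a::ab_group_add \<Rightarrow> 'a" +
  fixes m :: "'a \<Rightarrow> 'a \<Rightarrow> 'a" (infixl "\<odot>" 70) and e :: 'a
    and C :: "'a \<Rightarrow> 'a \<Rightarrow> 'a \<Rightarrow> 'k" and T :: "'a \<Rightarrow> 'k" and Q :: "'a \<Rightarrow> 'a \<Rightarrow> 'k"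
  assumes two [simp]: "(2::'k) \<noteq> 0" and three [simp]: "(3::'k) \<noteq> 0"
    and mult_add_left: "(x + y) \<odot> z = x \<odot> z + y \<odot> z"
    and mult_scale_left: "sc c x \<odot> y = sc c (x \<odot> y)"
    and mult_commute: "x \<odot> y = y \<odot> x"
    and unit [simp]: "e \<odot> x = x"
    and jordan: "((x \<odot> x) \<odot> y) \<odot> x = (x \<odot> x) \<odot> (y \<odot> x)"
    and C_add: "C (x + y) z w = C x z w + C y z w"
    and C_scale: "C (sc c x) z w = c * C x z w"
    and C_sym1: "C x y z = C y x z" and C_sym2: "C x y z = C x z y"
    and C_unit [simp]: "C e e e = 1"
    and T_add: "T (x + y) = T x + T y" and T_scale: "T (sc c x) = c * T x"
    and Q_add: "Q (x + y) z = Q x z + Q y z" and Q_scale: "Q (sc c x) z = c * Q x z"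
    and Q_sym: "Q x y = Q y x"
    and char_eq: "x \<odot> (x \<odot> x) - sc (T x) (x \<odot> x) + sc (Q x x) x - sc (C x x x) e = 0"
    and aniso: "C x x x = 0 \<Longrightarrow> x = 0"
    and generic: "\<exists>x. \<forall>a b c. sc a e + sc b x + sc c (x \<odot> x) = 0 \<longrightarrow> c = 0"
begin

lemma mult_add_right: "z \<odot> (x + y) = z \<odot> x + z \<odot> y"
  by (metis mult_add_left mult_commute)
lemma mult_scale_right: "x \<odot> sc c y = sc c (x \<odot> y)"
  by (metis mult_scale_left mult_commute)
lemma unit_right [simp]: "x \<odot> e = x" by (metis unit mult_commute)
lemma minus_eq_scale: "- x = sc (-1) x" by simp
lemma diff_eq_scale: "x - y = x + sc (-1) y" by simp
lemma C_add2: "C z (x + y) w = C z x w + C z y w" by (metis C_add C_sym1)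
lemma C_add3: "C z w (x + y) = C z w x + C z w y" by (metis C_add2 C_sym2)
lemma C_scale2: "C z (sc c x) w = c * C z x w" by (metis C_scale C_sym1)
lemma C_scale3: "C z w (sc c x) = c * C z w x" by (metis C_scale2 C_sym2)
lemma Q_add2: "Q z (x + y) = Q z x + Q z y" by (metis Q_add Q_sym)
lemma Q_scale2: "Q z (sc c x) = c * Q z x" by (metis Q_scale Q_sym)

lemmas multilinear = mult_add_left mult_add_right mult_scale_left mult_scale_right
  C_add C_add2 C_add3 C_scale C_scale2 C_scale3 T_add T_scale Q_add Q_add2 Q_scale Q_scale2

lemma minus_rules:
  "T (x - y) = T x - T y" "T (- x) = - T x" "T 0 = 0"
  "Q (x - y) z = Q x z - Q y z" "Q z (x - y) = Q z x - Q z y"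
  "C (x - y) z w = C x z w - C y z w" "C z (x - y) w = C z x w - C z y w"  "C z w (x - y) = C z w x - C z w y"
  by (simp_all only: diff_eq_scale minus_eq_scale multilinear) (use T_scale[of 0 0] in simp_all)

lemma mult_diff: "(x - y) \<odot> z = x \<odot> z - y \<odot> z" "z \<odot> (x - y) = z \<odot> x - z \<odot> y"
  "(- x) \<odot> z = - (x \<odot> z)" "z \<odot> (- x) = - (z \<odot> x)" "0 \<odot> z = 0" "z \<odot> 0 = 0"
proof -
  show "0 \<odot> z = 0" "z \<odot> 0 = 0" by (metis mult_scale_left mult_scale_right scale_zero_left)+
qed (simp_all only: diff_eq_scale minus_eq_scale multilinear)

lemmas expand = multilinear minus_rules mult_diff

text \<open>The component of degree two in x and one in y: for a cubic map f it is half of f(x + y)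
  - f(x - y) - 2 f(y).\<close>

lemma char_eq_linearised:
  "y \<odot> (x \<odot> x) + sc 2 (x \<odot> (x \<odot> y)) - sc (T y) (x \<odot> x) - sc (2 * T x) (x \<odot> y)
    + sc (2 * Q x y) x + sc (Q x x) y - sc (3 * C x x y) e = 0" (is "?f = 0")
proof -
  have c: "C x y x = C x x y" "C y x x = C x x y" "C y x y = C x y y" "C y y x = C x y y"
    "Q y x = Q x y" "y \<odot> x = x \<odot> y"
    by (metis C_sym1 C_sym2 Q_sym mult_commute)+
  have "sc 2 ?f = sc 2 0"
    by (rule vec_eqI3[OF char_eq[of "x + y"] char_eq[of "x - y"] char_eq[of y], where k = 1 and k' = "-1" and k'' = "-2"])
      (simp only: expand lin_simps c, algebra)
  then show ?thesis by (rule scale_cancelI[OF two])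
qed

lemma char_eq_linearised_unit:
  "sc (3 - T e) (x \<odot> x) + sc (2 * Q x e - 2 * T x) x + sc (Q x x - 3 * C x x e) e = 0"
  by (rule vec_eqI1[OF char_eq_linearised[of e x], where k = 1]) (simp only: unit unit_right lin_simps, algebra)

lemma nontrivial: "e \<noteq> 0"
  using C_unit C_scale[of 0 0 0 0] by (metis mult_zero_left scale_zero_left zero_neq_one C_scale)

text \<open>Linearising in the direction e gives a quadratic relation for every x with leading
  coefficient 3 - T e; the generic element makes it vanish.\<close>

lemma T_unit [simp]: "T e = 3"
proof -
  obtain x where "\<And>a b c. sc a e + sc b x + sc c (x \<odot> x) = 0 \<Longrightarrow> c = 0" using generic by blast
  from this[of "Q x x - 3 * C x x e" "2 * Q x e - 2 * T x" "3 - T e"] char_eq_linearised_unit[of x]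
  show ?thesis by (simp add: ac_simps)
qed

lemma Q_unit_unit: "Q e e = 3"
proof -
  have "sc (1 - 3 + Q e e - 1) e = 0" using char_eq[of e] by (simp add: algebra_simps)
  then show ?thesis using nontrivial by (simp add: algebra_simps)
qed

lemma Q_unit: "Q x e = T x"
proof (cases "\<exists>k. x = sc k e")
  case True then show ?thesis by (auto simp: Q_scale T_scale Q_unit_unit)
next
  case False
  show ?thesis
  proof (rule ccontr)
    assume "Q x e \<noteq> T x"
    then have ne: "2 * Q x e - 2 * T x \<noteq> 0"  using two by (metis eq_iff_diff_eq_0 mult_left_cancel)
    have "sc (2 * Q x e - 2 * T x) x = sc (3 * C x x e - Q x x) e"
      using char_eq_linearised_unit[of x] by (simp add: algebra_simps)
    from arg_cong[OF this, of "sc (inverse (2 * Q x e - 2 * T x))"]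
    have "x = sc (inverse (2 * Q x e - 2 * T x) * (3 * C x x e - Q x x)) e"
      using ne by simp
    with False show False by blast
  qed
qed

lemma Q_unit': "Q e x = T x" using Q_unit Q_sym by metis

lemma C_unit1: "3 * C x x e = Q x x"
  using char_eq_linearised_unit[of x] nontrivial by (simp add: Q_unit)

lemma C_unit2: "3 * C x e e = T x"
proof -
  have "3 * C (x + e) (x + e) e = Q (x + e) (x + e)" by (rule C_unit1)
  then have "2 * (3 * C x e e) = 2 * T x"
    using C_unit1[of x] C_unit1[of e] C_sym1[of e x e]
    by (simp add: expand Q_unit Q_unit' Q_unit_unit algebra_simps)
  then show ?thesis using two by (metis mult_left_cancel)
qed

text \<open>This is the characteristic polynomial of x at k, so by anisotropy it has a root only if
  x is a multiple of e.\<close>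

lemma norm_shift: "C (sc k e - x) (sc k e - x) (sc k e - x) = k^3 - k^2 * T x + k * Q x x - C x x x"
proof -
  have c: "C e x x = C x x e" "C x e x = C x x e" "C e x e = C x e e" "C e e x = C x e e"
    by (metis C_sym1 C_sym2)+
  show ?thesis unfolding C_unit1[of x, symmetric] C_unit2[of x, symmetric]
    by (simp add: expand c power3_eq_cube power2_eq_square algebra_simps)
qed

lemma degree_three:
  assumes x: "\<And>k. x \<noteq> sc k e" and z: "sc a e + sc b x + sc c (x \<odot> x) = 0"
  shows "a = 0 \<and> b = 0 \<and> c = 0"
proof (rule cubic_independent[OF nontrivial x char_eq _ _ z])
  show "x \<odot> (x \<odot> x) = sc t (x \<odot> x) - sc n x" if "x \<odot> x = sc t x - sc n e" for t n
    by (subst that) (simp add: expand)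
  show "x = sc k e" if "k^3 - k^2 * T x + k * Q x x - C x x x = 0" for k
    using aniso[of "sc k e - x"] that by (simp add: norm_shift)
qed

section \<open>The subalgebra generated by one element, and the adjoint\<close>

abbreviation P where "P x a b c \<equiv> sc a e + sc b x + sc c (x \<odot> x)"

lemma cube: "x \<odot> (x \<odot> x) = P x (C x x x) (- Q x x) (T x)"
  by (rule vec_eqI1[OF char_eq[of x], where k = 1]) (simp only: lin_simps, algebra)

lemma square_square: "(x \<odot> x) \<odot> (x \<odot> x) = P x (T x * C x x x) (C x x x - T x * Q x x) (T x ^ 2 - Q x x)"
proof -
  have "(x \<odot> x) \<odot> (x \<odot> x) = x \<odot> (x \<odot> (x \<odot> x))"
    using jordan[of x x] mult_commute by metis
  also have "\<dots> = P x (T x * C x x x) (C x x x - T x * Q x x) (T x ^ 2 - Q x x)"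
    by (rule vec_eqI) (simp only: lin_simps cube expand unit_right, algebra)
  finally show ?thesis .
qed

lemma P_mult: "P x a b c \<odot> P x a' b' c' = P x
    (a * a' + (b * c' + c * b') * C x x x + c * c' * (T x * C x x x))
    (a * b' + b * a' - (b * c' + c * b') * Q x x + c * c' * (C x x x - T x * Q x x))
    (a * c' + b * b' + c * a' + (b * c' + c * b') * T x + c * c' * (T x ^ 2 - Q x x))"
proof -
  have c: "(x \<odot> x) \<odot> x = P x (C x x x) (- Q x x) (T x)" using cube mult_commute by metis
  show ?thesis
    by (rule vec_eqI) (simp only: lin_simps cube c expand unit_right unit square_square, algebra)
qed

definition sharp where "sharp x = x \<odot> x - sc (T x) x + sc (Q x x) e"

lemma sharp_P: "sharp x = P x (Q x x) (- T x) 1" by (simp add: sharp_def algebra_simps)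

text \<open>The adjoint is N(x) / x, with pairwise products of the roots of x as its roots; this
  suggests a cubic with coefficients S, T N and N^2. It holds by computation in K[x], and as e, y,
  y^2 are independent it must coincide with the characteristic equation of y.\<close>

lemma sharp_invariants_generic:
  assumes x: "\<And>k. x \<noteq> sc k e"
  shows "T (sharp x) = Q x x \<and> Q (sharp x) (sharp x) = T x * C x x x"
proof -
  let ?y = "sharp x"
  have y: "?y \<noteq> sc k e" for k
  proof
    assume "?y = sc k e"
    then have "P x (Q x x - k) (- T x) 1 = 0" by (simp add: sharp_P algebra_simps)
    from degree_three[OF x this] show False by simp
  qed
  have 1: "?y \<odot> (?y \<odot> ?y) - sc (Q x x) (?y \<odot> ?y) + sc (T x * C x x x) ?y - sc (C x x x ^ 2) e = 0"
  by (rule vec_eqI) (simp only: sharp_P P_mult lin_simps, algebra)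
  have "P ?y (C x x x ^ 2 - C ?y ?y ?y) (Q ?y ?y - T x * C x x x) (Q x x - T ?y) = 0"
  proof -
    have "P ?y (C x x x ^ 2 - C ?y ?y ?y) (Q ?y ?y - T x * C x x x) (Q x x - T ?y) =
      (?y \<odot> (?y \<odot> ?y) - sc (T ?y) (?y \<odot> ?y) + sc (Q ?y ?y) ?y - sc (C ?y ?y ?y) e)
      - (?y \<odot> (?y \<odot> ?y) - sc (Q x x) (?y \<odot> ?y) + sc (T x * C x x x) ?y - sc (C x x x ^ 2) e)"
      by (rule vec_eqI) (simp only: lin_simps, algebra)
    then show ?thesis using 1 char_eq[of ?y] by simp
  qed
  from degree_three[OF y this] show ?thesis by simp
qed

lemma sharp_invariants: "T (sharp x) = Q x x" "Q (sharp x) (sharp x) = T x * C x x x"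
proof -
  have "T (sharp x) = Q x x \<and> Q (sharp x) (sharp x) = T x * C x x x"
  proof (cases "\<exists>k. x = sc k e")
    case True
    then obtain k where k: "x = sc k e" by blast
    show ?thesis unfolding sharp_def k by (simp add: expand Q_unit_unit algebra_simps)
  next
    case False then show ?thesis using sharp_invariants_generic by blast
  qed
  then show "T (sharp x) = Q x x" "Q (sharp x) (sharp x) = T x * C x x x" by auto
qed

lemma sharp_sharp: "sharp (sharp x) = sc (C x x x) x"
proof -
  have "sharp (sharp x) = sharp x \<odot> sharp x - sc (Q x x) (sharp x) + sc (T x * C x x x) e"
    by (subst sharp_def) (simp add: sharp_invariants)
  also have "\<dots> = sc (C x x x) x"
  by (rule vec_eqI) (simp only: sharp_P P_mult lin_simps, algebra)
  finally show ?thesis .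
qed

lemma T_square: "T (x \<odot> x) = T x ^ 2 - 2 * Q x x"
  using sharp_invariants(1)[of x] by (simp add: sharp_def expand algebra_simps power2_eq_square)

section \<open>Inner derivations and associativity of the trace form\<close>

lemma jordan_linearised:
  "((x \<odot> z) \<odot> y) \<odot> w + ((w \<odot> z) \<odot> y) \<odot> x + ((x \<odot> w) \<odot> y) \<odot> z
   = (x \<odot> z) \<odot> (y \<odot> w) + (w \<odot> z) \<odot> (y \<odot> x) + (x \<odot> w) \<odot> (y \<odot> z)"
proof -
  have 1: "sc 2 (((x \<odot> z) \<odot> y) \<odot> x) + ((x \<odot> x) \<odot> y) \<odot> z
     = sc 2 ((x \<odot> z) \<odot> (y \<odot> x)) + (x \<odot> x) \<odot> (y \<odot> z)" for x z
    by (rule scale_cancelI[OF two], rule vec_eqI3[OF jordan[of "x + z" y] jordan[of "x - z" y] jordan[of z y], where k = 1 and k' = "-1" and k'' = "-2"])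
      (simp only: expand lin_simps mult_commute[of z x], algebra)
  show ?thesis
    by (rule scale_cancelI[OF two], rule vec_eqI3[OF 1[of "x + w" z] 1[of x z] 1[of w z], where k = 1 and k' = "-1" and k'' = "-1"])
      (simp only: expand lin_simps mult_commute[of w x], algebra)
qed

definition comm where "comm a b x = a \<odot> (b \<odot> x) - b \<odot> (a \<odot> x)"

lemma comm_linear: "comm a b (u + v) = comm a b u + comm a b v" "comm a b (u - v) = comm a b u - comm a b v"
    "comm a b (sc k u) = sc k (comm a b u)" "comm a b e = 0" "comm a b 0 = 0"
  by (simp_all add: comm_def expand scale_right_diff_distrib mult_commute[of b a])

text \<open>Exchanging y and w leaves the right-hand side of the linearised Jordan identity
  unchanged; equating the two left-hand sides is the Leibniz rule.\<close>

lemma comm_derivation: "comm w y (x \<odot> z) = comm w y x \<odot> z + x \<odot> comm w y z"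
proof -
  have "comm w y (x \<odot> z) = ((x \<odot> z) \<odot> y) \<odot> w - ((x \<odot> z) \<odot> w) \<odot> y"
    unfolding comm_def using mult_commute by metis
  also have "\<dots> = ((y \<odot> z) \<odot> w) \<odot> x - ((w \<odot> z) \<odot> y) \<odot> x + (((x \<odot> y) \<odot> w) \<odot> z - ((x \<odot> w) \<odot> y) \<odot> z)"
  proof -
    have r: "(x \<odot> z) \<odot> (y \<odot> w) + (w \<odot> z) \<odot> (y \<odot> x) + (x \<odot> w) \<odot> (y \<odot> z)
      = (x \<odot> z) \<odot> (w \<odot> y) + (y \<odot> z) \<odot> (w \<odot> x) + (x \<odot> y) \<odot> (w \<odot> z)"
      using mult_commute[of y w] mult_commute[of "w \<odot> z" "y \<odot> x"] mult_commute[of y x]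
        mult_commute[of "y \<odot> z" "w \<odot> x"] mult_commute[of w x] by (simp add: add.assoc add.commute)
    have "((x \<odot> z) \<odot> y) \<odot> w + ((w \<odot> z) \<odot> y) \<odot> x + ((x \<odot> w) \<odot> y) \<odot> z
       = ((x \<odot> z) \<odot> w) \<odot> y + ((y \<odot> z) \<odot> w) \<odot> x + ((x \<odot> y) \<odot> w) \<odot> z"
      using jordan_linearised[of x z y w] jordan_linearised[of x z w y] r by simp
    then show ?thesis by (rule vec_eqI1[where k = 1]) (simp only: lin_simps, algebra)
  qed
  also have "\<dots> = comm w y x \<odot> z + x \<odot> comm w y z"
  proof -
    have "((y \<odot> z) \<odot> w) \<odot> x = x \<odot> (w \<odot> (y \<odot> z))" "((w \<odot> z) \<odot> y) \<odot> x = x \<odot> (y \<odot> (w \<odot> z))"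
      "((x \<odot> y) \<odot> w) \<odot> z = (w \<odot> (y \<odot> x)) \<odot> z" "((x \<odot> w) \<odot> y) \<odot> z = (y \<odot> (w \<odot> x)) \<odot> z"
      by (metis mult_commute)+
    then show ?thesis by (simp add: comm_def mult_diff)
  qed
  finally show ?thesis .
qed

text \<open>A derivation D applied to the characteristic equation of x treats its coefficients as
  constants. Subtracting the result from the linearised equation in the direction D x leaves a
  quadratic relation for x with leading coefficient T(D x).\<close>

lemma T_comm: "T (comm a b x) = 0"
proof (cases "\<exists>k. x = sc k e")
  case True
  then obtain k where "x = sc k e" by blast
  then show ?thesis by (simp add: comm_linear expand)
next
  case False
  let ?y = "comm a b x"
  have d2: "comm a b (x \<odot> x) = sc 2 (x \<odot> ?y)"
    unfolding comm_derivation[of a b x x] mult_commute[of "comm a b x" x]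
    by (rule vec_eqI) (simp only: lin_simps, algebra)
  have d3: "comm a b (x \<odot> (x \<odot> x)) = ?y \<odot> (x \<odot> x) + sc 2 (x \<odot> (x \<odot> ?y))"
    unfolding comm_derivation[of a b x "x \<odot> x"] d2 by (simp only: mult_scale_right)
  have "comm a b (x \<odot> (x \<odot> x) - sc (T x) (x \<odot> x) + sc (Q x x) x - sc (C x x x) e) = 0"
    unfolding char_eq by (rule comm_linear)
  then have "?y \<odot> (x \<odot> x) + sc 2 (x \<odot> (x \<odot> ?y)) - sc (2 * T x) (x \<odot> ?y) + sc (Q x x) ?y = 0"
    unfolding comm_linear d2 d3 by (simp add: mult.commute)
  moreover have "?y \<odot> (x \<odot> x) + sc 2 (x \<odot> (x \<odot> ?y)) - sc (2 * T x) (x \<odot> ?y) + sc (Q x x) ?y =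
     P x (3 * C x x ?y) (- 2 * Q x ?y) (T ?y)"
    by (rule vec_eqI1[OF char_eq_linearised[of ?y x], where k = 1]) (simp only: lin_simps, algebra)
  ultimately have "P x (3 * C x x ?y) (- 2 * Q x ?y) (T ?y) = 0" by simp
  from degree_three[OF _ this] False show ?thesis by blast
qed

lemma T_assoc: "T (a \<odot> (b \<odot> x)) = T (b \<odot> (a \<odot> x))"
  using T_comm[of a b x] by (simp add: comm_def minus_rules)

lemma Q_polar: "2 * Q x y = T x * T y - T (x \<odot> y)"
proof -
  have "T ((x + y) \<odot> (x + y)) = T (x + y) ^ 2 - 2 * Q (x + y) (x + y)" by (rule T_square)
  then have "2 * T (x \<odot> y) = 2 * (T x * T y) - 2 * (2 * Q x y)"
    using T_square[of x] T_square[of y] mult_commute[of y x] Q_sym[of y x]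
    by (simp add: expand algebra_simps power2_eq_square)
  then have "2 * (2 * Q x y) = 2 * (T x * T y - T (x \<odot> y))" by (simp add: algebra_simps)
  then show ?thesis using two by (metis mult_left_cancel)
qed

text \<open>Trace of the linearised characteristic equation, its cubic terms collected by
  associativity of the trace form. The factor 3 to be cancelled is T e.\<close>

lemma norm_linearised: "3 * C x x y = T (sharp x \<odot> y)"
proof -
  have a: "T (x \<odot> (x \<odot> y)) = T (y \<odot> (x \<odot> x))" using T_assoc[of x y x] mult_commute by metis
  have "T (y \<odot> (x \<odot> x) + sc 2 (x \<odot> (x \<odot> y)) - sc (T y) (x \<odot> x) - sc (2 * T x) (x \<odot> y)
    + sc (2 * Q x y) x + sc (Q x x) y - sc (3 * C x x y) e) = 0"
    unfolding char_eq_linearised by (rule minus_rules)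
  then have z: "T (y \<odot> (x \<odot> x)) + 2 * T (y \<odot> (x \<odot> x)) - T y * T (x \<odot> x) - 2 * T x * T (x \<odot> y)
      + 2 * Q x y * T x + Q x x * T y - 3 * C x x y * 3 = 0"
    by (simp only: expand a T_unit)
  have r: "T (sharp x \<odot> y) = T (y \<odot> (x \<odot> x)) - T x * T (x \<odot> y) + Q x x * T y"
    unfolding sharp_def expand mult_commute[of "x \<odot> x" y] unit ..
  have "3 * (3 * C x x y) = 3 * T (sharp x \<odot> y)
    - (T (y \<odot> (x \<odot> x)) + 2 * T (y \<odot> (x \<odot> x)) - T y * T (x \<odot> x) - 2 * T x * T (x \<odot> y)
      + 2 * Q x y * T x + Q x x * T y - 3 * C x x y * 3)"
    unfolding r T_square[of x] Q_polar[of x y] by (simp add: algebra_simps power2_eq_square)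
  also have "\<dots> = 3 * T (sharp x \<odot> y)" unfolding z by simp
  finally show ?thesis using three by (metis mult_left_cancel)
qed

end

section \<open>Cubic norm structures and their subalgebras\<close>

lemma mult_cancelI: "(c::'k::field) \<noteq> 0 \<Longrightarrow> c * a = c * b \<Longrightarrow> a = b"
  by simp

text \<open>Only the cross product and the trace form are primitive. The adjoint is half of x
  crossed with itself, and the norm is recovered from it by Euler's formula for a cubic
  form.\<close>

locale cubic_norm = finite_dimensional_vector_space sc Bas
  for sc :: "'k::field \<Rightarrow> 'a::ab_group_add \<Rightarrow> 'a" and Bas :: "'a set" +
  fixes cr :: "'a \<Rightarrow> 'a \<Rightarrow> 'a" (infixl "\<star>" 70) and t :: "'a \<Rightarrow> 'a \<Rightarrow> 'k" and e :: 'a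
  assumes two [simp]: "(2::'k) \<noteq> 0" and three [simp]: "(3::'k) \<noteq> 0"
    and cr_add_left: "(x + y) \<star> z = x \<star> z + y \<star> z"
    and cr_scale_left: "sc c x \<star> y = sc c (x \<star> y)"
    and cr_commute: "x \<star> y = y \<star> x"
    and t_add_left: "t (x + y) z = t x z + t y z"
    and t_scale_left: "t (sc c x) y = c * t x y"
    and t_commute: "t x y = t y x"
    and t_cr: "t (x \<star> y) z = t x (y \<star> z)"
    and cr_unit: "e \<star> x = sc (t x e) e - x"
    and t_unit [simp]: "t e e = 3"
    and adjoint_identity: "sc (1/2) (sc (1/2) (x \<star> x) \<star> sc (1/2) (x \<star> x)) = sc (t (sc (1/2) (x \<star> x)) x / 3) x"
    and anisotropic: "t (sc (1/2) (x \<star> x)) x = 0 \<Longrightarrow> x = 0"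
begin

definition ad where "ad x = sc (1/2) (x \<star> x)"
definition N where "N x = t (ad x) x / 3"
definition T where "T x = t x e"
definition n3 where "n3 x y z = t (x \<star> y) z"

lemma six [simp]: "(6::'k) \<noteq> 0" 
proof -
  have "(6::'k) = 2 * 3" by simp
  then show ?thesis using two three by (metis mult_eq_0_iff)
qed

lemma four [simp]: "(4::'k) \<noteq> 0" 
proof -
  have "(4::'k) = 2 * 2" by simp
  then show ?thesis using two by (metis mult_eq_0_iff)
qed

lemma cr_add_right: "z \<star> (x + y) = z \<star> x + z \<star> y" by (metis cr_add_left cr_commute)
lemma cr_scale_right: "x \<star> sc c y = sc c (x \<star> y)" by (metis cr_scale_left cr_commute)
lemma t_add_right: "t z (x + y) = t z x + t z y" by (metis t_add_left t_commute)
lemma t_scale_right: "t x (sc c y) = c * t x y" by (metis t_scale_left t_commute)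
lemma functional_t: "functional sc (t x)" "functional sc (\<lambda>y. t y x)"
  by (simp_all add: functional_def t_add_right t_scale_right t_add_left t_scale_left)
lemmas t_diff = lin_simps(3-5)[OF functional_t(1)] lin_simps(3-5)[OF functional_t(2)]
lemma cr_diff: "(x - y) \<star> z = x \<star> z - y \<star> z" "z \<star> (x - y) = z \<star> x - z \<star> y"
  "(- x) \<star> z = - (x \<star> z)" "z \<star> (- x) = - (z \<star> x)" "0 \<star> z = 0" "z \<star> 0 = 0"
proof -
  show z: "0 \<star> z = 0" "z \<star> 0 = 0" for z by (metis cr_scale_left cr_scale_right scale_zero_left)+
  have m: "(- x) \<star> z = - (x \<star> z)" "z \<star> (- x) = - (z \<star> x)" for x z
    using cr_scale_left[of "-1" x z] cr_scale_right[of z "-1" x] by simp_all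
  show "(- x) \<star> z = - (x \<star> z)" "z \<star> (- x) = - (z \<star> x)" by (fact m)+
  show "(x - y) \<star> z = x \<star> z - y \<star> z" "z \<star> (x - y) = z \<star> x - z \<star> y"
    using cr_add_left[of x "-y" z] cr_add_right[of z x "-y"] by (simp_all add: m)
qed

lemmas bilin = cr_add_left cr_add_right cr_scale_left cr_scale_right cr_diff
  t_add_left t_add_right t_scale_left t_scale_right t_diff

lemma T_linear: "T (x + y) = T x + T y" "T (sc c x) = c * T x" "T (x - y) = T x - T y" "T (- x) = - T x" "T 0 = 0"
  by (simp_all add: T_def bilin)
lemma T_e [simp]: "T e = 3" by (simp add: T_def)

lemma cr_self: "x \<star> x = sc 2 (ad x)" by (simp add: ad_def)
lemma ad_add: "ad (x + y) = ad x + x \<star> y + ad y"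
  by (rule vec_eqI) (simp only: lin_simps ad_def bilin cr_commute[of y x], simp add: field_simps)
lemma ad_scale: "ad (sc c x) = sc (c^2) (ad x)"
  by (simp add: ad_def bilin power2_eq_square)
lemma ad_minus: "ad (- x) = ad x" using ad_scale[of "-1" x] by simp
lemma ad_diff: "ad (x - y) = ad x - x \<star> y + ad y"
  using ad_add[of x "-y"] by (simp add: bilin ad_minus)
lemma ad_zero [simp]: "ad 0 = 0" by (simp add: ad_def bilin)

lemma n3_sym: "n3 x y z = n3 y x z" "n3 x y z = n3 x z y"
  unfolding n3_def by (metis cr_commute, metis cr_commute t_commute t_cr)

lemma t_ad: "t (ad x) y = n3 x x y / 2" by (simp add: n3_def ad_def bilin)
lemma n3_diag: "n3 x x y = 2 * t (ad x) y" by (simp add: t_ad)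
lemma N_n3: "n3 x x x = 6 * N x" by (simp add: N_def t_ad)
lemma t_ad_self: "t (ad x) x = 3 * N x" by (simp add: N_def)

lemma n3_linear: "n3 (x + y) z w = n3 x z w + n3 y z w" "n3 z (x + y) w = n3 z x w + n3 z y w"
  "n3 z w (x + y) = n3 z w x + n3 z w y" "n3 (sc c x) z w = c * n3 x z w"
  "n3 z (sc c x) w = c * n3 z x w" "n3 z w (sc c x) = c * n3 z w x"
  "n3 (x - y) z w = n3 x z w - n3 y z w" "n3 z (x - y) w = n3 z x w - n3 z y w"
  "n3 z w (x - y) = n3 z w x - n3 z w y" "n3 (- x) z w = - n3 x z w" "n3 z (- x) w = - n3 z x w"
  "n3 z w (- x) = - n3 z w x" "n3 0 z w = 0" "n3 z 0 w = 0" "n3 z w 0 = 0"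
  by (simp_all add: n3_def bilin)

lemma t_cr_ad: "t (x \<star> y) x = 2 * t (ad x) y" using n3_diag[of x y] n3_sym n3_def by metis

lemma N_add: "N (x + y) = N x + t (ad x) y + t x (ad y) + N y"
proof -
  have "6 * N (x + y) = n3 (x + y) (x + y) (x + y)" by (simp add: N_n3)
  also have "\<dots> = n3 x x x + 3 * n3 x x y + 3 * n3 y y x + n3 y y y"
  proof -
    have "n3 x y x = n3 x x y" "n3 y x x = n3 x x y" "n3 y x y = n3 y y x" "n3 x y y = n3 y y x"
      by (metis n3_sym)+
    then show ?thesis by (simp add: n3_linear algebra_simps)
  qed
  also have "\<dots> = 6 * (N x + t (ad x) y + t x (ad y) + N y)"
    unfolding N_n3 n3_diag t_commute[of x "ad y"] by (simp add: algebra_simps)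
  finally show ?thesis by (rule mult_cancelI[OF six])
qed
lemma N_scale: "N (sc c x) = c^3 * N x" by (simp add: N_def ad_scale bilin power3_eq_cube power2_eq_square)
lemma N_zero [simp]: "N 0 = 0" by (simp add: N_def bilin)
lemma N_minus: "N (- x) = - N x" by (simp add: N_def ad_minus bilin)
lemma N_diff: "N (x - y) = N x - t (ad x) y + t x (ad y) - N y"
  using N_add[of x "- y"] by (simp add: N_minus ad_minus bilin)
lemma N_eq_0 [simp]: "N x = 0 \<longleftrightarrow> x = 0" using anisotropic[of x] by (auto simp: N_def ad_def bilin)

lemma ad_ad: "ad (ad x) = sc (N x) x" using adjoint_identity[of x] by (simp add: ad_def N_def)

lemma e_nonzero: "e \<noteq> 0"
proof
  assume "e = 0" then have "t e e = 0" by (simp add: bilin) then show False by simp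
qed
lemma cr_e: "e \<star> x = sc (T x) e - x" "x \<star> e = sc (T x) e - x"
  unfolding T_def using cr_unit cr_commute by metis+
lemma ad_e [simp]: "ad e = e" 
  by (rule vec_eqI) (simp only: ad_def cr_e lin_simps T_e, simp add: field_simps)
lemma N_e [simp]: "N e = 1" by (simp add: N_def)

lemma t_nondegenerate: "x \<noteq> 0 \<Longrightarrow> \<exists>y. t x y \<noteq> 0"
  by (metis N_def N_eq_0 divide_eq_0_iff t_commute)

lemma N_ad: "N (ad x) = N x ^ 2"
proof -
  have "3 * N (ad x) = 3 * N x ^ 2"
    unfolding t_ad_self[of "ad x", symmetric] ad_ad bilin t_commute[of x "ad x"] t_ad_self by (simp add: power2_eq_square)
  then show ?thesis by (rule mult_cancelI[OF three])
qed

text \<open>The component of bidegree (2,2) of the adjoint identity; adding the cases x + y and x -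
  y removes the odd ones.\<close>

lemma ad_cr: "ad (x \<star> y) = sc (t (ad x) y) y + sc (t x (ad y)) x - ad x \<star> ad y"
proof (rule scale_cancelI[OF two], rule vec_eqI2[OF ad_ad[of "x + y"] ad_ad[of "x - y"], where k = 1 and k' = 1])
  fix g :: "'a \<Rightarrow> 'k" assume g: "functional sc g"
  show "g (sc 2 (ad (x \<star> y))) - g (sc 2 (sc (t (ad x) y) y + sc (t x (ad y)) x - ad x \<star> ad y)) =
         1 * (g (ad (ad (x + y))) - g (sc (N (x + y)) (x + y))) +
         1 * (g (ad (ad (x - y))) - g (sc (N (x - y)) (x - y)))"
    by (simp only: lin_simps[OF g] ad_add ad_diff N_add N_diff bilin ad_ad, algebra)
qed

text \<open>The component of bidegree (3,1) of the adjoint identity. The weights 6, -2, -1 at x + y,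
  x - y, x + 2y cancel the bidegrees (2,2) and (1,3) and leave 6 times the wanted one; the pure
  terms are covered by \<open>ad_ad\<close>.\<close>

lemma ad_cr_cr: "ad x \<star> (x \<star> y) = sc (N x) y + sc (t (ad x) y) x"
proof (rule scale_cancelI[OF six], rule vec_eqI3[OF ad_ad[of "x + y"] ad_ad[of "x - y"] ad_ad[of "x + sc 2 y"],
      where k = 6 and k' = "-2" and k'' = "-1"])
  fix g :: "'a \<Rightarrow> 'k" assume g: "functional sc g"
  show "g (sc 6 (ad x \<star> (x \<star> y))) - g (sc 6 (sc (N x) y + sc (t (ad x) y) x)) =
         6 * (g (ad (ad (x + y))) - g (sc (N (x + y)) (x + y))) +
         -2 * (g (ad (ad (x - y))) - g (sc (N (x - y)) (x - y))) +
         -1 * (g (ad (ad (x + sc 2 y))) - g (sc (N (x + sc 2 y)) (x + sc 2 y)))"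
    by (simp only: lin_simps[OF g] ad_add ad_diff ad_scale N_add N_scale N_diff bilin ad_ad, algebra)
qed

text \<open>The preceding identity at \<open>ad x\<close>, where \<open>ad (ad x)\<close> is N(x) x,
  with one factor N(x) cancelled.\<close>

lemma cr_ad_cr: "x \<star> (ad x \<star> y) = sc (N x) y + sc (t x y) (ad x)"
proof (cases "x = 0")
  case True then show ?thesis by (simp add: bilin)
next
  case False
  have "sc (N x) (x \<star> (ad x \<star> y)) = sc (N x) (sc (N x) y + sc (t x y) (ad x))"
    using ad_cr_cr[of "ad x" y] unfolding ad_ad N_ad bilin
    by (simp add: scale_right_distrib power2_eq_square)
  then show ?thesis using False by simp
qed

lemma ad_cr_cr_polar: "ad x \<star> (z \<star> y) + (x \<star> z) \<star> (x \<star> y) =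
    sc (t (ad x) z) y + sc (t (x \<star> z) y) x + sc (t (ad x) y) z"
proof (rule scale_cancelI[OF two], rule vec_eqI3[OF ad_cr_cr[of "x + z" y] ad_cr_cr[of "x - z" y] ad_cr_cr[of z y],
    where k = 1 and k' = "-1" and k'' = "-2"])
  fix g :: "'a \<Rightarrow> 'k" assume g: "functional sc g"
  show "g (sc 2 (ad x \<star> (z \<star> y) + (x \<star> z) \<star> (x \<star> y))) -
         g (sc 2 (sc (t (ad x) z) y + sc (t (x \<star> z) y) x + sc (t (ad x) y) z)) =
         1 * (g (ad (x + z) \<star> ((x + z) \<star> y)) - g (sc (N (x + z)) y + sc (t (ad (x + z)) y) (x + z))) +
         -1 * (g (ad (x - z) \<star> ((x - z) \<star> y)) - g (sc (N (x - z)) y + sc (t (ad (x - z)) y) (x - z))) +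
         -2 * (g (ad z \<star> (z \<star> y)) - g (sc (N z) y + sc (t (ad z) y) z))"
    by (simp only: lin_simps[OF g] ad_add ad_diff N_add N_diff bilin, algebra)
qed

lemma T_cr: "T (x \<star> y) = T x * T y - t x y"
  by (simp add: T_def t_cr cr_e bilin)
lemma T_ad: "2 * T (ad x) = T x ^ 2 - t x x"
  using T_cr[of x x] unfolding cr_self T_linear by (simp add: power2_eq_square)

text \<open>The Jordan product, solved from the formula that expresses the cross product as the
  polarised adjoint.\<close>

definition jm where "jm x y = sc (1/2) (x \<star> y + sc (T x) y + sc (T y) x - sc (T x * T y - t x y) e)"

lemma jm_commute: "jm x y = jm y x" by (simp add: jm_def cr_commute[of y x] t_commute[of y x] algebra_simps)
lemma jm_self: "jm x x = ad x + sc (T x) x - sc (T (ad x)) e"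
proof -
  have T: "T x * T x - t x x = 2 * T (ad x)" unfolding T_ad by (simp add: power2_eq_square)
  show ?thesis unfolding jm_def cr_self T by (rule vec_eqI) (simp only: lin_simps, simp add: field_simps)
qed
lemma jm_linear: "jm (x + y) z = jm x z + jm y z" "jm z (x + y) = jm z x + jm z y"
  "jm (sc c x) z = sc c (jm x z)" "jm z (sc c x) = sc c (jm z x)"
  by (rule vec_eqI, simp only: jm_def lin_simps bilin T_linear, simp add: field_simps)+
lemma jm_e [simp]: "jm e x = x" "jm x e = x"
  by (rule vec_eqI, simp only: jm_def lin_simps cr_e T_e, simp add: field_simps T_def t_commute[of e])+

lemma cube_jm: "jm x (jm x x) - sc (T x) (jm x x) + sc (T (ad x)) x - sc (N x) e = 0"
proof -
  have a: "x \<star> ad x = sc (T x * T (ad x) - N x) e - sc (T (ad x)) x - sc (T x) (ad x)"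
    using ad_cr_cr[of x e] unfolding cr_e bilin cr_commute[of "ad x" x] T_def[of "ad x", symmetric]
    by (rule vec_eqI1[where k = "-1"]) (simp only: lin_simps, algebra)
  have T2: "t x x = T x ^ 2 - 2 * T (ad x)" unfolding T_ad by simp
  have tx: "t x (ad x) = 3 * N x" "t x e = T x" by (metis t_ad_self t_commute) (simp add: T_def)
  show ?thesis unfolding jm_self
    by (rule vec_eqI) (simp only: jm_def bilin a cr_self cr_e T_linear T_e T2 tx lin_simps, simp add: field_simps power2_eq_square)
qed

text \<open>The sign makes \<open>e\<close> act as the identity: crossing \<open>e\<close> with a
  vector of trace zero gives its negative.\<close>

definition act (infixr "\<rhd>" 75) where "a \<rhd> c = - (cr a c)"

lemma act_linear: "(a + b) \<rhd> c = a \<rhd> c + b \<rhd> c" "a \<rhd> (c + d) = a \<rhd> c + a \<rhd> d"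
  "sc k a \<rhd> c = sc k (a \<rhd> c)" "a \<rhd> sc k c = sc k (a \<rhd> c)"
  "(a - b) \<rhd> c = a \<rhd> c - b \<rhd> c" "a \<rhd> (c - d) = a \<rhd> c - a \<rhd> d"
  "(- a) \<rhd> c = - (a \<rhd> c)" "a \<rhd> (- c) = - (a \<rhd> c)" "0 \<rhd> c = 0" "a \<rhd> 0 = 0"
  by (simp_all add: act_def bilin)

lemma act_adjoint: "t (a \<rhd> c) d = t c (a \<rhd> d)"
  unfolding act_def bilin t_cr by (metis cr_commute t_commute t_cr)

definition perp where "perp S = {c. \<forall>b\<in>S. t b c = 0}"

lemma perp_subspace: "subspace (perp S)"
  by (rule subspaceI) (auto simp: perp_def bilin)

lemma T_jm: "T (jm x y) = t x y"
proof (rule mult_cancelI[OF two])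
  show "2 * T (jm x y) = 2 * t x y"
    by (simp add: jm_def T_linear T_cr)
qed

lemma degree_three:
  assumes x: "\<And>k. x \<noteq> sc k e" and z: "sc a e + sc b x + sc c (ad x) = 0"
  shows "a = 0 \<and> b = 0 \<and> c = 0"
proof -
  have "sc (a - c * (- T (ad x))) e + sc (b - c * T x) x + sc c (jm x x) = 0"
    unfolding jm_self by (rule vec_eqI1[OF z, where k = 1]) (simp only: lin_simps, algebra)
  then have "a - c * (- T (ad x)) = 0 \<and> b - c * T x = 0 \<and> c = 0"
  proof (rule cubic_independent[OF e_nonzero x cube_jm, rotated 2])
    show "jm x (jm x x) = sc t (jm x x) - sc n x" if "jm x x = sc t x - sc n e" for t n
      by (subst that) (simp only: jm_linear scale_minus_left[symmetric] diff_conv_add_uminus jm_e)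
    show "x = sc k e" if k: "k^3 - k^2 * T x + k * T (ad x) - N x = 0" for k
    proof -
      have "N (sc k e + - x) = 0"
        using k unfolding N_add by (simp add: N_scale N_minus ad_scale ad_minus bilin T_def t_commute[of e] power2_eq_square)
      then show ?thesis by simp
    qed
  qed
  then show ?thesis by auto
qed

end

locale norm_subalgebra = cubic_norm +
  fixes B :: "'b set"
  assumes B_subspace: "subspace B" and e_B [simp]: "e \<in> B" and cr_B: "a \<in> B \<Longrightarrow> b \<in> B \<Longrightarrow> cr a b \<in> B"
begin

lemmas B_closed = subspace_add[OF B_subspace] subspace_diff[OF B_subspace] subspace_neg[OF B_subspace]
  subspace_scale[OF B_subspace] subspace_0[OF B_subspace] e_B cr_B

lemma ad_B: "a \<in> B \<Longrightarrow> ad a \<in> B" by (simp add: ad_def B_closed)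
lemma jm_B: "a \<in> B \<Longrightarrow> b \<in> B \<Longrightarrow> jm a b \<in> B" by (simp add: jm_def B_closed)
lemmas B_intros [simp] = B_closed ad_B jm_B

section \<open>The orthogonal complement as a special representation\<close>

abbreviation "C \<equiv> perp B"

lemma C_I: "(\<And>b. b \<in> B \<Longrightarrow> t b c = 0) \<Longrightarrow> c \<in> C" by (simp add: perp_def)
lemma C_D: "c \<in> C \<Longrightarrow> b \<in> B \<Longrightarrow> t b c = 0" "c \<in> C \<Longrightarrow> b \<in> B \<Longrightarrow> t c b = 0"
  using t_commute by (auto simp: perp_def)
lemmas C_subspace = perp_subspace[of B]
lemmas C_closed [simp] = subspace_add[OF C_subspace] subspace_diff[OF C_subspace] subspace_neg[OF C_subspace]
  subspace_scale[OF C_subspace] subspace_0[OF C_subspace]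

lemma T_C: "c \<in> C \<Longrightarrow> T c = 0" by (simp add: T_def C_D)

lemma act_closed [simp]: "a \<in> B \<Longrightarrow> c \<in> C \<Longrightarrow> a \<rhd> c \<in> C"
  unfolding act_def by (rule C_I) (simp add: bilin C_D flip: t_cr)

lemma act_e: "c \<in> C \<Longrightarrow> e \<rhd> c = c" by (simp add: act_def cr_e T_C)

lemma act_ad: assumes "a \<in> B" "c \<in> C" shows "a \<rhd> ad a \<rhd> c = sc (N a) c" "ad a \<rhd> a \<rhd> c = sc (N a) c"
  using assms by (simp_all add: act_def bilin cr_ad_cr ad_cr_cr C_D)

lemma act_inj: "a \<in> B \<Longrightarrow> c \<in> C \<Longrightarrow> a \<rhd> c = 0 \<Longrightarrow> a = 0 \<or> c = 0"
  by (metis act_ad(2) act_linear(10) scale_eq_0_iff N_eq_0)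

text \<open>The relation ad x \<rhd> x \<rhd> c = N(x) c at x = a + e and x = a shows that squares
  act as squares; polarisation gives the symmetrised product.\<close>

lemma act_jm: assumes "a \<in> B" "b \<in> B" "c \<in> C" shows "a \<rhd> b \<rhd> c + b \<rhd> a \<rhd> c = sc 2 (jm a b \<rhd> c)"
proof -
  have sq: "a \<rhd> a \<rhd> c = jm a a \<rhd> c" if "a \<in> B" for a
  proof (rule vec_eqI2[OF act_ad(2)[of "a + e" c] act_ad(2)[of a c], where k = "-1" and k' = 1])
    fix g :: "'b \<Rightarrow> 'a" assume g: "functional sc g"
    show "g (a \<rhd> a \<rhd> c) - g (jm a a \<rhd> c) = -1 * (g (ad (a + e) \<rhd> (a + e) \<rhd> c) - g (sc (N (a + e)) c)) +
        1 * (g (ad a \<rhd> a \<rhd> c) - g (sc (N a) c))"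
      by (simp only: ad_add N_add ad_e cr_e act_linear act_e assms that act_closed jm_self lin_simps[OF g] T_def[symmetric] t_commute[of e] N_e C_closed e_B, algebra)
  qed (use assms that in auto)
  show ?thesis
  proof (rule vec_eqI3[OF sq[of "a + b"] sq[of a] sq[of b], where k = 1 and k' = "-1" and k'' = "-1"])
    fix g :: "'b \<Rightarrow> 'a" assume g: "functional sc g"
    show "g (a \<rhd> b \<rhd> c + b \<rhd> a \<rhd> c) - g (sc 2 (jm a b \<rhd> c)) =
         1 * (g ((a + b) \<rhd> (a + b) \<rhd> c) - g (jm (a + b) (a + b) \<rhd> c)) +
         -1 * (g (a \<rhd> a \<rhd> c) - g (jm a a \<rhd> c)) + -1 * (g (b \<rhd> b \<rhd> c) - g (jm b b \<rhd> c))"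
      by (simp only: act_linear jm_linear jm_commute[of b a] lin_simps[OF g], algebra)
  qed (use assms in auto)
qed

lemma act_sq: assumes "a \<in> B" "c \<in> C" shows "jm a a \<rhd> c = a \<rhd> a \<rhd> c"
  by (rule scale_cancelI[OF two], rule vec_eqI1[OF act_jm[OF assms(1) assms], where k = "-1"])
    (simp only: lin_simps, algebra)

lemma act_ad_expand: assumes "a \<in> B" "c \<in> C"
  shows "ad a \<rhd> c = a \<rhd> a \<rhd> c - sc (T a) (a \<rhd> c) + sc (T (ad a)) c"
  using act_sq[OF assms] assms unfolding jm_self by (simp add: act_linear act_e algebra_simps)

text \<open>In \<open>ad_cr\<close> for a and a vector x of \<open>C\<close> the term with t (ad a)
  x vanishes by orthogonality, and pairing with z kills the multiple of a.\<close>

lemma n3_act: assumes "a \<in> B" "x \<in> C" "y \<in> C" "z \<in> C"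
  shows "n3 (a \<rhd> x) (a \<rhd> y) z = n3 x y (ad a \<rhd> z)"
proof -
  have q: "n3 (a \<rhd> x) (a \<rhd> x) z = n3 x x (ad a \<rhd> z)" if "x \<in> C" for x
  proof -
    have "t (ad (cr a x)) z = - t (cr (ad a) (ad x)) z"
      using that assms by (simp add: ad_cr bilin C_D)
    also have "\<dots> = t (ad x) (ad a \<rhd> z)" unfolding act_def bilin by (metis cr_commute t_cr)
    finally show ?thesis unfolding n3_diag by (simp add: act_def ad_minus)
  qed
  have "2 * n3 (a \<rhd> x) (a \<rhd> y) z = 2 * n3 x y (ad a \<rhd> z)"
    using q[of "x + y"] q[of x] q[of y] assms
    by (simp add: act_linear n3_linear n3_sym(1)[of "a \<rhd> y" "a \<rhd> x"] n3_sym(1)[of y x])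
  then show ?thesis by (rule mult_cancelI[OF two])
qed

lemma n3_act_polar: assumes "a \<in> B" "b \<in> B" "x \<in> C" "y \<in> C" "z \<in> C"
  shows "n3 (a \<rhd> x) (b \<rhd> y) z + n3 (b \<rhd> x) (a \<rhd> y) z = n3 x y (cr a b \<rhd> z)"
  using n3_act[of "a + b" x y z] n3_act[of a x y z] n3_act[of b x y z] assms
  by (simp add: act_linear n3_linear ad_add add.commute)

text \<open>The infinitesimal form of \<open>n3_act\<close>, from b = e in its polarisation: T a is
  the trace of the operator a as seen by the cubic form.\<close>

lemma n3_act_sum: assumes "a \<in> B" "x \<in> C" "y \<in> C" "z \<in> C"
  shows "n3 (a \<rhd> x) y z + n3 x (a \<rhd> y) z + n3 x y (a \<rhd> z) = T a * n3 x y z"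
  using n3_act_polar[of a e x y z] assms by (simp add: act_e cr_e act_linear n3_linear)

lemma n3_nondegenerate: "z \<in> C \<Longrightarrow> (\<And>x y. x \<in> C \<Longrightarrow> y \<in> C \<Longrightarrow> n3 x y z = 0) \<Longrightarrow> z = 0"
  by (metis N_n3 N_eq_0 six mult_eq_0_iff)

lemma B_C_disjoint: "b \<in> B \<Longrightarrow> b \<in> C \<Longrightarrow> b = 0"
  using C_D(1)[of b "ad b"] ad_B t_ad_self[of b] by simp

text \<open>Bounds the codimension of an orthogonal complement. A condition not implied by the
  earlier ones costs one vector \<open>w\<close> that violates it and satisfies them.\<close>

lemma perp_finite:
  assumes "finite S"
  shows "\<exists>F. finite F \<and> card F \<le> card S \<and> (\<forall>x. \<exists>f\<in>span F. \<forall>s\<in>S. t s (x - f) = 0)"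
  using assms
proof induction
  case empty
  show ?case by (intro exI[of _ "{}"]) auto
next
  case (insert s S)
  then obtain F where F: "finite F" "card F \<le> card S" "\<And>x. \<exists>f\<in>span F. \<forall>s\<in>S. t s (x - f) = 0" by blast
  show ?case
  proof (cases "\<exists>w. (\<forall>s\<in>S. t s w = 0) \<and> t s w \<noteq> 0")
    case False
    then have "\<forall>x. \<exists>f\<in>span F. \<forall>s\<in>insert s S. t s (x - f) = 0" using F(3) by fastforce
    moreover have "card F \<le> card (insert s S)" using F(2) insert.hyps by simp
    ultimately show ?thesis using F(1) by blast
  next
    case True
    then obtain w where w: "\<forall>s\<in>S. t s w = 0" "t s w \<noteq> 0" by blast
    have "\<exists>f\<in>span (insert w F). \<forall>s\<in>insert s S. t s (x - f) = 0" for x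
    proof -
      obtain f where f: "f \<in> span F" "\<forall>s\<in>S. t s (x - f) = 0" using F(3) by blast
      let ?f = "f + sc (t s (x - f) / t s w) w"
      have "?f \<in> span (insert w F)"
        by (meson f(1) insertI1 span_add span_base span_mono span_scale subset_insertI subsetD)
      moreover have "\<forall>s\<in>insert s S. t s (x - ?f) = 0"
        using f(2) w by (auto simp: bilin)
      ultimately show ?thesis by blast
    qed
    moreover have "card (insert w F) \<le> card (insert s S)"
      using F insert.hyps by (simp add: card_insert_if)
    ultimately show ?thesis using F(1) by (meson finite_insert)
  qed
qed

text \<open>The two spaces meet in 0 because t b (ad b) = 3 N(b), and the codimension bound makes
  them span everything.\<close>

lemma B_C_decomp: "dim B + dim C = dim (UNIV :: 'b set)" "\<exists>b\<in>B. \<exists>c\<in>C. x = b + c"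
proof -
  obtain S where S: "S \<subseteq> B" "independent S" "B \<subseteq> span S" "card S = dim B" using basis_exists by metis
  have fS: "finite S" using S(2) by (rule finiteI_independent)
  obtain F where F: "finite F" "card F \<le> card S" "\<And>x. \<exists>f\<in>span F. \<forall>s\<in>S. t s (x - f) = 0"
    using perp_finite[OF fS] by blast
  have C: "c \<in> C" if "\<forall>s\<in>S. t s c = 0" for c
  proof (rule C_I)
    fix b assume "b \<in> B"
    then have "b \<in> span S" using S(3) by blast
    then show "t b c = 0" by (induction rule: span_induct_alt) (use that in \<open>auto simp: bilin\<close>)
  qed
  let ?D = "{x + y |x y. x \<in> B \<and> y \<in> C}"
  have "B \<inter> C = {0}" using B_C_disjoint by auto
  then have d: "dim ?D = dim B + dim C"
    using dim_sums_Int[OF B_subspace C_subspace] by simp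
  obtain S' where S': "S' \<subseteq> C" "independent S'" "C \<subseteq> span S'" "card S' = dim C" using basis_exists by metis
  have fS': "finite S'" using S'(2) by (rule finiteI_independent)
  have "UNIV \<subseteq> span (F \<union> S')"
  proof
    fix x
    obtain f where f: "f \<in> span F" "\<forall>s\<in>S. t s (x - f) = 0" using F(3) by blast
    from C[OF f(2)] have "x - f \<in> span S'" using S'(3) by blast
    then have "f + (x - f) \<in> span (F \<union> S')"
      using f(1) by (meson in_mono span_add span_mono sup_ge1 sup_ge2)
    then show "x \<in> span (F \<union> S')" by simp
  qed
  then have "dim (UNIV :: 'b set) \<le> card (F \<union> S')" using F(1) fS' by (intro dim_le_card) auto
  also have "\<dots> \<le> card F + card S'" by (rule card_Un_le)
  also have "\<dots> \<le> dim ?D" using F(2) S(4) S'(4) d by simp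
  finally have le: "dim (UNIV :: 'b set) \<le> dim ?D" .
  then have eq: "?D = UNIV"
    by (intro subspace_dim_equal subspace_sums B_subspace C_subspace) auto
  with d show "dim B + dim C = dim (UNIV :: 'b set)" by simp
  show "\<exists>b\<in>B. \<exists>c\<in>C. x = b + c" using eq by blast
qed

lemma N_sum: "a \<in> B \<Longrightarrow> c \<in> C \<Longrightarrow> N (a + c) = N a + N c - t (a \<rhd> c) c / 2"
proof -
  assume a: "a \<in> B" "c \<in> C"
  have "t (a \<rhd> c) c = - n3 c c a" unfolding act_def bilin n3_def[symmetric] by (metis n3_sym)
  then have "t a (ad c) = - t (a \<rhd> c) c / 2" unfolding n3_diag by (simp add: t_commute)
  then show ?thesis unfolding N_add using a by (simp add: C_D)
qed

end

section \<open>Nine-dimensional subalgebras\<close>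

lemma (in finite_dimensional_vector_space) dim_linear_image:
  assumes S: "subspace S" and f: "Vector_Spaces.linear scale scale f" and inj: "\<And>x. x \<in> S \<Longrightarrow> f x = 0 \<Longrightarrow> x = 0"
  shows "dim (f ` S) = dim S"
proof -
  interpret finite_dimensional_vector_space_pair_1 scale Basis scale by unfold_locales
  interpret f: Vector_Spaces.linear scale scale f by (rule f)
  have "inj_on f (span S)"
  proof (rule inj_onI)
    fix x y assume xy: "x \<in> span S" "y \<in> span S" "f x = f y"
    then have "x - y \<in> S" using S by (metis span_eq_iff subspace_diff)
    moreover have "f (x - y) = 0" using xy by (simp add: f.diff)
    ultimately show "x = y" using inj by force
  qed
  then show ?thesis by (rule dim_image_eq[OF f])
qed

lemma (in finite_dimensional_vector_space) linear_iff':
  "Vector_Spaces.linear scale scale f \<longleftrightarrow> (\<forall>x y. f (x + y) = f x + f y) \<and> (\<forall>c x. f (scale c x) = scale c (f x))"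
  unfolding Vector_Spaces.linear_iff using vector_space_axioms by auto

lemma (in finite_dimensional_vector_space) subspace_linear_image:
  assumes S: "subspace S" and f: "Vector_Spaces.linear scale scale f"
  shows "subspace (f ` S)"
proof -
  interpret f: Vector_Spaces.linear scale scale f by (rule f)
  show ?thesis using f.subspace_image[OF S] .
qed

locale cubic_field = norm_subalgebra sc Bas cr t e L
  for sc :: "'k::field \<Rightarrow> 'a::ab_group_add \<Rightarrow> 'a" and Bas :: "'a set" and cr (infixl "\<star>" 70) and t e and L :: "'a set" +
  fixes l :: 'a
  assumes l_generic: "\<And>k. l \<noteq> sc k e"
    and l_gen: "x \<in> L \<longleftrightarrow> (\<exists>a b c. x = sc a e + sc b l + sc c (ad l))"
begin

lemma l_L [simp]: "l \<in> L" unfolding l_gen by (rule exI[of _ 0], rule exI[of _ 1], rule exI[of _ 0]) simp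

text \<open>Only \<open>l\<close> and \<open>ad l\<close> need checking, and in either order they
  act as the scalar N(l).\<close>

lemma act_commute: assumes "a \<in> L" "b \<in> L" "v \<in> C" shows "a \<rhd> b \<rhd> v = b \<rhd> a \<rhd> v"
proof -
  obtain a0 a1 a2 where a: "a = sc a0 e + sc a1 l + sc a2 (ad l)" using assms(1) l_gen by blast
  obtain b0 b1 b2 where b: "b = sc b0 e + sc b1 l + sc b2 (ad l)" using assms(2) l_gen by blast
  have *: "ad l \<rhd> l \<rhd> v = l \<rhd> ad l \<rhd> v" using act_ad[of l v] assms(3) by simp
  show ?thesis unfolding a b act_linear
    by (rule vec_eqI) (simp only: lin_simps * act_linear act_e assms act_closed l_L ad_B e_B, algebra)
qed

lemma act_mult: assumes "a \<in> L" "b \<in> L" "v \<in> C" shows "jm a b \<rhd> v = a \<rhd> b \<rhd> v"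
  by (rule scale_cancelI[OF two], rule vec_eqI2[OF act_jm[OF assms] act_commute[OF assms], where k = "-1" and k' = "-1"])
    (simp only: lin_simps, algebra)

text \<open>Here -q and b are the components of \<open>ad w\<close> in \<open>L\<close> and in its
  complement; the formula gives the decomposition after w is multiplied by an element of
  \<open>L\<close>.\<close>

lemma ad_act: assumes "a \<in> L" "w \<in> C" "ad w = b - q" "q \<in> L" "b \<in> C"
  shows "ad (a \<rhd> w) = (ad a \<star> q - sc (t a q) a) + ad a \<rhd> b"
proof -
  have "ad (a \<rhd> w) = ad (a \<star> w)" by (simp add: act_def ad_minus)
  also have "\<dots> = (ad a \<star> q - sc (t a q) a) + ad a \<rhd> b"
    unfolding ad_cr assms(3) using assms by (simp add: C_D bilin act_def)
  finally show ?thesis .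
qed

lemma act_cr_ad: assumes "a \<in> L" "w \<in> C"
  shows "(a \<rhd> w) \<star> ad w = - sc (t (ad w) a) w - sc (N w) a"
proof (rule scale_cancelI[OF three], rule vec_eqI1[OF ad_cr_cr_polar[of w a w], where k = "-1"])
  fix g :: "'a \<Rightarrow> 'k" assume g: "functional sc g"
  have t1: "t (a \<star> w) w = 2 * t (ad w) a" using t_cr_ad[of w a] cr_commute[of w a] by simp
  show "g (sc 3 ((a \<rhd> w) \<star> ad w)) - g (sc 3 (- sc (t (ad w) a) w - sc (N w) a)) =
         -1 * (g (ad w \<star> (a \<star> w) + (w \<star> a) \<star> (w \<star> w)) -
          g (sc (t (ad w) a) w + sc (t (w \<star> a) w) w + sc (t (ad w) w) a))"
    unfolding act_def t_ad_self cr_self cr_commute[of w a] cr_commute[of "ad w" "a \<star> w"] t1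
    by (simp only: lin_simps[OF g] bilin, algebra)
qed

text \<open>If b = a \<rhd> v, the outer component of ad (ad v) = N(v) v gives t q a = 3 N(v) - 3
  N(a), whereas t (a \<rhd> v) v is both 3 N(v) and 2 t q a. So N(v) = 2 N(a), and then N(a + v) =
  N(a) + N(v) - 3 N(v) / 2 = 0.\<close>

lemma ad_not_multiple:
  assumes v: "v \<in> C" "v \<noteq> 0" and ad: "ad v = b - q" "q \<in> L" "b \<in> C" and a: "a \<in> L"
  shows "b \<noteq> a \<rhd> v"
proof
  assume b: "b = a \<rhd> v"
  have ab: "ad b = (ad a \<star> q - sc (t a q) a) + ad a \<rhd> b"
    unfolding b using ad_act[OF a v(1) ad] b by simp
  have "sc (N v) v = ad (b - q)" using ad_ad[of v] unfolding ad by simp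
  also have "\<dots> = (ad a \<star> q - sc (t a q) a + ad q) + (ad a \<rhd> b + q \<rhd> b)"
    unfolding ad_diff ab act_def cr_commute[of b q] by (simp add: algebra_simps)
  finally have 1: "sc (N v) v - (ad a \<rhd> b + q \<rhd> b) = ad a \<star> q - sc (t a q) a + ad q" by (simp add: algebra_simps)
  have "sc (N v) v - (ad a \<rhd> b + q \<rhd> b) = 0"
  proof (rule B_C_disjoint)
    show "sc (N v) v - (ad a \<rhd> b + q \<rhd> b) \<in> L" unfolding 1 using a ad by simp
    show "sc (N v) v - (ad a \<rhd> b + q \<rhd> b) \<in> C" using a ad v by simp
  qed
  moreover have "ad a \<rhd> b + q \<rhd> b = (sc (N a) e + jm q a) \<rhd> v"
    unfolding b using act_ad[OF a v(1)] act_mult[OF ad(2) a v(1)] v a by (simp add: act_linear act_e)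
  ultimately have "(sc (N a) e + jm q a - sc (N v) e) \<rhd> v = 0" using v by (simp add: act_linear act_e)
  then have "sc (N a) e + jm q a - sc (N v) e = 0" using act_inj[of "sc (N a) e + jm q a - sc (N v) e" v] v a ad by simp
  then have "T (sc (N a) e + jm q a - sc (N v) e) = 0" by (simp add: T_linear)
  then have 2: "t q a = 3 * N v - 3 * N a" by (simp add: T_linear T_jm algebra_simps)
  have "3 * N v = t (ad v) v" by (simp add: t_ad_self)
  also have "\<dots> = t (a \<rhd> v) v" unfolding ad using v ad by (simp add: bilin C_D b)
  finally have 3: "t (a \<rhd> v) v = 3 * N v" by simp
  have "t (a \<rhd> v) v = - n3 v v a" unfolding act_def bilin n3_def[symmetric] by (metis n3_sym)
  also have "\<dots> = 2 * t q a" unfolding n3_diag ad using a ad by (simp add: bilin C_D)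
  finally have "3 * N v = 2 * (3 * N v - 3 * N a)" using 2 3 by simp
  then have 4: "3 * N v = 3 * (2 * N a)" by (simp add: algebra_simps)
  then have Nv: "N v = 2 * N a" by (rule mult_cancelI[OF three])
  have "N (a + v) = N a + N v - 3 * N v / 2" using N_sum[OF a v(1)] 3 by simp
  also have "\<dots> = 0" unfolding Nv by simp
  finally have "a + v = 0" by simp
  then have "v = - a" by (simp add: eq_neg_iff_add_eq_0 add.commute)
  then have "v = 0" using a v by (intro B_C_disjoint) auto
  with v show False by simp
qed

text \<open>The subalgebra is L + L v + L b with b the component of \<open>ad v\<close> outside
  \<open>L\<close>. Closure under \<open>ad\<close> is enough, the cross product being its
  polarisation.\<close>

lemma nine_dimensional:
  assumes v: "v \<in> C" "v \<noteq> 0" and dimL: "dim L = 3"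
  shows "\<exists>B. norm_subalgebra sc Bas cr t e B \<and> dim B = 9 \<and> L \<subseteq> B \<and> v \<in> B"
proof -
  obtain q0 b where q0: "q0 \<in> L" "b \<in> C" "ad v = q0 + b" using B_C_decomp(2) by metis
  define q where "q = - q0"
  have ad: "ad v = b - q" "q \<in> L" "b \<in> C" using q0 by (simp_all add: q_def)
  \<comment> \<open>The adjoint identity for v, read as the decomposition of \<open>ad b\<close>, so
    that \<open>ad_act\<close> applies to b as well.\<close>
  have b: "ad b = (sc (N v) v - q \<rhd> b) - ad q"
  proof -
    have "sc (N v) v = ad (b - q)" using ad_ad[of v] unfolding ad by simp
    then show ?thesis unfolding ad_diff act_def cr_commute[of b q] by (simp add: algebra_simps)
  qed
  define B where "B = {x + y + z |x y z. x \<in> L \<and> y \<in> (\<lambda>a. a \<rhd> v) ` L \<and> z \<in> (\<lambda>a. a \<rhd> b) ` L}"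
  have BI: "x + a \<rhd> v + a' \<rhd> b \<in> B" if "x \<in> L" "a \<in> L" "a' \<in> L" for x a a' using that by (auto simp: B_def)
  have BI1: "x \<in> B" if "x \<in> L" for x using BI[OF that, of 0 0] by (simp add: act_linear)
  have BI2: "a \<rhd> v \<in> B" if "a \<in> L" for a using BI[of 0 a 0] that by (simp add: act_linear)
  have BI3: "a \<rhd> b \<in> B" if "a \<in> L" for a using BI[of 0 0 a] that by (simp add: act_linear)
  have lin: "Vector_Spaces.linear sc sc (\<lambda>a. a \<rhd> w)" for w
    unfolding linear_iff' by (simp add: act_linear)
  let ?S2 = "(\<lambda>a. a \<rhd> v) ` L" and ?S3 = "(\<lambda>a. a \<rhd> b) ` L"
  let ?S23 = "{x + y |x y. x \<in> ?S2 \<and> y \<in> ?S3}"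
  have B': "B = {x + y |x y. x \<in> L \<and> y \<in> ?S23}"
  proof (intro set_eqI iffI)
    fix x assume "x \<in> B"
    then obtain x1 y z where "x = x1 + (y + z)" "x1 \<in> L" "y \<in> ?S2" "z \<in> ?S3"
      unfolding B_def add.assoc by blast
    then show "x \<in> {x + y |x y. x \<in> L \<and> y \<in> ?S23}" by blast
  next
    fix x assume "x \<in> {x + y |x y. x \<in> L \<and> y \<in> ?S23}"
    then obtain x1 y z where "x = x1 + (y + z)" "x1 \<in> L" "y \<in> ?S2" "z \<in> ?S3" by blast
    then show "x \<in> B" unfolding B_def add.assoc by blast
  qed
  have s2: "subspace ?S2" and s3: "subspace ?S3" by (intro subspace_linear_image B_subspace lin)+
  have s23: "subspace ?S23" by (intro subspace_sums s2 s3)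
  have B_sub: "subspace B" unfolding B' by (intro subspace_sums s23 B_subspace)
  have b0: "b \<noteq> 0" using ad_not_multiple[OF v ad, of 0] by (simp add: act_linear)
  have "dim ?S2 = 3" unfolding dimL[symmetric]
    by (rule dim_linear_image[OF B_subspace lin]) (metis act_inj v)
  moreover have "dim ?S3 = 3" unfolding dimL[symmetric]
    by (rule dim_linear_image[OF B_subspace lin]) (metis act_inj ad(3) b0)
  moreover have "?S2 \<inter> ?S3 = {0}"
  proof -
    have "x = 0" if x23: "x \<in> ?S2" "x \<in> ?S3" for x
    proof (rule ccontr)
      assume x: "x \<noteq> 0"
      obtain a where a: "a \<in> L" "x = a \<rhd> v" using x23 by blast
      obtain a' where a': "a' \<in> L" "x = a' \<rhd> b" using x23 by blast
      have ne: "a' \<noteq> 0" using x a' by (auto simp: act_linear)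
      have "sc (N a') b = ad a' \<rhd> x" using act_ad a' ad by simp
      also have "\<dots> = jm (ad a') a \<rhd> v" unfolding a using a a' v by (simp add: act_mult)
      finally have "sc (1 / N a') (sc (N a') b) = sc (1 / N a') (jm (ad a') a \<rhd> v)" by simp
      then have "b = sc (1 / N a') (jm (ad a') a \<rhd> v)" using ne by simp
      then have "b = sc (1 / N a') (jm (ad a') a) \<rhd> v" by (simp add: act_linear)
      then show False using ad_not_multiple[OF v ad] a a' by simp
    qed
    then show ?thesis using subspace_0[OF s2] subspace_0[OF s3] by blast
  qed
  ultimately have d23: "dim ?S23 = 6" using dim_sums_Int[OF s2 s3] by simp
  have "L \<inter> ?S23 = {0}"
  proof -
    have "?S23 \<subseteq> C" using v ad by auto
    then show ?thesis using B_C_disjoint subspace_0[OF s23] subspace_0[OF B_subspace] by blast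
  qed
  then have dB: "dim B = 9" unfolding B' using dim_sums_Int[OF B_subspace s23] d23 dimL by simp
  have mixed: "(a \<rhd> v) \<star> (a' \<rhd> b) \<in> B" if a: "a \<in> L" "a' \<in> L" for a a'
  proof (cases "a' = 0")
    case True
    show ?thesis unfolding True act_linear cr_diff by (rule subspace_0[OF B_sub])
  next
    case False
    \<comment> \<open>With this w, N(a') times a' \<rhd> b is the outer component of
      \<open>ad w\<close>, and N(a') times a \<rhd> v is an L-multiple of w, so that
      \<open>act_cr_ad\<close> computes their cross product. The factors N(a') are divided out at
      the end.\<close>
    define w where "w = ad a' \<rhd> v"
    have w: "w \<in> C" unfolding w_def by (intro act_closed ad_B a v)
    define q' where "q' = - (ad (ad a') \<star> q - sc (t (ad a') q) (ad a'))"
    have q': "q' \<in> L" unfolding q'_def by (intro B_closed ad_B a ad)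
    have adw: "ad w = sc (N a') (a' \<rhd> b) - q'"
      unfolding w_def q'_def ad_act[OF ad_B[OF a(2)] v(1) ad] ad_ad act_linear by simp
    have av: "sc (N a') (a \<rhd> v) = jm a a' \<rhd> w"
      unfolding w_def act_mult[OF a act_closed[OF ad_B[OF a(2)] v(1)]] act_ad(1)[OF a(2) v(1)] act_linear ..
    have aw: "jm a a' \<in> L" using a by simp
    have "sc (N a' * N a') ((a \<rhd> v) \<star> (a' \<rhd> b)) = sc (N a') (a \<rhd> v) \<star> sc (N a') (a' \<rhd> b)"
      by (simp only: bilin scale_scale)
    also have "sc (N a') (a' \<rhd> b) = ad w + q'" unfolding adw by simp
    also have "sc (N a') (a \<rhd> v) \<star> (ad w + q') = (jm a a' \<rhd> w) \<star> ad w + (jm a a' \<rhd> w) \<star> q'"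
      unfolding av by (rule cr_add_right)
    also have "\<dots> = - sc (t (ad w) (jm a a')) w - sc (N w) (jm a a') - q' \<rhd> jm a a' \<rhd> w"
      unfolding act_cr_ad[OF aw w] act_def[of q'] cr_commute[of _ q'] by simp
    also have "\<dots> \<in> B"
    proof -
      have "q' \<rhd> jm a a' \<rhd> w = jm (jm q' (jm a a')) (ad a') \<rhd> v"
        using a q' v w aw unfolding w_def by (simp only: act_mult jm_B ad_B)
      moreover have "w \<in> B" unfolding w_def by (rule BI2[OF ad_B[OF a(2)]])
      moreover have "jm a a' \<in> B" by (rule BI1[OF aw])
      moreover have "jm (jm q' (jm a a')) (ad a') \<rhd> v \<in> B" by (rule BI2) (intro jm_B q' aw ad_B a)
      ultimately show ?thesis
        by (metis subspace_diff[OF B_sub] subspace_neg[OF B_sub] subspace_scale[OF B_sub])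
    qed
    finally have "sc (1 / (N a' * N a')) (sc (N a' * N a') ((a \<rhd> v) \<star> (a' \<rhd> b))) \<in> B"
      by (rule subspace_scale[OF B_sub])
    then show ?thesis using False by simp
  qed
  have adB: "ad x \<in> B" if "x \<in> B" for x
  proof -
    obtain a0 a a' where x: "x = a0 + a \<rhd> v + a' \<rhd> b" "a0 \<in> L" "a \<in> L" "a' \<in> L" using \<open>x \<in> B\<close> unfolding B_def by auto
    have 1: "ad (a \<rhd> v) \<in> B"
      unfolding ad_act[OF x(3) v(1) ad] using x ad by (intro subspace_add[OF B_sub] BI1 BI3) auto
    have "ad (a' \<rhd> b) = (ad a' \<star> ad q - sc (t a' (ad q)) a') + ad a' \<rhd> (sc (N v) v - q \<rhd> b)"
      by (rule ad_act[OF x(4) ad(3) b]) (use ad v in auto)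
    also have "\<dots> = (ad a' \<star> ad q - sc (t a' (ad q)) a') + sc (N v) (ad a' \<rhd> v) - jm (ad a') q \<rhd> b"
      using x ad by (simp add: act_linear act_mult)
    also have "\<dots> \<in> B" using x ad
      by (intro subspace_add[OF B_sub] subspace_diff[OF B_sub] subspace_scale[OF B_sub] BI1 BI3 BI2) auto
    finally have 2: "ad (a' \<rhd> b) \<in> B" .
    have "a0 \<star> (a \<rhd> v) = - (jm a0 a \<rhd> v)" "a0 \<star> (a' \<rhd> b) = - (jm a0 a' \<rhd> b)"
      using x v ad by (simp_all add: act_mult) (simp_all add: act_def)
    then have 3: "a0 \<star> (a \<rhd> v) \<in> B" "a0 \<star> (a' \<rhd> b) \<in> B"
      using x by (simp_all add: subspace_neg[OF B_sub] BI2 BI3)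
    show ?thesis unfolding x ad_add bilin
      by (intro subspace_add[OF B_sub] 1 2 3 mixed x BI1 ad_B)
  qed
  have "norm_subalgebra sc Bas cr t e B"
  proof
    show "subspace B" by (rule B_sub)
    show "e \<in> B" by (rule BI1) simp
    show "x \<star> y \<in> B" if "x \<in> B" "y \<in> B" for x y
    proof -
      have "x \<star> y = ad (x + y) - ad x - ad y" by (simp add: ad_add)
      then show ?thesis using that by (simp add: adB subspace_diff[OF B_sub] subspace_add[OF B_sub])
    qed
  qed
  moreover have "v \<in> B" using BI2[of e] v by (simp add: act_e)
  ultimately show ?thesis using dB BI1 by blast
qed

text \<open>The action occurs in two ways: \<open>L\<close> acts on its own complement, which
  contains v, and \<open>B\<close> acts on perp B, where commuting is assumed. Commuting makes jm
  (ad l) (jm l v) equal to N(l) v; orthogonality to \<open>L\<close> makes jm l v half of T(l) v - l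
  \<rhd> v. Together they give an element of \<open>L\<close> that kills v.\<close>

lemma centralizer_trivial:
  assumes "norm_subalgebra sc Bas cr t e B" "L \<subseteq> B" and v: "v \<in> B" "v \<in> C"
    and c0: "c0 \<in> perp B" "c0 \<noteq> 0"
    and com: "\<And>c. c \<in> perp B \<Longrightarrow> l \<rhd> v \<rhd> c = v \<rhd> l \<rhd> c"
  shows "v = 0"
proof (rule ccontr)
  assume "v \<noteq> 0"
  interpret B: norm_subalgebra sc Bas cr t e B by (rule assms)
  have l: "l \<in> B" "ad l \<in> B" using \<open>L \<subseteq> B\<close> l_L ad_B by blast+
  define w where "w = jm l v"
  have w_eq: "w = sc (1/2) (sc (T l) v - l \<rhd> v)"
    using v by (simp add: w_def jm_def act_def C_D T_C)
  have wC: "w \<in> C" unfolding w_eq using v by simp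
  have wB: "w \<in> B" using l v by (simp add: w_def)
  have w: "w \<rhd> c = l \<rhd> v \<rhd> c" if "c \<in> perp B" for c
    unfolding w_def
    by (rule scale_cancelI[OF two], rule vec_eqI2[OF B.act_jm[OF l(1) v(1) that] com[OF that], where k = "-1" and k' = "-1"])
      (simp only: lin_simps, algebra)
  have com2: "ad l \<rhd> v \<rhd> c = v \<rhd> ad l \<rhd> c" if "c \<in> perp B" for c
    using that l v by (simp add: B.act_ad_expand act_linear com)
  have "jm (ad l) w \<rhd> c0 = sc (N l) v \<rhd> c0"
  proof (rule scale_cancelI[OF two])
    have "sc 2 (jm (ad l) w \<rhd> c0) = ad l \<rhd> w \<rhd> c0 + w \<rhd> ad l \<rhd> c0"
      by (simp add: B.act_jm l wB c0)
    also have "\<dots> = ad l \<rhd> l \<rhd> v \<rhd> c0 + l \<rhd> ad l \<rhd> v \<rhd> c0"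
      using c0 l v by (simp add: w com2)
    also have "\<dots> = sc 2 (sc (N l) v \<rhd> c0)"
      using B.act_ad[of l "v \<rhd> c0"] c0 l v by (simp add: act_linear flip: scale_left_distrib)
    finally show "sc 2 (jm (ad l) w \<rhd> c0) = sc 2 (sc (N l) v \<rhd> c0)" .
  qed
  then have "(jm (ad l) w - sc (N l) v) \<rhd> c0 = 0" by (simp add: act_linear)
  then have 1: "jm (ad l) w = sc (N l) v"
    using B.act_inj[of "jm (ad l) w - sc (N l) v" c0] c0 l v wB by simp
  have "jm (ad l) w = sc (1/2) (sc (T (ad l)) w - ad l \<rhd> w)"
    using wC by (simp add: jm_def act_def C_D T_C)
  then have "sc 4 (sc (1/2) (sc (T (ad l)) w - ad l \<rhd> w)) = sc 4 (sc (N l) v)" using 1 by simp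
  moreover have "sc 4 (sc (1/2) (sc (T (ad l)) w - ad l \<rhd> w)) = sc (T (ad l)) (sc 2 w) - ad l \<rhd> sc 2 w"
  proof -
    have "(4::'k) * (1/2) = 2" by (simp add: field_simps)
    then have "sc 4 (sc (1/2) (sc (T (ad l)) w - ad l \<rhd> w)) = sc 2 (sc (T (ad l)) w - ad l \<rhd> w)"
      by (simp only: scale_scale)
    then show ?thesis by (simp add: act_linear scale_right_diff_distrib mult.commute)
  qed
  moreover have "sc 2 w = sc (T l) v - l \<rhd> v" by (simp add: w_eq)
  ultimately have 2: "sc (T (ad l)) (sc (T l) v - l \<rhd> v) - ad l \<rhd> (sc (T l) v - l \<rhd> v) = sc 4 (sc (N l) v)" by simp
  \<comment> \<open>Independence of e, l and ad l makes all coefficients of k vanish, so the first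
    one reduces to 3 N(l) = 0.\<close>
  define k where "k = sc (T (ad l) * T l - 3 * N l) e + sc (- T (ad l)) l + sc (- T l) (ad l)"
  have "k \<rhd> v = 0"
    by (rule vec_eqI1[OF 2, where k = 1])
      (simp only: k_def act_linear act_e[OF v(2)] act_ad[OF l_L v(2)] lin_simps, algebra)
  moreover have "k \<in> L" by (simp add: k_def)
  ultimately have "k = 0" using act_inj v \<open>v \<noteq> 0\<close> by blast
  then have "T (ad l) * T l - 3 * N l = 0 \<and> - T (ad l) = 0 \<and> - T l = 0"
    unfolding k_def by (rule degree_three[OF l_generic])
  then have "3 * N l = 0" by auto
  then have "l = 0" using three by (metis mult_eq_0_iff N_eq_0)
  with l_generic[of 0] show False by simp
qed

end

section \<open>Commutators on the orthogonal complement\<close>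

context norm_subalgebra begin

text \<open>Hides 1/2 behind a variable with 2 h = 1, so that \<open>algebra\<close> meets a
  polynomial relation instead of a division.\<close>

lemma half: obtains h :: 'a where "2 * h = 1" "\<And>a b c. a \<in> B \<Longrightarrow> b \<in> B \<Longrightarrow> c \<in> C \<Longrightarrow> jm a b \<rhd> c = sc h (a \<rhd> b \<rhd> c + b \<rhd> a \<rhd> c)"
proof
  show "2 * (1 / 2 :: 'a) = 1" by simp
  show "jm a b \<rhd> c = sc (1/2) (a \<rhd> b \<rhd> c + b \<rhd> a \<rhd> c)" if "a \<in> B" "b \<in> B" "c \<in> C" for a b c
    unfolding act_jm[OF that] by simp
qed

definition cm where "cm a b c = a \<rhd> b \<rhd> c - b \<rhd> a \<rhd> c"

lemma cm_closed [simp]: "a \<in> B \<Longrightarrow> b \<in> B \<Longrightarrow> c \<in> C \<Longrightarrow> cm a b c \<in> C"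
  by (simp add: cm_def)
lemma cm_linear: "cm a b (c + d) = cm a b c + cm a b d" "cm a b (sc k c) = sc k (cm a b c)"
  "cm a b (c - d) = cm a b c - cm a b d" "cm a b (- c) = - cm a b c" "cm a b 0 = 0"
  "cm a (b + b') c = cm a b c + cm a b' c" "cm (a + a') b c = cm a b c + cm a' b c"
  by (simp_all add: cm_def act_linear scale_right_diff_distrib)
lemma cm_swap: "cm b a c = - cm a b c" by (simp add: cm_def)
lemma cm_adjoint: "t (cm a b c) d = - t c (cm a b d)"
  by (simp add: cm_def bilin act_adjoint)

text \<open>The Jordan polynomials \<open>p0 a b\<close> and \<open>pp a b\<close> represent the adjoint and the square of \<open>cm a b\<close>
  in the enveloping algebra of degree 3, so that \<open>eps a b\<close> is the reduced norm of \<open>cm a b\<close>.\<close>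
definition U where "U a b = sc 2 (jm a (jm a b)) - jm (jm a a) b"
definition p0 where "p0 a b = sc 2 (jm (ad a) (ad b)) - jm (cr a b) (cr a b) + cr (jm a a) (jm b b)"
definition pp where "pp a b = sc 2 (jm (U a b) b) - U a (jm b b) - U b (jm a a)"
definition eps where "eps a b c = cm a b (p0 a b \<rhd> c)"

lemma U_B [simp]: "a \<in> B \<Longrightarrow> b \<in> B \<Longrightarrow> U a b \<in> B" by (simp add: U_def)
lemma p0_B [simp]: "a \<in> B \<Longrightarrow> b \<in> B \<Longrightarrow> p0 a b \<in> B" by (simp add: p0_def)
lemma pp_B [simp]: "a \<in> B \<Longrightarrow> b \<in> B \<Longrightarrow> pp a b \<in> B" by (simp add: pp_def)
lemma p0_swap: "p0 b a = p0 a b" 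
  by (simp add: p0_def cr_commute[of b a] cr_commute[of "jm b b"] jm_commute[of "ad b"])
lemma eps_swap: "eps b a c = - eps a b c" by (simp add: eps_def p0_swap[of b a] cm_swap[of b a])
lemma eps_closed [simp]: "a \<in> B \<Longrightarrow> b \<in> B \<Longrightarrow> c \<in> C \<Longrightarrow> eps a b c \<in> C" by (simp add: eps_def)
lemma eps_linear: "eps a b (c + d) = eps a b c + eps a b d" "eps a b (sc k c) = sc k (eps a b c)"
  by (simp_all add: eps_def act_linear cm_linear)

lemma act_U: assumes "a \<in> B" "b \<in> B" "c \<in> C" shows "U a b \<rhd> c = a \<rhd> b \<rhd> a \<rhd> c"
proof -
  obtain h where h: "2 * h = 1" "\<And>a b c. a \<in> B \<Longrightarrow> b \<in> B \<Longrightarrow> c \<in> C \<Longrightarrow> jm a b \<rhd> c = sc h (a \<rhd> b \<rhd> c + b \<rhd> a \<rhd> c)"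
    by (rule half) blast
  show ?thesis
    by (rule vec_eqI) (simp only: U_def act_linear h(2) assms jm_B act_closed lin_simps, use h(1) in algebra)
qed

text \<open>Expand (ab - ba)^2 = abab + baba - abba - baab: the first two terms form a symmetrised
  product of \<open>U a b\<close> and b, the others are values of \<open>U\<close>.\<close>

lemma cm_cm: assumes "a \<in> B" "b \<in> B" "c \<in> C" shows "cm a b (cm a b c) = pp a b \<rhd> c"
proof -
  have 1: "sc 2 (jm (U a b) b \<rhd> c) = a \<rhd> b \<rhd> a \<rhd> b \<rhd> c + b \<rhd> a \<rhd> b \<rhd> a \<rhd> c"
    unfolding act_jm[OF U_B[OF assms(1,2)] assms(2,3), symmetric] using assms by (simp add: act_U)
  show ?thesis unfolding pp_def act_linear 1 using assms
    by (simp add: act_U act_sq cm_def act_linear)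
qed

lemma n3_cm: assumes "a \<in> B" "b \<in> B" "x \<in> C" "y \<in> C" "z \<in> C"
  shows "n3 (cm a b x) (cm a b y) z = n3 x y (p0 a b \<rhd> z)"
proof -
  have 1: "n3 (a \<rhd> b \<rhd> x) (a \<rhd> b \<rhd> y) z = n3 x y (ad b \<rhd> ad a \<rhd> z)" 
    "n3 (b \<rhd> a \<rhd> x) (b \<rhd> a \<rhd> y) z = n3 x y (ad a \<rhd> ad b \<rhd> z)"
    using assms by (simp_all add: n3_act)
  have 2: "n3 (a \<rhd> b \<rhd> x) (b \<rhd> a \<rhd> y) z + n3 (b \<rhd> b \<rhd> x) (a \<rhd> a \<rhd> y) z = n3 (b \<rhd> x) (a \<rhd> y) (cr a b \<rhd> z)"
    "n3 (a \<rhd> a \<rhd> x) (b \<rhd> b \<rhd> y) z + n3 (b \<rhd> a \<rhd> x) (a \<rhd> b \<rhd> y) z = n3 (a \<rhd> x) (b \<rhd> y) (cr a b \<rhd> z)"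
    using assms by (simp_all add: n3_act_polar)
  have 3: "n3 (a \<rhd> x) (b \<rhd> y) (cr a b \<rhd> z) + n3 (b \<rhd> x) (a \<rhd> y) (cr a b \<rhd> z) = n3 x y (cr a b \<rhd> cr a b \<rhd> z)"
    using assms by (simp add: n3_act_polar)
  have 4: "n3 (a \<rhd> a \<rhd> x) (b \<rhd> b \<rhd> y) z + n3 (b \<rhd> b \<rhd> x) (a \<rhd> a \<rhd> y) z = n3 x y (cr (jm a a) (jm b b) \<rhd> z)"
    using n3_act_polar[of "jm a a" "jm b b" x y z] assms by (simp add: act_sq)
  have 5: "p0 a b \<rhd> z = ad b \<rhd> ad a \<rhd> z + ad a \<rhd> ad b \<rhd> z - cr a b \<rhd> cr a b \<rhd> z + cr (jm a a) (jm b b) \<rhd> z"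
    unfolding p0_def using assms by (simp add: act_linear act_sq act_jm[symmetric] add.commute)
  have "n3 (cm a b x) (cm a b y) z = n3 (a \<rhd> b \<rhd> x) (a \<rhd> b \<rhd> y) z + n3 (b \<rhd> a \<rhd> x) (b \<rhd> a \<rhd> y) z
     - n3 (a \<rhd> b \<rhd> x) (b \<rhd> a \<rhd> y) z - n3 (b \<rhd> a \<rhd> x) (a \<rhd> b \<rhd> y) z"
    by (simp add: cm_def n3_linear algebra_simps)
  also have "\<dots> = n3 x y (p0 a b \<rhd> z)"
    unfolding 5 n3_linear 3[symmetric] 1 4[symmetric] 2[symmetric] by algebra
  finally show ?thesis .
qed

text \<open>A commutator has trace zero: combining the instances of \<open>n3_act_sum\<close>
  cancels every multiple of T a and T b.\<close>

lemma n3_cm_sum: assumes "a \<in> B" "b \<in> B" "x \<in> C" "y \<in> C" "z \<in> C"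
  shows "n3 (cm a b x) y z + n3 x (cm a b y) z + n3 x y (cm a b z) = 0"
proof -
  have "n3 (a \<rhd> b \<rhd> x) y z + n3 (b \<rhd> x) (a \<rhd> y) z + n3 (b \<rhd> x) y (a \<rhd> z) = T a * n3 (b \<rhd> x) y z"
    "n3 (a \<rhd> x) (b \<rhd> y) z + n3 x (a \<rhd> b \<rhd> y) z + n3 x (b \<rhd> y) (a \<rhd> z) = T a * n3 x (b \<rhd> y) z"
    "n3 (a \<rhd> x) y (b \<rhd> z) + n3 x (a \<rhd> y) (b \<rhd> z) + n3 x y (a \<rhd> b \<rhd> z) = T a * n3 x y (b \<rhd> z)"
    "n3 (b \<rhd> a \<rhd> x) y z + n3 (a \<rhd> x) (b \<rhd> y) z + n3 (a \<rhd> x) y (b \<rhd> z) = T b * n3 (a \<rhd> x) y z"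
    "n3 (b \<rhd> x) (a \<rhd> y) z + n3 x (b \<rhd> a \<rhd> y) z + n3 x (a \<rhd> y) (b \<rhd> z) = T b * n3 x (a \<rhd> y) z"
    "n3 (b \<rhd> x) y (a \<rhd> z) + n3 x (b \<rhd> y) (a \<rhd> z) + n3 x y (b \<rhd> a \<rhd> z) = T b * n3 x y (a \<rhd> z)"
    "n3 (a \<rhd> x) y z + n3 x (a \<rhd> y) z + n3 x y (a \<rhd> z) = T a * n3 x y z"
    "n3 (b \<rhd> x) y z + n3 x (b \<rhd> y) z + n3 x y (b \<rhd> z) = T b * n3 x y z"
    using assms by (simp_all add: n3_act_sum)
  then show ?thesis unfolding cm_def n3_linear by algebra
qed

lemma n3_eqI: assumes "z \<in> C" "w \<in> C" "\<And>x y. x \<in> C \<Longrightarrow> y \<in> C \<Longrightarrow> n3 x y z = n3 x y w" shows "z = w"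
proof -
  have "z - w = 0" by (rule n3_nondegenerate) (use assms in \<open>simp_all add: n3_linear\<close>)
  then show ?thesis by simp
qed

text \<open>Evaluate the derivation rule at D x, D y, c, where D is the commutator, and move the
  factors D in pairs to the remaining slot.\<close>

lemma cm_p0_commute: assumes "a \<in> B" "b \<in> B" "c \<in> C"
  shows "cm a b (p0 a b \<rhd> c) = p0 a b \<rhd> cm a b c"
proof (rule n3_eqI)
  fix x y assume xy: "x \<in> C" "y \<in> C"
  let ?D = "cm a b" and ?p = "p0 a b"
  have "n3 (?D (?D x)) (?D y) c + n3 (?D x) (?D (?D y)) c + n3 (?D x) (?D y) (?D c) = 0"
    using assms xy by (simp add: n3_cm_sum)
  moreover have "n3 (?D (?D x)) (?D y) c = n3 (?D x) y (?p \<rhd> c)" "n3 (?D x) (?D (?D y)) c = n3 x (?D y) (?p \<rhd> c)"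
    "n3 (?D x) (?D y) (?D c) = n3 x y (?p \<rhd> ?D c)" using assms xy by (simp_all add: n3_cm)
  moreover have "n3 (?D x) y (?p \<rhd> c) + n3 x (?D y) (?p \<rhd> c) + n3 x y (?D (?p \<rhd> c)) = 0"
    using assms xy by (simp add: n3_cm_sum)
  ultimately show "n3 x y (?D (?p \<rhd> c)) = n3 x y (?p \<rhd> ?D c)" by algebra
qed (use assms in simp_all)

lemma eps_alt: "a \<in> B \<Longrightarrow> b \<in> B \<Longrightarrow> c \<in> C \<Longrightarrow> p0 a b \<rhd> cm a b c = eps a b c"
  by (simp add: eps_def cm_p0_commute)

text \<open>Both sides represent the adjoint of the square of \<open>cm a b\<close>.\<close>

lemma p0_sq: assumes "a \<in> B" "b \<in> B" "c \<in> C" shows "p0 a b \<rhd> p0 a b \<rhd> c = ad (pp a b) \<rhd> c"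
proof (rule n3_eqI)
  fix x y assume xy: "x \<in> C" "y \<in> C"
  have "n3 x y (p0 a b \<rhd> p0 a b \<rhd> c) = n3 (cm a b (cm a b x)) (cm a b (cm a b y)) c"
    using assms xy by (simp add: n3_cm)
  also have "\<dots> = n3 x y (ad (pp a b) \<rhd> c)"
    using assms xy by (simp add: cm_cm n3_act)
  finally show "n3 x y (p0 a b \<rhd> p0 a b \<rhd> c) = n3 x y (ad (pp a b) \<rhd> c)" .
qed (use assms in simp_all)

lemma eps_eps: assumes "a \<in> B" "b \<in> B" "c \<in> C" shows "eps a b (eps a b c) = sc (N (pp a b)) c"
proof -
  have "eps a b (eps a b c) = cm a b (p0 a b \<rhd> p0 a b \<rhd> cm a b c)"
    using assms by (simp add: eps_def flip: cm_p0_commute)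
  also have "\<dots> = cm a b (cm a b (p0 a b \<rhd> p0 a b \<rhd> c))"
    using assms by (simp add: cm_p0_commute)
  also have "\<dots> = pp a b \<rhd> ad (pp a b) \<rhd> c" using assms by (simp add: cm_cm p0_sq)
  finally show ?thesis using assms by (simp add: act_ad)
qed

lemma p0_nonzero: assumes "a \<in> B" "b \<in> B" "c \<in> C" "cm a b c \<noteq> 0" shows "p0 a b \<noteq> 0" "pp a b \<noteq> 0"
proof -
  show p: "p0 a b \<noteq> 0"
  proof
    assume "p0 a b = 0"
    then have "n3 (cm a b c) (cm a b c) (cm a b c) = 0" using assms by (simp add: n3_cm act_linear n3_linear)
    then show False using assms by (simp add: N_n3)
  qed
  have "c \<noteq> 0" using assms(4) by (auto simp: cm_linear)
  show "pp a b \<noteq> 0"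
  proof
    assume "pp a b = 0"
    then have "p0 a b \<rhd> p0 a b \<rhd> c = 0" using assms by (simp add: p0_sq act_linear)
    then show False using act_inj[of "p0 a b" "p0 a b \<rhd> c"] act_inj[of "p0 a b" c] p \<open>c \<noteq> 0\<close> assms by auto
  qed
qed

text \<open>The centroid of the cubic form on \<open>C\<close>: it is commutative because the form is nondegenerate.\<close>
definition balanced where
  "balanced f \<longleftrightarrow> (\<forall>x\<in>C. f x \<in> C) \<and> (\<forall>x y. f (x + y) = f x + f y) \<and> (\<forall>k x. f (sc k x) = sc k (f x)) \<and>
     (\<forall>x\<in>C. \<forall>y\<in>C. \<forall>z\<in>C. n3 (f x) y z = n3 x (f y) z)"

lemma balancedD: assumes "balanced f" "x \<in> C" "y \<in> C" "z \<in> C"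
  shows "n3 (f x) y z = n3 x (f y) z" "n3 x (f y) z = n3 x y (f z)" "n3 (f x) y z = n3 x y (f z)"
proof -
  show 1: "n3 (f x) y z = n3 x (f y) z" using assms by (auto simp: balanced_def)
  have "n3 (f y) z x = n3 y (f z) x" using assms by (auto simp: balanced_def)
  then show 2: "n3 x (f y) z = n3 x y (f z)" by (metis n3_sym)
  show "n3 (f x) y z = n3 x y (f z)" using 1 2 by simp
qed

lemma balanced_closed: "balanced f \<Longrightarrow> x \<in> C \<Longrightarrow> f x \<in> C" by (simp add: balanced_def)
lemma balanced_linear: "balanced f \<Longrightarrow> f (x + y) = f x + f y" "balanced f \<Longrightarrow> f (sc k x) = sc k (f x)" by (simp_all add: balanced_def)
lemma balanced_diff: assumes "balanced f" shows "f (x - y) = f x - f y" "f (- x) = - f x" "f 0 = 0"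
proof -
  show "f (- x) = - f x" for x using balanced_linear(2)[OF assms, of "-1" x] by simp
  then show "f (x - y) = f x - f y" using balanced_linear(1)[OF assms, of x "-y"] by simp
  show "f 0 = 0" using balanced_linear(2)[OF assms, of 0 0] by simp
qed

lemma balanced_commute: assumes "balanced f" "balanced g" "c \<in> C" shows "f (g c) = g (f c)"
proof (rule n3_eqI)
  fix x y assume xy: "x \<in> C" "y \<in> C"
  have "n3 x y (f (g c)) = n3 (f x) y (g c)" using balancedD[OF assms(1)] xy assms balanced_closed by metis
  also have "\<dots> = n3 (f x) (g y) c" using balancedD[OF assms(2)] xy assms balanced_closed by metis
  also have "\<dots> = n3 x (g y) (f c)" using balancedD[OF assms(1)] xy assms balanced_closed by metis
  also have "\<dots> = n3 x y (g (f c))" using balancedD[OF assms(2)] xy assms balanced_closed by metis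
  finally show "n3 x y (f (g c)) = n3 x y (g (f c))" .
qed (use assms balanced_closed in auto)

lemma balanced_scale: "balanced (sc k)"
  by (simp add: balanced_def scale_right_distrib n3_linear mult.commute)

text \<open>With D the commutator, n3 (D x) (D y) (D z) is symmetric in x, y, z and equals n3 x y
  (eps a b z).\<close>

lemma balanced_eps: assumes "a \<in> B" "b \<in> B" shows "balanced (eps a b)"
proof -
  have *: "n3 (cm a b x) (cm a b y) (cm a b z) = n3 x y (eps a b z)" if "x \<in> C" "y \<in> C" "z \<in> C" for x y z
    using that assms by (simp add: n3_cm eps_alt)
  have "n3 (eps a b x) y z = n3 x (eps a b y) z" if "x \<in> C" "y \<in> C" "z \<in> C" for x y z
    using *[OF that] *[of y z x] *[of x z y] that n3_sym by metis
  then show ?thesis using assms by (simp add: balanced_def eps_linear)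
qed

section \<open>Central operators on the complement and their uniqueness\<close>

definition central where "central f \<longleftrightarrow> balanced f \<and> (\<forall>k\<in>B. \<forall>c\<in>C. f (k \<rhd> c) = k \<rhd> f c)"

lemma centralD: "central f \<Longrightarrow> balanced f" "central f \<Longrightarrow> k \<in> B \<Longrightarrow> c \<in> C \<Longrightarrow> f (k \<rhd> c) = k \<rhd> f c"
  by (auto simp: central_def)

text \<open>The defect \<delta> of commuting with k is again balanced, so it commutes with eps. It
  also anticommutes with eps, whose square is a scalar. Hence 2 eps \<delta> = 0, and the scalar is
  not 0.\<close>

lemma central_eps: assumes ab: "a \<in> B" "b \<in> B" and nz: "c \<in> C" "cm a b c \<noteq> 0" shows "central (eps a b)"
proof -
  let ?f = "eps a b"
  note bf = balanced_eps[OF ab]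
  have "?f (k \<rhd> c) = k \<rhd> ?f c" if k: "k \<in> B" and c: "c \<in> C" for k c
  proof -
    define \<delta> where "\<delta> c = ?f (k \<rhd> c) - k \<rhd> ?f c" for c
    have dC: "\<delta> c \<in> C" if "c \<in> C" for c using that k ab by (simp add: \<delta>_def)
    have "balanced \<delta>"
    proof -
      have "n3 (\<delta> x) y z = n3 x (\<delta> y) z" if xyz: "x \<in> C" "y \<in> C" "z \<in> C" for x y z
      proof -
        have "n3 (k \<rhd> ?f x) y z + n3 (?f x) (k \<rhd> y) z + n3 (?f x) y (k \<rhd> z) = T k * n3 (?f x) y z"
          "n3 (k \<rhd> x) (?f y) z + n3 x (k \<rhd> ?f y) z + n3 x (?f y) (k \<rhd> z) = T k * n3 x (?f y) z"
          using k ab xyz by (simp_all add: n3_act_sum)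
        moreover have "n3 (?f x) y z = n3 x (?f y) z" "n3 (?f x) y (k \<rhd> z) = n3 x (?f y) (k \<rhd> z)"
          "n3 (?f x) (k \<rhd> y) z = n3 x (?f (k \<rhd> y)) z" "n3 (k \<rhd> x) (?f y) z = n3 (?f (k \<rhd> x)) y z"
          using balancedD(1)[OF bf] k xyz by simp_all
        ultimately show ?thesis unfolding \<delta>_def n3_linear by algebra
      qed
      then show ?thesis using dC
        by (simp add: balanced_def) (simp add: \<delta>_def act_linear eps_linear algebra_simps)
    qed
    have "?f (\<delta> c) = \<delta> (?f c)" by (rule balanced_commute[OF bf \<open>balanced \<delta>\<close> c])
    moreover have "?f (\<delta> c) + \<delta> (?f c) = 0"
      unfolding \<delta>_def balanced_diff[OF bf] using ab k c by (simp add: eps_eps act_linear)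
    ultimately have "sc 2 (?f (\<delta> c)) = 0" by (metis scale_left_distrib scale_one one_add_one)
    then have "?f (\<delta> c) = 0" by simp
    then have "sc (N (pp a b)) (\<delta> c) = 0" using eps_eps[OF ab dC[OF c]] balanced_diff(3)[OF bf] by simp
    then have "\<delta> c = 0" using p0_nonzero[OF ab nz] by simp
    then show ?thesis by (simp add: \<delta>_def)
  qed
  then show ?thesis using bf by (simp add: central_def)
qed

lemma eps_adjoint: assumes "a \<in> B" "b \<in> B" "c \<in> C" "d \<in> C" shows "t (eps a b c) d = - t c (eps a b d)"
proof -
  have "t (eps a b c) d = - t c (p0 a b \<rhd> cm a b d)" by (simp add: eps_def cm_adjoint act_adjoint)
  then show ?thesis using assms by (simp add: eps_alt)
qed

lemma central_compose: assumes "central f" "central g" shows "central (\<lambda>x. f (g x))"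
proof -
  have "n3 (f (g x)) y z = n3 x (f (g y)) z" if "x \<in> C" "y \<in> C" "z \<in> C" for x y z
  proof -
    have "n3 (f (g x)) y z = n3 (g x) (f y) z" using assms that balancedD(1) balanced_closed centralD(1) by metis
    also have "\<dots> = n3 x (g (f y)) z" using assms that balancedD(1) balanced_closed centralD(1) by metis
    also have "g (f y) = f (g y)" using assms that balanced_commute centralD(1) by metis
    finally show ?thesis .
  qed
  then show ?thesis using assms by (simp add: central_def balanced_def)
qed

lemma central_scale: "central (sc k)"
  using balanced_scale by (simp add: central_def act_linear)

lemma central_trace: assumes "central f" "a \<in> B" "x \<in> C" "y \<in> C" "z \<in> C"
  shows "n3 (f (a \<rhd> x)) y z + n3 x (f (a \<rhd> y)) z + n3 x y (f (a \<rhd> z)) = T a * n3 (f x) y z"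
proof -
  note b = centralD(1)[OF assms(1)]
  have "n3 x (f (a \<rhd> y)) z = n3 (f x) (a \<rhd> y) z" "n3 x y (f (a \<rhd> z)) = n3 (f x) y (a \<rhd> z)"
    using balancedD[OF b] assms by simp_all
  moreover have "n3 (f (a \<rhd> x)) y z = n3 (a \<rhd> f x) y z" using centralD(2)[OF assms(1)] assms by simp
  ultimately show ?thesis using n3_act_sum[of a "f x" y z] balanced_closed[OF b] assms by simp
qed

text \<open>Multiply the relation symmetrically by k and take traces: each coefficient from
  \<open>B\<close> becomes the scalar t k a, which leaves a linear relation among the central
  operators.\<close>

lemma central_independent:
  assumes f: "central f1" "central f2" "central f3" and a: "a1 \<in> B" "a2 \<in> B" "a3 \<in> B"
    and z: "\<And>c. c \<in> C \<Longrightarrow> f1 (a1 \<rhd> c) + f2 (a2 \<rhd> c) + f3 (a3 \<rhd> c) = 0"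
    and k: "k \<in> B" and c: "c \<in> C"
  shows "sc (t k a1) (f1 c) + sc (t k a2) (f2 c) + sc (t k a3) (f3 c) = 0"
proof -
  let ?g = "\<lambda>c. f1 (jm k a1 \<rhd> c) + f2 (jm k a2 \<rhd> c) + f3 (jm k a3 \<rhd> c)"
  have zero: "?g c = 0" if c: "c \<in> C" for c
  proof -
    have j: "sc 2 (f (jm k a \<rhd> c)) = k \<rhd> f (a \<rhd> c) + f (a \<rhd> k \<rhd> c)" if "central f" "a \<in> B" for f a
    proof -
      have "sc 2 (f (jm k a \<rhd> c)) = f (sc 2 (jm k a \<rhd> c))" using balanced_linear centralD(1) that by metis
      also have "\<dots> = f (k \<rhd> a \<rhd> c) + f (a \<rhd> k \<rhd> c)"
        using act_jm[OF k that(2) c] balanced_linear(1)[OF centralD(1)] that by metis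
      finally show ?thesis using centralD(2)[OF that(1) k, of "a \<rhd> c"] that c by simp
    qed
    have "sc 2 (?g c) = k \<rhd> (f1 (a1 \<rhd> c) + f2 (a2 \<rhd> c) + f3 (a3 \<rhd> c)) + (f1 (a1 \<rhd> k \<rhd> c) + f2 (a2 \<rhd> k \<rhd> c) + f3 (a3 \<rhd> k \<rhd> c))"
      unfolding scale_right_distrib j[OF f(1) a(1)] j[OF f(2) a(2)] j[OF f(3) a(3)] act_linear by (simp add: algebra_simps)
    also have "\<dots> = 0" using z[OF c] z[of "k \<rhd> c"] k c by (simp add: act_linear)
    finally show ?thesis by simp
  qed
  let ?h = "sc (t k a1) (f1 c) + sc (t k a2) (f2 c) + sc (t k a3) (f3 c)"
  have fC: "f1 c \<in> C" "f2 c \<in> C" "f3 c \<in> C" using f c balanced_closed centralD(1) by blast+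
  show ?thesis
  proof (rule n3_nondegenerate)
    show "?h \<in> C" using fC by simp
    fix x y assume xy: "x \<in> C" "y \<in> C"
    have s: "n3 (f (jm k a \<rhd> c)) x y + n3 c (f (jm k a \<rhd> x)) y + n3 c x (f (jm k a \<rhd> y)) = t k a * n3 (f c) x y"
      if "central f" "a \<in> B" for f a using central_trace[OF that(1), of "jm k a" c x y] that k c xy by (simp add: T_jm)
    have "n3 ?h x y = n3 (?g c) x y + n3 c (?g x) y + n3 c x (?g y)"
      unfolding n3_linear s[OF f(1) a(1), symmetric] s[OF f(2) a(2), symmetric] s[OF f(3) a(3), symmetric] by algebra
    also have "\<dots> = 0" unfolding zero[OF c] zero[OF xy(1)] zero[OF xy(2)] n3_linear by simp
    finally show "n3 x y ?h = 0" by (metis n3_sym)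
  qed
qed

definition scalar_on_C where "scalar_on_C f \<longleftrightarrow> (\<exists>k. \<forall>c\<in>C. f c = sc k c)"

lemma scalar_if_dependent: assumes "\<And>c. c \<in> C \<Longrightarrow> sc \<alpha> c + sc \<beta> (f c) = 0" "\<beta> \<noteq> 0" shows "scalar_on_C f"
proof -
  have "f c = sc (- \<alpha> / \<beta>) c" if "c \<in> C" for c
  proof -
    have "f c = sc (1 / \<beta>) (sc \<beta> (f c))" using assms(2) by simp
    also have "sc \<beta> (f c) = - sc \<alpha> c" using assms(1)[OF that] by (simp add: add_eq_0_iff)
    finally show ?thesis by simp
  qed
  then show ?thesis unfolding scalar_on_C_def by blast
qed

text \<open>As eps is the commutator times \<open>p0 a b\<close>, the witness is the inverse of
  \<open>p0 a b\<close>, given by its adjoint over its norm.\<close>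

lemma cm_eps: assumes "a \<in> B" "b \<in> B" "x \<in> C" "cm a b x \<noteq> 0"
  shows "\<exists>k\<in>B. k \<noteq> 0 \<and> (\<forall>c\<in>C. cm a b c = eps a b (k \<rhd> c))"
proof -
  let ?p = "p0 a b" and ?k = "sc (1 / N (p0 a b)) (ad (p0 a b))"
  have p: "?p \<noteq> 0" by (rule p0_nonzero[OF assms])
  have "cm a b c = eps a b (?k \<rhd> c)" if "c \<in> C" for c
    unfolding eps_def act_linear act_ad(1)[OF p0_B[OF assms(1,2)] that] cm_linear using p by simp
  moreover have "?k \<in> B" using assms by simp
  moreover have "?k \<noteq> 0"
  proof
    assume "?k = 0"
    then have "N (ad ?p) = 0" using p by simp
    then show False unfolding N_ad using p by simp
  qed
  ultimately show ?thesis by blast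
qed

text \<open>It is enough that the product g2 of the two operators is a scalar. The commutators of a
  with b, b' and b + b' give a relation between 1, g2 and g3 with coefficients in \<open>B\<close>,
  and g2, g3 have scalar squares. If g2 is not scalar, traces give g3 = \<alpha> + \<gamma> g2 with
  \<alpha> and \<gamma> nonzero, and squaring makes 2 \<alpha> \<gamma> g2 a scalar. If a commutes
  with b + b', the relation involves only 1 and g2.\<close>

lemma eps_proportional:
  assumes B: "a \<in> B" "b \<in> B" "b' \<in> B" and x: "x \<in> C" "cm a b x \<noteq> 0" and x': "x' \<in> C" "cm a b' x' \<noteq> 0"
  shows "\<exists>\<gamma>. \<forall>c\<in>C. eps a b' c = sc \<gamma> (eps a b c)"
proof -
  define d1 where "d1 = N (pp a b)" define d2 where "d2 = N (pp a b')"
  have d1: "d1 \<noteq> 0" unfolding d1_def using p0_nonzero(2)[OF B(1,2) x] by simp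
  note c1 = central_eps[OF B(1,2) x] and c2 = central_eps[OF B(1,3) x']
  note l1 = balanced_linear[OF centralD(1)[OF c1]] balanced_diff[OF centralD(1)[OF c1]]
  define g2 where "g2 c = eps a b (eps a b' c)" for c
  have cg2: "central g2" unfolding g2_def by (rule central_compose[OF c1 c2])
  obtain k1 where k1: "k1 \<in> B" "k1 \<noteq> 0" "\<And>c. c \<in> C \<Longrightarrow> cm a b c = eps a b (k1 \<rhd> c)" using cm_eps[OF B(1,2) x] by blast
  obtain k2 where k2: "k2 \<in> B" "k2 \<noteq> 0" "\<And>c. c \<in> C \<Longrightarrow> cm a b' c = eps a b' (k2 \<rhd> c)" using cm_eps[OF B(1,3) x'] by blast
  have sq1: "eps a b (eps a b c) = sc d1 c" if "c \<in> C" for c using eps_eps[OF B(1,2) that] by (simp add: d1_def)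
  have g2g2: "g2 (g2 c) = sc (d1 * d2) c" if c: "c \<in> C" for c
  proof -
    have "g2 (g2 c) = eps a b (eps a b (eps a b' (eps a b' c)))"
      unfolding g2_def using balanced_commute[OF centralD(1)[OF c2] centralD(1)[OF c1]] B c by simp
    then show ?thesis using c B by (simp add: eps_eps l1 d1_def d2_def mult.commute)
  qed
  have main: "eps a b (cm a (b + b') c) = sc d1 (k1 \<rhd> c) + g2 (k2 \<rhd> c)" if c: "c \<in> C" for c
    unfolding cm_linear g2_def using k1 k2 c B by (simp add: l1 sq1)
  have t3: "t (ad k) k \<noteq> 0" if "k \<noteq> 0" for k using that unfolding t_ad_self by simp
  have "scalar_on_C g2"
  proof (rule ccontr)
    assume ns: "\<not> scalar_on_C g2"
    show False
    proof (cases "\<exists>y\<in>C. cm a (b + b') y \<noteq> 0")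
      case False
      have z: "sc d1 (k1 \<rhd> c) + g2 (k2 \<rhd> c) + sc 0 (0 \<rhd> c) = 0" if "c \<in> C" for c
        using main[OF that] False that by (simp add: l1)
      have "sc (t (ad k2) k1 * d1) c + sc (t (ad k2) k2) (g2 c) = 0" if "c \<in> C" for c
        using central_independent[OF central_scale cg2 central_scale k1(1) k2(1) B_closed(5) z, of "ad k2" c] that k2 by simp
      then show False using scalar_if_dependent[of _ "t (ad k2) k2" g2] t3[OF k2(2)] ns by blast
    next
      case True
      then obtain y where y: "y \<in> C" "cm a (b + b') y \<noteq> 0" by blast
      have B3: "b + b' \<in> B" using B by simp
      note c3 = central_eps[OF B(1) B3 y]
      obtain k3 where k3: "k3 \<in> B" "k3 \<noteq> 0" "\<And>c. c \<in> C \<Longrightarrow> cm a (b + b') c = eps a (b + b') (k3 \<rhd> c)" using cm_eps[OF B(1) B3 y] by blast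
      define d3 where "d3 = N (pp a (b + b'))"
      define g3 where "g3 c = eps a b (eps a (b + b') c)" for c
      have cg3: "central g3" unfolding g3_def by (rule central_compose[OF c1 c3])
      define mg3 where "mg3 c = sc (-1) (g3 c)" for c
      have cmg3: "central mg3" unfolding mg3_def by (rule central_compose[OF central_scale cg3])
      have g3g3: "g3 (g3 c) = sc (d1 * d3) c" if c: "c \<in> C" for c
      proof -
        have "g3 (g3 c) = eps a b (eps a b (eps a (b + b') (eps a (b + b') c)))"
          unfolding g3_def using balanced_commute[OF centralD(1)[OF c3] centralD(1)[OF c1]] B B3 c by simp
        then show ?thesis using c B B3 by (simp add: eps_eps l1 d1_def d3_def mult.commute)
      qed
      have z: "sc d1 (k1 \<rhd> c) + g2 (k2 \<rhd> c) + mg3 (k3 \<rhd> c) = 0" if "c \<in> C" for c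
        using main[OF that] k3(3)[OF that] by (simp add: mg3_def g3_def)
      have ind: "sc (t k k1 * d1) c + sc (t k k2) (g2 c) = sc (t k k3) (g3 c)" if "c \<in> C" "k \<in> B" for c k
        using central_independent[OF central_scale cg2 cmg3 k1(1) k2(1) k3(1) z that(2,1)] by (simp add: mg3_def)
      define \<alpha> where "\<alpha> = t (ad k3) k1 * d1 / t (ad k3) k3"
      define \<gamma> where "\<gamma> = t (ad k3) k2 / t (ad k3) k3"
      have g3: "g3 c = sc \<alpha> c + sc \<gamma> (g2 c)" if "c \<in> C" for c
      proof -
        have "sc (t (ad k3) k3) (g3 c) = sc (t (ad k3) k3) (sc \<alpha> c + sc \<gamma> (g2 c))"
          using ind[OF that ad_B[OF k3(1)]] t3[OF k3(2)] by (simp add: \<alpha>_def \<gamma>_def scale_right_distrib)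
        then show ?thesis using t3[OF k3(2)] by simp
      qed
      have ind2: "sc (t k k1 * d1 - t k k3 * \<alpha>) c + sc (t k k2 - t k k3 * \<gamma>) (g2 c) = 0" if "c \<in> C" "k \<in> B" for c k
        by (rule vec_eqI1[OF ind[OF that], where k = 1]) (simp only: g3[OF that(1)] lin_simps, algebra)
      have k2g: "t k k2 = t k k3 * \<gamma>" if "k \<in> B" for k
        using scalar_if_dependent[OF ind2[OF _ that]] ns by auto
      have x0: "x \<noteq> 0" using x by (auto simp: cm_linear)
      have k1a: "t k k1 * d1 = t k k3 * \<alpha>" if "k \<in> B" for k
        using ind2[OF x(1) that] k2g[OF that] x0 by simp
      \<comment> \<open>The coefficients of 1 and of g2 match separately for every k; the tests k =
        ad k1 and k = ad k2 produce t (ad k) k, a nonzero multiple of the norm.\<close>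
      have "\<alpha> \<noteq> 0" using k1a[OF ad_B[OF k1(1)]] t3[OF k1(2)] d1 by auto
      moreover have "\<gamma> \<noteq> 0" using k2g[OF ad_B[OF k2(1)]] t3[OF k2(2)] by auto
      ultimately have ne: "2 * \<alpha> * \<gamma> \<noteq> 0" by simp
      have "sc (\<alpha>^2 + \<gamma>^2 * (d1 * d2) - d1 * d3) c + sc (2 * \<alpha> * \<gamma>) (g2 c) = 0" if c: "c \<in> C" for c
      proof -
        have g2C: "g2 c \<in> C" using B c by (simp add: g2_def)
        have "sc (d1 * d3) c = g3 (sc \<alpha> c + sc \<gamma> (g2 c))" using g3g3[OF c] g3[OF c] by simp
        also have "\<dots> = sc \<alpha> (g3 c) + sc \<gamma> (g3 (g2 c))" using balanced_linear[OF centralD(1)[OF cg3]] by simp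
        finally have e: "sc (d1 * d3) c = sc \<alpha> (sc \<alpha> c + sc \<gamma> (g2 c)) + sc \<gamma> (sc \<alpha> (g2 c) + sc \<gamma> (sc (d1 * d2) c))"
          unfolding g3[OF c] g3[OF g2C] g2g2[OF c] .
        show ?thesis by (rule vec_eqI1[OF e, where k = "-1"]) (simp only: lin_simps, algebra)
      qed
      then show False using scalar_if_dependent[OF _ ne] ns by blast
    qed
  qed
  then obtain s where s: "\<And>c. c \<in> C \<Longrightarrow> g2 c = sc s c" by (auto simp: scalar_on_C_def)
  have "eps a b' c = sc (s / d1) (eps a b c)" if c: "c \<in> C" for c
  proof -
    have "sc d1 (eps a b' c) = eps a b (g2 c)" unfolding g2_def using sq1[of "eps a b' c"] c B by simp
    also have "\<dots> = sc s (eps a b c)" using s[OF c] by (simp add: l1)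
    also have "\<dots> = sc d1 (sc (s / d1) (eps a b c))" using d1 by simp
    finally show ?thesis by (rule scale_cancelI[OF d1])
  qed
  then show ?thesis by blast
qed

text \<open>Change one entry at a time, passing through noncommuting pairs. If both mixed pairs
  commute, a + a' commutes with neither b nor b'.\<close>

lemma eps_unique:
  assumes B: "a \<in> B" "b \<in> B" "a' \<in> B" "b' \<in> B" and x: "x \<in> C" "cm a b x \<noteq> 0" and x': "x' \<in> C" "cm a' b' x' \<noteq> 0"
  shows "\<exists>\<gamma>. \<forall>c\<in>C. eps a' b' c = sc \<gamma> (eps a b c)"
proof -
  have tr: "\<exists>\<gamma>. \<forall>c\<in>C. h c = sc \<gamma> (f c)" if "\<exists>\<gamma>. \<forall>c\<in>C. g c = sc \<gamma> (f c)" "\<exists>\<gamma>. \<forall>c\<in>C. h c = sc \<gamma> (g c)"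
    for f g h :: "'b \<Rightarrow> 'b"
  proof -
    from that obtain u v where "\<forall>c\<in>C. g c = sc u (f c)" "\<forall>c\<in>C. h c = sc v (g c)" by blast
    then have "\<forall>c\<in>C. h c = sc (v * u) (f c)" by simp
    then show ?thesis by blast
  qed
  have left: "\<exists>\<gamma>. \<forall>c\<in>C. eps a' b c = sc \<gamma> (eps a b c)"
    if "a \<in> B" "b \<in> B" "a' \<in> B" "x \<in> C" "cm a b x \<noteq> 0" "x' \<in> C" "cm a' b x' \<noteq> 0" for a b a' x x'
  proof -
    have "cm b a x \<noteq> 0" "cm b a' x' \<noteq> 0" using that cm_swap[of b a x] cm_swap[of b a' x'] by simp_all
    from eps_proportional[OF that(2,1,3,4) this(1) that(6) this(2)]
    show ?thesis using eps_swap[of b a] eps_swap[of b a'] by (metis minus_minus scale_minus_right)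
  qed
  show ?thesis
  proof (cases "\<exists>y\<in>C. cm a b' y \<noteq> 0")
    case True
    then obtain y where y: "y \<in> C" "cm a b' y \<noteq> 0" by blast
    show ?thesis by (rule tr[OF eps_proportional[OF B(1,2,4) x y] left[OF B(1,4,3) y x']])
  next
    case n1: False
    show ?thesis
    proof (cases "\<exists>y\<in>C. cm a' b y \<noteq> 0")
      case True
      then obtain y where y: "y \<in> C" "cm a' b y \<noteq> 0" by blast
      show ?thesis by (rule tr[OF left[OF B(1,2,3) x y] eps_proportional[OF B(3,2,4) y x']])
    next
      case n2: False
      have B': "a + a' \<in> B" using B by simp
      have y: "cm (a + a') b x \<noteq> 0" "cm (a + a') b' x' \<noteq> 0"
        using x x' n1 n2 by (simp_all add: cm_linear)
      have 1: "\<exists>\<gamma>. \<forall>c\<in>C. eps (a + a') b c = sc \<gamma> (eps a b c)" by (rule left[OF B(1,2) B' x x(1) y(1)])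
      have 2: "\<exists>\<gamma>. \<forall>c\<in>C. eps (a + a') b' c = sc \<gamma> (eps (a + a') b c)" by (rule eps_proportional[OF B' B(2,4) x(1) y(1) x'(1) y(2)])
      have 3: "\<exists>\<gamma>. \<forall>c\<in>C. eps a' b' c = sc \<gamma> (eps (a + a') b' c)" by (rule left[OF B' B(4,3) x'(1) y(2) x'])
      show ?thesis by (rule tr[OF tr[OF 1 2] 3])
    qed
  qed
qed

end

section \<open>The associative envelope\<close>

locale envelope = norm_subalgebra +
  fixes a0 b0 x0 :: 'b
  assumes a0: "a0 \<in> B" and b0: "b0 \<in> B" and x0: "x0 \<in> C" and noncomm: "cm a0 b0 x0 \<noteq> 0"
begin

definition E where "E c = eps a0 b0 c"
definition d where "d = N (pp a0 b0)"

lemma d_nonzero: "d \<noteq> 0" unfolding d_def using p0_nonzero(2)[OF a0 b0 x0 noncomm] by simp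
lemma x0_nonzero: "x0 \<noteq> 0" using noncomm by (auto simp: cm_linear)
lemma E_def': "E = eps a0 b0" by (rule ext) (simp add: E_def)
lemma E_E: "c \<in> C \<Longrightarrow> E (E c) = sc d c" unfolding E_def d_def by (rule eps_eps[OF a0 b0])
lemma central_E: "central E" unfolding E_def' by (rule central_eps[OF a0 b0 x0 noncomm])
lemmas balanced_E = centralD(1)[OF central_E]
lemma E_C [simp]: "c \<in> C \<Longrightarrow> E c \<in> C" by (rule balanced_closed[OF balanced_E])
lemmas E_linear = balanced_linear[OF balanced_E] balanced_diff[OF balanced_E]
lemma E_act: "k \<in> B \<Longrightarrow> c \<in> C \<Longrightarrow> E (k \<rhd> c) = k \<rhd> E c" by (rule centralD(2)[OF central_E])
lemma E_adjoint: "c \<in> C \<Longrightarrow> y \<in> C \<Longrightarrow> t (E c) y = - t c (E y)" unfolding E_def by (rule eps_adjoint[OF a0 b0])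
lemma E_inj: "c \<in> C \<Longrightarrow> E c = 0 \<Longrightarrow> c = 0" using E_E[of c] d_nonzero by (simp add: E_linear)

text \<open>The pair \<open>(a, a')\<close> stands for the operator \<open>a + E a'\<close> on \<open>C\<close>.\<close>
definition app where "app r c = fst r \<rhd> c + E (snd r \<rhd> c)"
abbreviation "R \<equiv> B \<times> B"

lemma app_C [simp]: "r \<in> R \<Longrightarrow> c \<in> C \<Longrightarrow> app r c \<in> C" by (auto simp: app_def)
lemma app_linear: "app r (c + c') = app r c + app r c'" "app r (sc k c) = sc k (app r c)"
  "app r (c - c') = app r c - app r c'" "app r (- c) = - app r c" "app r 0 = 0"
  by (simp_all add: app_def act_linear E_linear scale_right_distrib)

definition star :: "'b \<times> 'b \<Rightarrow> 'b \<times> 'b" where "star r = (fst r, - snd r)"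
lemma star_R [simp]: "r \<in> R \<Longrightarrow> star r \<in> R" by (auto simp: star_def)
lemma star_star [simp]: "star (star r) = r" by (simp add: star_def prod_eq_iff)
lemma app_star: assumes "r \<in> R" "c \<in> C" "c' \<in> C" shows "t (app r c) c' = t c (app (star r) c')"
proof -
  have "t (E (snd r \<rhd> c)) c' = t c (E ((- snd r) \<rhd> c'))"
    using assms by (auto simp: E_adjoint act_adjoint E_act act_linear E_linear bilin)
  then show ?thesis by (simp add: app_def star_def bilin act_adjoint)
qed

lemma C_eqI: assumes "x \<in> C" "y \<in> C" "\<And>z. z \<in> C \<Longrightarrow> t x z = t y z" shows "x = y"
proof (rule ccontr)
  assume "x \<noteq> y"
  then obtain z where z: "t (x - y) z \<noteq> 0" using t_nondegenerate[of "x - y"] by auto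
  obtain b c where bc: "b \<in> B" "c \<in> C" "z = b + c" using B_C_decomp(2) by blast
  then have "t (x - y) z = 0" using assms by (simp add: bilin C_D)
  with z show False by simp
qed

text \<open>Adding an operator to its adjoint isolates the part from \<open>B\<close>, subtracting
  isolates the part with E. Each can then be cancelled at the single vector
  \<open>x0\<close>.\<close>

lemma app_unique: assumes r: "r \<in> R" "s \<in> R" and eq: "\<And>c. c \<in> C \<Longrightarrow> app r c = app s c" shows "r = s"
proof -
  have eq': "app (star r) c = app (star s) c" if c: "c \<in> C" for c
  proof (rule C_eqI)
    show "t (app (star r) c) z = t (app (star s) c) z" if "z \<in> C" for z
      using app_star[of "star r" c z] app_star[of "star s" c z] eq[OF that] r c that by simp
  qed (use r c in simp_all)
  note e1 = eq[OF x0, unfolded app_def] and e2 = eq'[OF x0, unfolded app_def star_def fst_conv snd_conv]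
  have "sc 2 ((fst r - fst s) \<rhd> x0) = 0"
    by (rule vec_eqI2[OF e1 e2, where k = 1 and k' = 1]) (simp only: lin_simps act_linear E_linear, algebra)
  moreover have "sc 2 (E ((snd r - snd s) \<rhd> x0)) = 0"
    by (rule vec_eqI2[OF e1 e2, where k = 1 and k' = "-1"]) (simp only: lin_simps act_linear E_linear, algebra)
  ultimately have "(fst r - fst s) \<rhd> x0 = 0" "E ((snd r - snd s) \<rhd> x0) = 0" by simp_all
  moreover have "fst r - fst s \<in> B" "snd r - snd s \<in> B" using r by auto
  ultimately have "fst r - fst s = 0" "snd r - snd s = 0"
    using act_inj[OF _ x0] E_inj x0_nonzero x0 by (metis, metis act_closed)
  then show ?thesis by (simp add: prod_eq_iff)
qed

lemma kap_exists: assumes "a \<in> B" "b \<in> B" shows "\<exists>k\<in>B. \<forall>c\<in>C. cm a b c = E (k \<rhd> c)"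
proof (cases "\<exists>x\<in>C. cm a b x \<noteq> 0")
  case False
  then show ?thesis by (intro bexI[of _ 0]) (auto simp: act_linear E_linear)
next
  case True
  then obtain x where x: "x \<in> C" "cm a b x \<noteq> 0" by blast
  obtain k where k: "k \<in> B" "\<And>c. c \<in> C \<Longrightarrow> cm a b c = eps a b (k \<rhd> c)" using cm_eps[OF assms x] by blast
  obtain g where g: "\<And>c. c \<in> C \<Longrightarrow> eps a b c = sc g (E c)" using eps_unique[OF a0 b0 assms x0 noncomm x] unfolding E_def by blast
  show ?thesis by (rule bexI[of _ "sc g k"]) (use k g in \<open>simp_all add: act_linear E_linear\<close>)
qed

text \<open>The commutator divided by E. Linearity of expressions containing it is obtained from
  \<open>app_unique\<close>, not from the choice made here.\<close>

definition kap where "kap a b = (SOME k. k \<in> B \<and> (\<forall>c\<in>C. cm a b c = E (k \<rhd> c)))"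

lemma kap: assumes "a \<in> B" "b \<in> B" shows "kap a b \<in> B" "c \<in> C \<Longrightarrow> cm a b c = E (kap a b \<rhd> c)"
proof -
  have "\<exists>k. k \<in> B \<and> (\<forall>c\<in>C. cm a b c = E (k \<rhd> c))" using kap_exists[OF assms] by blast
  from someI_ex[OF this] show "kap a b \<in> B" "c \<in> C \<Longrightarrow> cm a b c = E (kap a b \<rhd> c)" unfolding kap_def by blast+
qed

text \<open>By \<open>central_trace\<close> the vanishing trace of the commutator is T (kap a b)
  times E, and E does not kill \<open>x0\<close>.\<close>

lemma T_kap: assumes "a \<in> B" "b \<in> B" shows "T (kap a b) = 0"
proof (rule ccontr)
  assume nz: "T (kap a b) \<noteq> 0"
  have "E x0 = 0"
  proof (rule n3_nondegenerate)
    show "E x0 \<in> C" using x0 by simp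
    fix x y assume xy: "x \<in> C" "y \<in> C"
    have "n3 (cm a b x0) x y + n3 x0 (cm a b x) y + n3 x0 x (cm a b y) = 0"
      using assms x0 xy by (simp add: n3_cm_sum)
    then have "T (kap a b) * n3 (E x0) x y = 0"
      using central_trace[OF central_E kap(1)[OF assms] x0 xy] kap(2)[OF assms] x0 xy by simp
    then show "n3 x y (E x0) = 0" using nz n3_sym by (metis mult_eq_0_iff)
  qed
  then show False using E_inj x0 x0_nonzero by blast
qed

lemma act_act: assumes "a \<in> B" "b \<in> B" "c \<in> C" shows "a \<rhd> b \<rhd> c = jm a b \<rhd> c + E (sc (1/2) (kap a b) \<rhd> c)"
proof -
  have 1: "a \<rhd> b \<rhd> c + b \<rhd> a \<rhd> c = sc 2 (jm a b \<rhd> c)" by (rule act_jm[OF assms])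
  have 2: "a \<rhd> b \<rhd> c - b \<rhd> a \<rhd> c = sc 2 (E (sc (1/2) (kap a b) \<rhd> c))" 
    using kap(2)[OF assms] by (simp add: cm_def act_linear E_linear)
  show ?thesis
    by (rule scale_cancelI[OF two], rule vec_eqI2[OF 1 2, where k = 1 and k' = 1])
      (simp only: lin_simps, algebra)
qed

text \<open>The product of a + E a' and b + E b', expanded by \<open>act_act\<close> and E^2 =
  d.\<close>

definition mul where "mul r s =
  (jm (fst r) (fst s) + sc d (jm (snd r) (snd s)) + sc (d * (1/2)) (kap (snd r) (fst s) + kap (fst r) (snd s)),
   jm (snd r) (fst s) + jm (fst r) (snd s) + sc (1/2) (kap (fst r) (fst s) + sc d (kap (snd r) (snd s))))"

lemma mul_R [simp]: "r \<in> R \<Longrightarrow> s \<in> R \<Longrightarrow> mul r s \<in> R"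
  by (auto simp: mul_def kap)

lemma app_mul: assumes "r \<in> R" "s \<in> R" "c \<in> C" shows "app (mul r s) c = app r (app s c)"
proof -
  obtain a a' where r: "r = (a, a')" "a \<in> B" "a' \<in> B" using assms by blast
  obtain b b' where s: "s = (b, b')" "b \<in> B" "b' \<in> B" using assms by blast
  note k = kap(1)[OF r(2) s(2)] kap(1)[OF r(2) s(3)] kap(1)[OF r(3) s(2)] kap(1)[OF r(3) s(3)]
  have "app r (app s c) = a \<rhd> b \<rhd> c + E (a \<rhd> b' \<rhd> c) + E (a' \<rhd> b \<rhd> c) + sc d (a' \<rhd> b' \<rhd> c)"
    using r s assms(3) by (simp add: app_def act_linear E_linear E_E flip: E_act)
  also have "\<dots> = app (mul r s) c"
    unfolding act_act[OF r(2) s(2) assms(3)] act_act[OF r(2) s(3) assms(3)] act_act[OF r(3) s(2) assms(3)] act_act[OF r(3) s(3) assms(3)]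
    unfolding r s app_def mul_def fst_conv snd_conv
    by (rule vec_eqI) (simp only: lin_simps act_linear E_linear E_E k r s assms(3) act_closed, algebra)
  finally show ?thesis by simp
qed

definition tr where "tr r = T (fst r)"

lemma tr_mul: assumes "r \<in> R" "s \<in> R" shows "tr (mul r s) = t (fst r) (fst s) + d * t (snd r) (snd s)"
  using assms by (auto simp: tr_def mul_def T_linear T_jm T_kap)

lemma tr_commute: assumes "r \<in> R" "s \<in> R" shows "tr (mul r s) = tr (mul s r)"
  using assms by (simp add: tr_mul t_commute)

lemma mul_assoc: "r \<in> R \<Longrightarrow> s \<in> R \<Longrightarrow> r' \<in> R \<Longrightarrow> mul (mul r s) r' = mul r (mul s r')"
  by (rule app_unique) (simp_all add: app_mul)

lemma star_eqI:
  assumes "w \<in> R" "w' \<in> R" "\<And>x y. x \<in> C \<Longrightarrow> y \<in> C \<Longrightarrow> t (app w x) y = t x (app w' y)"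
  shows "star w = w'"
proof (rule app_unique)
  fix c assume c: "c \<in> C"
  show "app (star w) c = app w' c"
  proof (rule C_eqI)
    fix z assume z: "z \<in> C"
    have "t (app (star w) c) z = t c (app w z)" using app_star[of "star w" c z] assms c z by simp
    also have "\<dots> = t (app w' c) z" using assms(3)[OF z c] t_commute by metis
    finally show "t (app (star w) c) z = t (app w' c) z" .
  qed (use assms c in simp_all)
qed (use assms in simp_all)

lemma star_mul: assumes "r \<in> R" "s \<in> R" shows "star (mul r s) = mul (star s) (star r)"
  by (rule star_eqI) (use assms in \<open>simp_all add: app_mul app_star\<close>)

definition inc :: "'b \<Rightarrow> 'b \<times> 'b" where "inc a = (a, 0)"
lemma inc_R [simp]: "a \<in> B \<Longrightarrow> inc a \<in> R" by (simp add: inc_def)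
lemma app_inc: "app (inc a) c = a \<rhd> c" by (simp add: app_def inc_def act_linear E_linear)
lemma star_inc [simp]: "star (inc a) = inc a" by (simp add: star_def inc_def)
lemma self_adjoint: assumes "r \<in> R" "star r = r" obtains a where "a \<in> B" "r = inc a"
proof
  have "snd r = - snd r" using assms(2) by (metis snd_conv star_def)
  then have "sc 2 (snd r) = 0" by (metis scale_left_distrib scale_one one_add_one add.right_inverse)
  then have "snd r = 0" by simp
  then show "r = inc (fst r)" by (simp add: inc_def prod_eq_iff)
  show "fst r \<in> B" using assms by auto
qed

definition ee where "ee \<alpha> \<beta> = (sc \<alpha> e, sc \<beta> e)"
lemma ee_R [simp]: "ee \<alpha> \<beta> \<in> R" by (simp add: ee_def)
lemma app_ee: "c \<in> C \<Longrightarrow> app (ee \<alpha> \<beta>) c = sc \<alpha> c + sc \<beta> (E c)" by (simp add: app_def ee_def act_linear act_e E_linear)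
lemma ee_inj: "ee \<alpha> \<beta> = ee \<alpha>' \<beta>' \<longleftrightarrow> \<alpha> = \<alpha>' \<and> \<beta> = \<beta>'" using e_nonzero by (auto simp: ee_def)
lemma ee_central: "r \<in> R \<Longrightarrow> c \<in> C \<Longrightarrow> app r (app (ee \<alpha> \<beta>) c) = app (ee \<alpha> \<beta>) (app r c)"
  by (auto simp: app_ee) (simp add: app_def act_linear E_linear E_act algebra_simps)
lemma app_ee_ee: "c \<in> C \<Longrightarrow> app (ee \<alpha> \<beta>) (app (ee \<alpha>' \<beta>') c) = app (ee (\<alpha> * \<alpha>' + d * \<beta> * \<beta>') (\<alpha> * \<beta>' + \<beta> * \<alpha>')) c"
  by (rule vec_eqI) (simp only: app_ee app_C ee_R E_linear E_E E_C C_closed lin_simps, algebra)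

section \<open>Reduced adjoint, reduced norm and inverses\<close>

definition adR where "adR r = (ad (fst r) + sc d (ad (snd r)), cr (fst r) (snd r))"
text \<open>\<open>nr\<close> and \<open>ni\<close> are the components of N(a + E a') = nr + E ni,
  expanded formally with E^2 = d.\<close>

definition nr where "nr r = N (fst r) + d * t (fst r) (ad (snd r))"
definition ni where "ni r = t (ad (fst r)) (snd r) + d * N (snd r)"
abbreviation "nn r \<equiv> ee (nr r) (ni r)"
lemma adR_R [simp]: "r \<in> R \<Longrightarrow> adR r \<in> R" by (auto simp: adR_def)

lemma act_ad_polar: assumes "a \<in> B" "b \<in> B" "c \<in> C"
  shows "a \<rhd> cr a b \<rhd> c + b \<rhd> ad a \<rhd> c = sc (t (ad a) b) c" "cr a b \<rhd> a \<rhd> c + ad a \<rhd> b \<rhd> c = sc (t (ad a) b) c"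
proof -
  have ab: "a + b \<in> B" "a - b \<in> B" using assms by simp_all
  show "a \<rhd> cr a b \<rhd> c + b \<rhd> ad a \<rhd> c = sc (t (ad a) b) c"
    by (rule scale_cancelI[OF two], rule vec_eqI3[OF act_ad(1)[OF ab(1) assms(3)] act_ad(1)[OF ab(2) assms(3)] act_ad(1)[OF assms(2,3)],
        where k = 1 and k' = "-1" and k'' = "-2"])
      (simp only: lin_simps act_linear ad_add ad_diff N_add N_diff, algebra)
  show "cr a b \<rhd> a \<rhd> c + ad a \<rhd> b \<rhd> c = sc (t (ad a) b) c"
    by (rule scale_cancelI[OF two], rule vec_eqI3[OF act_ad(2)[OF ab(1) assms(3)] act_ad(2)[OF ab(2) assms(3)] act_ad(2)[OF assms(2,3)],
        where k = 1 and k' = "-1" and k'' = "-2"])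
      (simp only: lin_simps act_linear ad_add ad_diff N_add N_diff, algebra)
qed

lemma app_adR: assumes "r \<in> R" "c \<in> C" shows "app r (app (adR r) c) = app (nn r) c" "app (adR r) (app r c) = app (nn r) c"
proof -
  obtain a a' where r: "r = (a, a')" "a \<in> B" "a' \<in> B" using assms by blast
  note c = assms(2)
  note p1 = act_ad_polar[OF r(2,3) c] and p2 = act_ad_polar[OF r(3,2) c, unfolded cr_commute[of a' a] t_commute[of "ad a'" a]]
  note q = act_ad[OF r(2) c] act_ad[OF r(3) c]
  have "app r (app (adR r) c) = a \<rhd> ad a \<rhd> c + E (a \<rhd> cr a a' \<rhd> c + a' \<rhd> ad a \<rhd> c) + sc d (a' \<rhd> cr a a' \<rhd> c + a \<rhd> ad a' \<rhd> c) + sc d (E (a' \<rhd> ad a' \<rhd> c))"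
    using r c by (simp add: app_def adR_def act_linear E_linear E_E scale_right_distrib flip: E_act)
  also have "\<dots> = app (nn r) c" unfolding p1 p2 q app_ee[OF c] E_linear
    by (rule vec_eqI) (simp only: lin_simps nr_def ni_def r fst_conv snd_conv, algebra)
  finally show "app r (app (adR r) c) = app (nn r) c" .
  have "app (adR r) (app r c) = ad a \<rhd> a \<rhd> c + E (cr a a' \<rhd> a \<rhd> c + ad a \<rhd> a' \<rhd> c) + sc d (cr a a' \<rhd> a' \<rhd> c + ad a' \<rhd> a \<rhd> c) + sc d (E (ad a' \<rhd> a' \<rhd> c))"
    using r c by (simp add: app_def adR_def act_linear E_linear E_E scale_right_distrib flip: E_act)
  also have "\<dots> = app (nn r) c" unfolding p1 p2 q app_ee[OF c] E_linear
    by (rule vec_eqI) (simp only: lin_simps nr_def ni_def r fst_conv snd_conv, algebra)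
  finally show "app (adR r) (app r c) = app (nn r) c" .
qed

lemma n3_app: assumes "r \<in> R" "x \<in> C" "y \<in> C" "z \<in> C"
  shows "n3 (app r x) (app r y) z = n3 x y (app (adR r) z)"
proof -
  obtain a a' where r: "r = (a, a')" "a \<in> B" "a' \<in> B" using assms by blast
  note b = balancedD[OF balanced_E]
  have 1: "n3 (a \<rhd> x) (a \<rhd> y) z = n3 x y (ad a \<rhd> z)" using n3_act r assms by simp
  have 2: "n3 (a \<rhd> x) (E (a' \<rhd> y)) z + n3 (E (a' \<rhd> x)) (a \<rhd> y) z = n3 x y (E (cr a a' \<rhd> z))"
    using b(2)[of "a \<rhd> x" "a' \<rhd> y" z] b(3)[of "a' \<rhd> x" "a \<rhd> y" z] n3_act_polar[of a a' x y "E z"] r assms by (simp add: E_act)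
  have 3: "n3 (E (a' \<rhd> x)) (E (a' \<rhd> y)) z = d * n3 x y (ad a' \<rhd> z)"
    using b(3)[of "a' \<rhd> x" "E (a' \<rhd> y)" z] b(2)[of "a' \<rhd> x" "a' \<rhd> y" "E z"] n3_act[of a' x y z] r assms by (simp add: E_E n3_linear)
  show ?thesis unfolding r app_def adR_def fst_conv snd_conv n3_linear act_linear 1 3 2[symmetric] by algebra
qed

lemma n3_app_cube: assumes "r \<in> R" "x \<in> C" "y \<in> C" "z \<in> C"
  shows "n3 (app r x) (app r y) (app r z) = n3 x y (app (nn r) z)"
  using assms by (simp add: n3_app app_adR)

lemma nn_unique: assumes "\<And>x y z. x \<in> C \<Longrightarrow> y \<in> C \<Longrightarrow> z \<in> C \<Longrightarrow> n3 x y (app (ee \<alpha> \<beta>) z) = n3 x y (app (ee \<alpha>' \<beta>') z)"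
  shows "\<alpha> = \<alpha>' \<and> \<beta> = \<beta>'"
proof -
  have "ee \<alpha> \<beta> = ee \<alpha>' \<beta>'"
    by (rule app_unique) (auto intro!: n3_eqI assms)
  then show ?thesis by (simp add: ee_inj)
qed

text \<open>The reduced norm is determined by how an operator scales the cubic form, and composition
  scales it twice.\<close>

lemma nn_mul: assumes "r \<in> R" "s \<in> R"
  shows "nr (mul r s) = nr r * nr s + d * ni r * ni s" "ni (mul r s) = nr r * ni s + ni r * nr s"
proof -
  have "nr (mul r s) = nr r * nr s + d * ni r * ni s \<and> ni (mul r s) = nr r * ni s + ni r * nr s"
  proof (rule nn_unique)
    fix x y z assume xyz: "x \<in> C" "y \<in> C" "z \<in> C"
    have "n3 x y (app (nn (mul r s)) z) = n3 (app (mul r s) x) (app (mul r s) y) (app (mul r s) z)"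
      using xyz assms by (simp only: n3_app_cube mul_R)
    also have "\<dots> = n3 (app r (app s x)) (app r (app s y)) (app r (app s z))" using xyz assms by (simp add: app_mul)
    also have "\<dots> = n3 (app s x) (app s y) (app s (app (nn r) z))"
      using xyz assms ee_central[OF assms(2) xyz(3), of "nr r" "ni r"] by (simp only: n3_app_cube app_C)
    also have "\<dots> = n3 x y (app (nn s) (app (nn r) z))" using xyz assms by (simp only: n3_app_cube app_C ee_R)
    also have "\<dots> = n3 x y (app (nn r) (app (nn s) z))" by (subst ee_central[OF ee_R xyz(3)]) (rule refl)
    finally show "n3 x y (app (nn (mul r s)) z) = n3 x y (app (ee (nr r * nr s + d * ni r * ni s) (nr r * ni s + ni r * nr s)) z)"
      using xyz by (simp only: app_ee_ee)
  qed
  then show "nr (mul r s) = nr r * nr s + d * ni r * ni s" "ni (mul r s) = nr r * ni s + ni r * nr s" by auto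
qed

lemma nn_star: "nr (star r) = nr r" "ni (star r) = - ni r"
  by (simp_all add: nr_def ni_def star_def ad_minus N_minus bilin)
lemma nn_inc: "nr (inc a) = N a" "ni (inc a) = 0" by (simp_all add: nr_def ni_def inc_def bilin)

text \<open>The norm from K[E] to K of the reduced norm; r is invertible when it is nonzero, also
  when d is a square.\<close>

definition "nu r = nr r ^ 2 - d * ni r ^ 2"

lemma nu_mul: "r \<in> R \<Longrightarrow> s \<in> R \<Longrightarrow> nu (mul r s) = nu r * nu s"
  unfolding nu_def nn_mul by algebra

lemma ee_inverse: assumes "c \<in> C" "nu r \<noteq> 0"
  shows "app (ee (nr r / nu r) (- ni r / nu r)) (app (nn r) c) = c"
proof -
  have "nr r / nu r * nr r + d * (- ni r / nu r) * ni r = 1"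
  proof -
    have "nr r / nu r * nr r + d * (- ni r / nu r) * ni r = (nr r ^ 2 - d * ni r ^ 2) / nu r"
      by (simp add: power2_eq_square diff_divide_distrib)
    then show ?thesis using assms(2) by (simp add: nu_def)
  qed
  moreover have "nr r / nu r * ni r + - ni r / nu r * nr r = 0" by simp
  ultimately show ?thesis using assms unfolding app_ee_ee[OF assms(1)] by (simp only: app_ee) simp
qed

definition invR where "invR r = mul (ee (nr r / nu r) (- ni r / nu r)) (adR r)"
lemma invR_R [simp]: "r \<in> R \<Longrightarrow> invR r \<in> R" by (simp add: invR_def)
lemma app_invR: assumes "r \<in> R" "c \<in> C" "nu r \<noteq> 0" shows "app (invR r) (app r c) = c" "app r (app (invR r) c) = c"
proof -
  have "app (invR r) (app r c) = app (ee (nr r / nu r) (- ni r / nu r)) (app (adR r) (app r c))"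
    using assms by (simp add: invR_def app_mul)
  then show "app (invR r) (app r c) = c" using ee_inverse[OF assms(2,3)] assms by (simp only: app_adR)
  have "app r (app (invR r) c) = app (ee (nr r / nu r) (- ni r / nu r)) (app r (app (adR r) c))"
    using assms by (simp add: invR_def app_mul ee_central)
  then show "app r (app (invR r) c) = c" using ee_inverse[OF assms(2,3)] assms by (simp only: app_adR)
qed

end

section \<open>Intertwiners\<close>

context envelope begin

text \<open>Every image \<open>app r c\<close> has norm 0 by the scaling identity. The reduced norm
  is thus anisotropic even when K[E] has zero divisors and \<open>nu\<close> can vanish.\<close>

lemma nn_zero: assumes "r \<in> R" "nr r = 0" "ni r = 0" shows "r = (0, 0)"
proof (rule app_unique)
  fix c assume c: "c \<in> C"
  have "n3 (app r c) (app r c) (app r c) = 0"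
    unfolding n3_app_cube[OF assms(1) c c c] assms(2,3) app_ee[OF c] by (simp add: n3_linear)
  then have "app r c = 0" by (simp add: N_n3)
  then show "app r c = app (0, 0) c" by (simp add: app_def act_linear E_linear)
qed (use assms in auto)

definition faithful where "faithful c \<longleftrightarrow> c \<in> C \<and> (\<forall>r\<in>R. app r c = 0 \<longrightarrow> r = (0, 0))"

text \<open>The hypothesis makes n3 c c (E c) + E n3 c c c an invertible element of K[E]. If r kills
  c, the product of nn r with this element is 0, so nn r is 0.\<close>

lemma faithful_if:
  assumes c: "c \<in> C" and ne: "n3 c c (E c) ^ 2 \<noteq> d * n3 c c c ^ 2"
  shows "faithful c"
proof -
  have "r = (0, 0)" if r: "r \<in> R" and z: "app r c = 0" for r
  proof -
    let ?n = "n3 c c c" and ?n' = "n3 c c (E c)"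
    have nz: "app (nn r) c = 0" using app_adR(2)[OF r c] z by (simp add: app_linear)
    then have 1: "n3 c c (app (nn r) c) = 0" by (simp add: n3_linear)
    have "n3 c c (E (app (nn r) c)) = 0" using nz by (simp add: n3_linear E_linear)
    then have 2: "nr r * ?n' + d * ni r * ?n = 0"
      using c by (simp add: app_ee E_linear E_E n3_linear mult.assoc mult.left_commute)
    have 1: "nr r * ?n + ni r * ?n' = 0" using 1 c by (simp add: app_ee n3_linear)
    have "ni r * (?n' ^ 2 - d * ?n ^ 2) = ?n' * (nr r * ?n + ni r * ?n') - ?n * (nr r * ?n' + d * ni r * ?n)" by algebra
    then have ni: "ni r = 0" using ne 1 2 by simp
    have "nr r * (?n' ^ 2 - d * ?n ^ 2) = ?n' * (nr r * ?n' + d * ni r * ?n) - d * ?n * (nr r * ?n + ni r * ?n')" by algebra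
    then have "nr r = 0" using ne 1 2 by simp
    with ni show ?thesis using nn_zero[OF r] by blast
  qed
  then show ?thesis using c by (simp add: faithful_def)
qed

text \<open>If d is not a square every nonzero vector works. If d = k^2, the eigenspaces of E for k
  and -k are orthogonal for the cubic form, and a sum of nonzero vectors from both works.\<close>

lemma faithful_exists: "\<exists>c. faithful c"
proof (cases "\<exists>k. d = k ^ 2")
  case False
  have n: "n3 x0 x0 x0 \<noteq> 0" using x0_nonzero by (simp add: N_n3)
  have "n3 x0 x0 (E x0) ^ 2 \<noteq> d * n3 x0 x0 x0 ^ 2"
  proof
    assume "n3 x0 x0 (E x0) ^ 2 = d * n3 x0 x0 x0 ^ 2"
    then have "d = (n3 x0 x0 (E x0) / n3 x0 x0 x0) ^ 2" using n by (simp add: power_divide)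
    with False show False by blast
  qed
  then show ?thesis using faithful_if x0 by blast
next
  case True
  then obtain k where k: "d = k ^ 2" by blast
  have k0: "k \<noteq> 0" using k d_nonzero by auto
  have ex: "\<exists>c\<in>C. E c + sc k c \<noteq> 0" for k
  proof (rule ccontr)
    assume "\<not> ?thesis"
    then have "app (ee k 1) c = app (ee 0 0) c" if "c \<in> C" for c using that by (simp add: app_ee add.commute)
    then have "ee k 1 = ee 0 0" by (intro app_unique) auto
    then show False by (simp add: ee_inj)
  qed
  obtain x where x: "x \<in> C" "E x + sc k x \<noteq> 0" using ex by blast
  obtain y where y: "y \<in> C" "E y + sc (- k) y \<noteq> 0" using ex by blast
  define c1 where "c1 = E x + sc k x" define c2 where "c2 = E y + sc (- k) y"
  have C12: "c1 \<in> C" "c2 \<in> C" and nz: "c1 \<noteq> 0" "c2 \<noteq> 0" unfolding c1_def c2_def using x y by simp_all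
  have E1: "E c1 = sc k c1" and E2: "E c2 = sc (- k) c2"
    unfolding c1_def c2_def using x y by (simp_all add: E_linear E_E k scale_right_distrib scale_right_diff_distrib power2_eq_square add.commute)
  note b = balancedD[OF balanced_E]
  have z: "n3 c1 c2 w = 0" if w: "w \<in> C" for w
  proof -
    have "k * n3 c1 c2 w = - k * n3 c1 c2 w" using b(1)[OF C12 w] unfolding E1 E2 n3_linear .
    then have "2 * (k * n3 c1 c2 w) = 0" by simp
    then show ?thesis using k0 by simp
  qed
  have z': "n3 c1 c2 w = 0" "n3 c2 c1 w = 0" "n3 c1 w c2 = 0" "n3 c2 w c1 = 0" "n3 w c1 c2 = 0" "n3 w c2 c1 = 0" if "w \<in> C" for w
    using z[OF that] n3_sym by metis+
  have n: "n3 (c1 + c2) (c1 + c2) (c1 + c2) = n3 c1 c1 c1 + n3 c2 c2 c2"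
    "n3 (c1 + c2) (c1 + c2) (E (c1 + c2)) = k * n3 c1 c1 c1 - k * n3 c2 c2 c2"
    unfolding E_linear E1 E2 n3_linear using z' C12 by simp_all
  have "n3 (c1 + c2) (c1 + c2) (E (c1 + c2)) ^ 2 - d * n3 (c1 + c2) (c1 + c2) (c1 + c2) ^ 2 = - (4 * d * (n3 c1 c1 c1 * n3 c2 c2 c2))"
    unfolding n k by algebra
  moreover have "4 * d * (n3 c1 c1 c1 * n3 c2 c2 c2) \<noteq> 0"
  proof -
    have "n3 c1 c1 c1 \<noteq> 0" "n3 c2 c2 c2 \<noteq> 0" using nz by (simp_all add: N_n3)
    then show ?thesis using d_nonzero by simp
  qed
  ultimately have "n3 (c1 + c2) (c1 + c2) (E (c1 + c2)) ^ 2 \<noteq> d * n3 (c1 + c2) (c1 + c2) (c1 + c2) ^ 2" by auto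
  then show ?thesis using faithful_if[of "c1 + c2"] C12 by auto
qed

lemma faithful_cyclic:
  assumes f: "faithful c0" and dimC: "dim C = dim B + dim B" and c: "c \<in> C"
  shows "\<exists>r\<in>R. c = app r c0"
proof -
  have c0: "c0 \<in> C" and inj: "\<And>r. r \<in> R \<Longrightarrow> app r c0 = 0 \<Longrightarrow> r = (0, 0)" using f by (auto simp: faithful_def)
  have l1: "Vector_Spaces.linear sc sc (\<lambda>a. a \<rhd> c0)" and l2: "Vector_Spaces.linear sc sc (\<lambda>a. E (a \<rhd> c0))"
    unfolding linear_iff' by (simp_all add: act_linear E_linear)
  let ?S1 = "(\<lambda>a. a \<rhd> c0) ` B" and ?S2 = "(\<lambda>a. E (a \<rhd> c0)) ` B"
  let ?S = "{x + y |x y. x \<in> ?S1 \<and> y \<in> ?S2}"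
  have s: "subspace ?S1" "subspace ?S2" by (intro subspace_linear_image B_subspace l1 l2)+
  have d1: "dim ?S1 = dim B"
    by (rule dim_linear_image[OF B_subspace l1]) (use inj[of "(_, 0)"] in \<open>simp add: app_def act_linear E_linear\<close>)
  have d2: "dim ?S2 = dim B"
    by (rule dim_linear_image[OF B_subspace l2]) (use inj[of "(0, _)"] in \<open>simp add: app_def act_linear E_linear\<close>)
  have "?S1 \<inter> ?S2 = {0}"
  proof -
    have "x = 0" if x12: "x \<in> ?S1" "x \<in> ?S2" for x
    proof -
      obtain a where a: "a \<in> B" "x = a \<rhd> c0" using x12 by blast
      obtain a' where a': "a' \<in> B" "x = E (a' \<rhd> c0)" using x12 by blast
      have "app (a, - a') c0 = 0" using a a' by (simp add: app_def act_linear E_linear)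
      then have "a = 0" using inj[of "(a, - a')"] a a' by simp
      then show ?thesis using a by (simp add: act_linear)
    qed
    then show ?thesis using subspace_0[OF s(1)] subspace_0[OF s(2)] by blast
  qed
  then have "dim ?S = dim C" using dim_sums_Int[OF s] d1 d2 dimC by simp
  moreover have "?S \<subseteq> C" using c0 by auto
  ultimately have "?S = C" by (intro subspace_dim_equal subspace_sums s C_subspace) auto
  then obtain a a' where "a \<in> B" "a' \<in> B" "c = a \<rhd> c0 + E (a' \<rhd> c0)" using c by blast
  then show ?thesis by (intro bexI[of _ "(a, a')"]) (auto simp: app_def)
qed

section \<open>The Skolem-Noether intertwiner\<close>

definition isR where "isR f \<longleftrightarrow> (\<exists>r\<in>R. \<forall>c\<in>C. f c = app r c)"

lemma isR_act: "a \<in> B \<Longrightarrow> isR (\<lambda>c. a \<rhd> c)"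
  unfolding isR_def by (rule bexI[of _ "inc a"]) (auto simp: app_inc)
lemma isR_add: assumes "isR f" "isR g" shows "isR (\<lambda>c. f c + g c)"
proof -
  obtain r s where "r \<in> R" "s \<in> R" "\<forall>c\<in>C. f c = app r c" "\<forall>c\<in>C. g c = app s c" using assms by (auto simp: isR_def)
  then show ?thesis unfolding isR_def
    by (intro bexI[of _ "(fst r + fst s, snd r + snd s)"]) (auto simp: app_def act_linear E_linear)
qed
lemma isR_scale: assumes "isR f" shows "isR (\<lambda>c. sc k (f c))"
proof -
  obtain r where "r \<in> R" "\<forall>c\<in>C. f c = app r c" using assms by (auto simp: isR_def)
  then show ?thesis unfolding isR_def
    by (intro bexI[of _ "(sc k (fst r), sc k (snd r))"]) (auto simp: app_def act_linear E_linear scale_right_distrib)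
qed
lemma isR_comp: assumes "isR f" "isR g" shows "isR (\<lambda>c. f (g c))"
proof -
  obtain r s where "r \<in> R" "s \<in> R" "\<forall>c\<in>C. f c = app r c" "\<forall>c\<in>C. g c = app s c" using assms by (auto simp: isR_def)
  then show ?thesis unfolding isR_def by (intro bexI[of _ "mul r s"]) (auto simp: app_mul)
qed
lemma isR_id: "isR (\<lambda>c. c)" unfolding isR_def by (rule bexI[of _ "inc e"]) (auto simp: app_inc act_e)

text \<open>With f the common characteristic polynomial, \<Phi> is the divided difference of f with
  one variable acting as l' on the left and the other as l on the right, the terms without l' being
  gathered in ad l. Hence l' \<Phi>(z) - \<Phi>(z) l = f(l') z - z f(l) = 0.\<close>

lemma intertwiner_nonzero:
  assumes l: "l \<in> B" and l': "l' \<in> B" and eq: "T l' = T l" "T (ad l') = T (ad l)" "N l' = N l"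
    and y: "y \<in> B" "x \<in> C" "cm l y x \<noteq> 0" and w: "w \<in> B" "x' \<in> C" "cm l' w x' \<noteq> 0"
  shows "\<exists>r\<in>R. r \<noteq> (0, 0) \<and> (\<forall>c\<in>C. app r (l \<rhd> c) = l' \<rhd> app r c)"
proof -
  define \<Phi> where "\<Phi> z c = l' \<rhd> l' \<rhd> z c + l' \<rhd> z (l \<rhd> c) + sc (- T l) (l' \<rhd> z c) + z (ad l \<rhd> c)" for z c
  have R: "isR (\<Phi> z)" if "isR z" for z
  proof -
    note A = isR_act[OF l']
    have "isR (\<lambda>c. l' \<rhd> l' \<rhd> z c)" by (rule isR_comp[OF A isR_comp[OF A that]])
    moreover have "isR (\<lambda>c. l' \<rhd> z (l \<rhd> c))" by (rule isR_comp[OF A isR_comp[OF that isR_act[OF l]]])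
    moreover have "isR (\<lambda>c. sc (- T l) (l' \<rhd> z c))" by (rule isR_scale[OF isR_comp[OF A that]])
    moreover have "isR (\<lambda>c. z (ad l \<rhd> c))" by (rule isR_comp[OF that isR_act[OF ad_B[OF l]]])
    ultimately show ?thesis unfolding \<Phi>_def by (rule isR_add[OF isR_add[OF isR_add]])
  qed
  have int: "\<Phi> z (l \<rhd> c) = l' \<rhd> \<Phi> z c" if z: "isR z" and c: "c \<in> C" for z c
  proof -
    obtain r where r: "r \<in> R" "\<And>c. c \<in> C \<Longrightarrow> z c = app r c" using z by (auto simp: isR_def)
    have zC: "app r c \<in> C" using r c by simp
    have 1: "l' \<rhd> l' \<rhd> l' \<rhd> app r c - sc (T l) (l' \<rhd> l' \<rhd> app r c) + sc (T (ad l)) (l' \<rhd> app r c) = sc (N l) (app r c)"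
      using act_ad(1)[OF l' zC] unfolding act_ad_expand[OF l' zC] eq by (simp add: act_linear)
    have 2: "z (ad l \<rhd> l \<rhd> c) = sc (N l) (app r c)" "z (ad l \<rhd> c) = app r (l \<rhd> l \<rhd> c) - sc (T l) (app r (l \<rhd> c)) + sc (T (ad l)) (app r c)"
      using r l c act_ad(2)[OF l c] by (simp_all add: app_linear) (simp add: act_ad_expand app_linear)
    have 3: "z (l \<rhd> c) = app r (l \<rhd> c)" "z (l \<rhd> l \<rhd> c) = app r (l \<rhd> l \<rhd> c)" "z c = app r c" using r l c by simp_all
    show ?thesis unfolding \<Phi>_def 2 3
      by (rule vec_eqI1[OF 1, where k = "-1"]) (simp only: lin_simps act_linear, algebra)
  qed
  \<comment> \<open>Compares \<Phi>(z) y with \<Phi>(z y): they differ only in commutators of y with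
    l and with ad l.\<close>
  have step: "l' \<rhd> z (cm l y c) + z (cm (ad l) y c) = 0"
    if z: "isR z" and 0: "\<And>c. c \<in> C \<Longrightarrow> \<Phi> z c = 0" "\<And>c. c \<in> C \<Longrightarrow> \<Phi> (\<lambda>c. z (y \<rhd> c)) c = 0" and c: "c \<in> C" for z c
  proof -
    obtain r where r: "r \<in> R" "\<And>c. c \<in> C \<Longrightarrow> z c = app r c" using z by (auto simp: isR_def)
    have 1: "\<Phi> z (y \<rhd> c) = 0" and 2: "\<Phi> (\<lambda>c. z (y \<rhd> c)) c = 0" using 0 y c by simp_all
    have m: "z (cm l y c) = app r (l \<rhd> y \<rhd> c) - app r (y \<rhd> l \<rhd> c)" "z (cm (ad l) y c) = app r (ad l \<rhd> y \<rhd> c) - app r (y \<rhd> ad l \<rhd> c)"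
      using r y l c by (simp_all) (simp_all add: cm_def app_linear)
    have e: "z (y \<rhd> c) = app r (y \<rhd> c)" "z (l \<rhd> y \<rhd> c) = app r (l \<rhd> y \<rhd> c)" "z (y \<rhd> l \<rhd> c) = app r (y \<rhd> l \<rhd> c)"
      "z (ad l \<rhd> y \<rhd> c) = app r (ad l \<rhd> y \<rhd> c)" "z (y \<rhd> ad l \<rhd> c) = app r (y \<rhd> ad l \<rhd> c)" using r y l c by simp_all
    show ?thesis unfolding m
      by (rule vec_eqI2[OF 1[unfolded \<Phi>_def e] 2[unfolded \<Phi>_def e], where k = 1 and k' = "-1"])
        (simp only: lin_simps act_linear, algebra)
  qed
  \<comment> \<open>If \<Phi> vanished, the cases z = 1 and z = w of \<open>step\<close> would
    combine to cm l' w (cm l y x) = 0. As cm l y x is not 0, kap l' w would be 0, against cm l' w x'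
    not being 0.\<close>
  have "\<exists>z. isR z \<and> (\<exists>c\<in>C. \<Phi> z c \<noteq> 0)"
  proof (rule ccontr)
    assume "\<nexists>z. isR z \<and> (\<exists>c\<in>C. \<Phi> z c \<noteq> 0)"
    then have 0: "\<Phi> z c = 0" if "isR z" "c \<in> C" for z c using that by blast
    have iw: "isR (\<lambda>c. w \<rhd> c)" by (rule isR_act[OF w(1)])
    have s1: "l' \<rhd> cm l y x + cm (ad l) y x = 0"
      by (rule step[OF isR_id 0[OF isR_id] 0[OF isR_comp[OF isR_id isR_act[OF y(1)]]] y(2)])
    have s2: "l' \<rhd> w \<rhd> cm l y x + w \<rhd> cm (ad l) y x = 0"
      by (rule step[OF iw 0[OF iw] 0[OF isR_comp[OF iw isR_act[OF y(1)]]] y(2)])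
    have "cm (ad l) y x = - (l' \<rhd> cm l y x)" using s1 by (simp add: eq_neg_iff_add_eq_0 add.commute)
    then have "l' \<rhd> w \<rhd> cm l y x - w \<rhd> l' \<rhd> cm l y x = 0" using s2 by (simp add: act_linear)
    then have z: "cm l' w (cm l y x) = 0" by (simp only: cm_def[of l' w])
    have X: "cm l y x \<in> C" using l y by simp
    have "E (kap l' w \<rhd> cm l y x) = 0" using kap(2)[OF l' w(1) X] z by simp
    then have "kap l' w \<rhd> cm l y x = 0" using E_inj X kap(1)[OF l' w(1)] by simp
    then have "kap l' w = 0" using act_inj[OF kap(1)[OF l' w(1)] X] y by simp
    then show False using kap(2)[OF l' w(1,2)] w(3) by (simp add: act_linear E_linear)
  qed
  then obtain z c where z: "isR z" and c: "c \<in> C" "\<Phi> z c \<noteq> 0" by blast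
  obtain r where r: "r \<in> R" "\<And>c. c \<in> C \<Longrightarrow> \<Phi> z c = app r c" using R[OF z] by (auto simp: isR_def)
  have "app (0, 0) c = 0" by (simp add: app_def act_linear E_linear)
  then have "r \<noteq> (0, 0)" using c r by metis
  moreover have "\<forall>c\<in>C. app r (l \<rhd> c) = l' \<rhd> app r c" using int[OF z] r l by simp
  ultimately show ?thesis using r(1) by blast
qed

text \<open>If \<open>d = k\<^sup>2\<close> then \<open>R\<close> splits into two factors exchanged by \<open>star\<close>, and a nonzero component
  \<open>a\<close> of an intertwiner in one factor is completed by \<open>a\<inverse>\<close> in the other.\<close>
lemma intertwiner_split:
  assumes l: "l \<in> B" "l' \<in> B" and r: "r \<in> R" "\<And>c. c \<in> C \<Longrightarrow> app r (l \<rhd> c) = l' \<rhd> app r c"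
    and k: "d = k ^ 2" and nz: "fst r + sc k (snd r) \<noteq> 0"
  shows "\<exists>b\<in>R. nu b \<noteq> 0 \<and> (\<forall>c\<in>C. app b (l \<rhd> c) = l' \<rhd> app b c)"
proof -
  define a where "a = fst r + sc k (snd r)"
  have a: "a \<in> B" "a \<noteq> 0" using r nz by (auto simp: a_def)
  define ai where "ai = sc (1 / N a) (ad a)"
  have ai: "ai \<in> B" using a by (simp add: ai_def)
  have k0: "k \<noteq> 0" using k d_nonzero by auto
  have inv: "a \<rhd> ai \<rhd> c = c" "ai \<rhd> a \<rhd> c = c" if "c \<in> C" for c
    unfolding ai_def using a act_ad[OF a(1) that] by (simp_all add: act_linear)
  \<comment> \<open>Up to a factor 2k, E + k projects onto the eigenspace of E for k, where r acts
    as a.\<close>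
  have key: "E (app r c) + sc k (app r c) = E (a \<rhd> c) + sc k (a \<rhd> c)" if "c \<in> C" for c
    unfolding a_def app_def E_linear act_linear using r that
    by (auto simp: E_E k power2_eq_square scale_right_distrib)
  define D where "D c = a \<rhd> l \<rhd> c - l' \<rhd> a \<rhd> c" for c
  have DC: "D c \<in> C" if "c \<in> C" for c using a l that by (simp add: D_def)
  have 1: "E (D c) + sc k (D c) = 0" if c: "c \<in> C" for c
  proof -
    have "E (D c) + sc k (D c) = (E (a \<rhd> l \<rhd> c) + sc k (a \<rhd> l \<rhd> c)) - l' \<rhd> (E (a \<rhd> c) + sc k (a \<rhd> c))"
      using a l c by (simp add: D_def E_linear act_linear scale_right_diff_distrib E_act)
    also have "\<dots> = (E (app r (l \<rhd> c)) + sc k (app r (l \<rhd> c))) - l' \<rhd> (E (app r c) + sc k (app r c))"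
      using key[OF c] key[of "l \<rhd> c"] l c by simp
    also have "\<dots> = 0" using r(2)[OF c] r(1) l c by (simp add: act_linear E_act)
    finally show ?thesis .
  qed
  define D' where "D' c = l \<rhd> a \<rhd> c - a \<rhd> l' \<rhd> c" for c
  have D'C: "D' c \<in> C" if "c \<in> C" for c using a l that by (simp add: D'_def)
  \<comment> \<open>Taking adjoints replaces E by -E and so moves the relation to the other
    eigenspace.\<close>
  have 2: "D' (sc k c - E c) = 0" if c: "c \<in> C" for c
  proof (rule C_eqI)
    fix z assume z: "z \<in> C"
    have "t (D' (sc k c - E c)) z = t (sc k c - E c) (D z)"
      by (simp add: D'_def D_def bilin act_adjoint)
    also have "\<dots> = t c (E (D z) + sc k (D z))" using DC[OF z] c by (simp add: bilin E_adjoint)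
    finally show "t (D' (sc k c - E c)) z = t 0 z" using 1[OF z] by (simp add: bilin)
  qed (use D'C c in simp_all)
  have 3: "sc k (ai \<rhd> l \<rhd> c - l' \<rhd> ai \<rhd> c) - E (ai \<rhd> l \<rhd> c - l' \<rhd> ai \<rhd> c) = 0" if c: "c \<in> C" for c
  proof -
    have "0 = ai \<rhd> D' (sc k (ai \<rhd> c) - E (ai \<rhd> c))" using 2[of "ai \<rhd> c"] ai c by (simp add: act_linear)
    also have "\<dots> = sc k (ai \<rhd> D' (ai \<rhd> c)) - E (ai \<rhd> D' (ai \<rhd> c))"
      unfolding D'_def using a ai l c by (simp add: act_linear E_linear E_act scale_right_diff_distrib)
    also have "ai \<rhd> D' (ai \<rhd> c) = ai \<rhd> l \<rhd> c - l' \<rhd> ai \<rhd> c"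
      unfolding D'_def using ai a l c by (simp add: act_linear inv)
    finally show ?thesis by simp
  qed
  \<comment> \<open>This acts as 2 a where E = k and as 2 ai where E = -k; exchanging the two gives
    b', so that b b' = 4.\<close>
  define b where "b = (a + ai, sc (1 / k) (a - ai))"
  define b' where "b' = (a + ai, sc (1 / k) (ai - a))"
  have bR: "b \<in> R" "b' \<in> R" using a ai by (auto simp: b_def b'_def)
  have bb: "app b (app b' c) = app (inc (sc 4 e)) c" if c: "c \<in> C" for c
  proof -
    have "app b (app b' c) = (a + ai) \<rhd> (a + ai) \<rhd> c + sc (1 / k) (E ((a + ai) \<rhd> (ai - a) \<rhd> c + (a - ai) \<rhd> (a + ai) \<rhd> c))
      + sc (1 / k * (1 / k) * d) ((a - ai) \<rhd> (ai - a) \<rhd> c)"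
      using a ai c by (simp add: b_def b'_def app_def act_linear E_linear E_E E_act[symmetric] scale_right_distrib scale_right_diff_distrib algebra_simps)
    also have "1 / k * (1 / k) * d = 1" using k k0 by (simp add: power2_eq_square)
    also have "(a + ai) \<rhd> (ai - a) \<rhd> c + (a - ai) \<rhd> (a + ai) \<rhd> c = 0"
      using c by (simp add: act_linear inv)
    also have "(a + ai) \<rhd> (a + ai) \<rhd> c + sc (1 / k) (E 0) + sc 1 ((a - ai) \<rhd> (ai - a) \<rhd> c) = sc 4 c"
      by (rule vec_eqI) (simp only: lin_simps act_linear inv[OF c] E_linear, algebra)
    finally show ?thesis using c by (simp add: app_inc act_linear act_e)
  qed
  have "mul b b' = inc (sc 4 e)" by (rule app_unique) (use bR bb in \<open>simp_all add: app_mul\<close>)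
  then have "nu b * nu b' = N (sc 4 e) ^ 2" using nu_mul[OF bR] by (simp add: nu_def nn_inc)
  moreover have "N (sc 4 e) \<noteq> 0" using e_nonzero by simp
  ultimately have "nu b \<noteq> 0" by auto
  moreover have "app b (l \<rhd> c) = l' \<rhd> app b c" if c: "c \<in> C" for c
  proof -
    have "sc k (app b (l \<rhd> c) - l' \<rhd> app b c) =
       (E (D c) + sc k (D c)) + (sc k (ai \<rhd> l \<rhd> c - l' \<rhd> ai \<rhd> c) - E (ai \<rhd> l \<rhd> c - l' \<rhd> ai \<rhd> c))"
      unfolding b_def app_def D_def using a ai l c k0
      by (simp add: act_linear E_linear E_act scale_right_diff_distrib scale_right_distrib algebra_simps)
    then have "sc k (app b (l \<rhd> c) - l' \<rhd> app b c) = 0" using 1[OF c] 3[OF c] by simp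
    then show ?thesis using k0 by simp
  qed
  ultimately show ?thesis using bR by blast
qed

text \<open>If a nonzero r has nu r = 0, then d is the square of k = nr r / ni r, and the components
  of r in the two factors, fst r + k snd r and fst r - k snd r, do not both vanish.\<close>

lemma intertwiner:
  assumes l: "l \<in> B" and l': "l' \<in> B" and eq: "T l' = T l" "T (ad l') = T (ad l)" "N l' = N l"
    and y: "y \<in> B" "x \<in> C" "cm l y x \<noteq> 0" and w: "w \<in> B" "x' \<in> C" "cm l' w x' \<noteq> 0"
  shows "\<exists>b\<in>R. nu b \<noteq> 0 \<and> (\<forall>c\<in>C. app b (l \<rhd> c) = l' \<rhd> app b c)"
proof -
  obtain r where r: "r \<in> R" "r \<noteq> (0, 0)" "\<And>c. c \<in> C \<Longrightarrow> app r (l \<rhd> c) = l' \<rhd> app r c"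
    using intertwiner_nonzero[OF assms] by blast
  show ?thesis
  proof (cases "nu r = 0")
    case False then show ?thesis using r by blast
  next
    case True
    have ni: "ni r \<noteq> 0"
    proof
      assume "ni r = 0"
      then have "nr r = 0" using True by (simp add: nu_def)
      then show False using nn_zero[OF r(1)] \<open>ni r = 0\<close> r(2) by blast
    qed
    define k where "k = nr r / ni r"
    have k: "d = k ^ 2" using True ni by (simp add: nu_def k_def power_divide)
    have k': "d = (- k) ^ 2" using k by simp
    have k0: "k \<noteq> 0" using k d_nonzero by auto
    have "fst r + sc k (snd r) \<noteq> 0 \<or> fst r + sc (- k) (snd r) \<noteq> 0"
    proof (rule ccontr)
      assume "\<not> ?thesis"
      then have z: "fst r + sc k (snd r) = 0" "fst r + sc (- k) (snd r) = 0" by auto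
      have "sc 2 (fst r) = 0" by (rule vec_eqI2[OF z, where k = 1 and k' = 1]) (simp only: lin_simps, algebra)
      then have "fst r = 0" by simp
      then show False using z(1) k0 r(2) by (simp add: prod_eq_iff)
    qed
    then show ?thesis using intertwiner_split[OF l l' r(1,3) k] intertwiner_split[OF l l' r(1,3) k'] by blast
  qed
qed

end

section \<open>Extension to a norm similarity\<close>

context norm_subalgebra begin

section \<open>Orthogonal projection onto the subalgebra\<close>

definition piB where "piB x = (THE b. b \<in> B \<and> x - b \<in> C)"

lemma piB_unique: assumes "b \<in> B" "x - b \<in> C" shows "piB x = b"
proof -
  have "b' = b" if "b' \<in> B" "x - b' \<in> C" for b'
  proof -
    have "b' - b \<in> B" using that assms by simp
    moreover have "(x - b) - (x - b') \<in> C" using that assms by (metis C_closed(2))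
    then have "b' - b \<in> C" by simp
    ultimately show ?thesis using B_C_disjoint[of "b' - b"] by simp
  qed
  then show ?thesis unfolding piB_def using assms by (intro the_equality) blast+
qed

lemma piB: "piB x \<in> B" "x - piB x \<in> C"
proof -
  obtain b c where "b \<in> B" "c \<in> C" "x = b + c" using B_C_decomp(2) by blast
  then have "piB x = b" by (intro piB_unique) auto
  then show "piB x \<in> B" "x - piB x \<in> C" using \<open>b \<in> B\<close> \<open>c \<in> C\<close> \<open>x = b + c\<close> by auto
qed

lemma piB_linear: "piB (x + y) = piB x + piB y" "piB (sc k x) = sc k (piB x)"
proof -
  show "piB (x + y) = piB x + piB y"
  proof (rule piB_unique)
    have "(x - piB x) + (y - piB y) \<in> C" by (rule C_closed(1)[OF piB(2) piB(2)])
    then show "x + y - (piB x + piB y) \<in> C" by (simp add: algebra_simps)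
  qed (simp add: piB)
  show "piB (sc k x) = sc k (piB x)"
  proof (rule piB_unique)
    have "sc k (x - piB x) \<in> C" by (rule C_closed(4)[OF piB(2)])
    then show "sc k x - sc k (piB x) \<in> C" by (simp add: scale_right_diff_distrib)
  qed (simp add: piB)
qed

lemma piB_B: "b \<in> B \<Longrightarrow> piB b = b" by (rule piB_unique) simp_all

end

context envelope begin

lemma nu_star: "nu (star r) = nu r" by (simp add: nu_def nn_star)

lemma star_adR: "star (adR (star r)) = adR r"
  by (simp add: star_def adR_def ad_minus bilin)

lemma nn_ee: "nr (ee \<alpha> \<beta>) = \<alpha>^3 + 3 * d * \<alpha> * \<beta>^2" "ni (ee \<alpha> \<beta>) = 3 * \<alpha>^2 * \<beta> + d * \<beta>^3"
  by (simp_all add: nr_def ni_def ee_def N_scale ad_scale bilin)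

text \<open>The product of r and adR r is the central element nn r, whose reduced norm is its cube;
  cancelling nn r once leaves the square.\<close>

lemma nn_adR: assumes "r \<in> R" "nu r \<noteq> 0" shows "nr (adR r) = nr r ^ 2 + d * ni r ^ 2" "ni (adR r) = 2 * nr r * ni r"
proof -
  have m: "mul r (adR r) = nn r" by (rule app_unique) (use assms in \<open>simp_all add: app_mul app_adR\<close>)
  note e = nn_mul[OF assms(1) adR_R[OF assms(1)], unfolded m nn_ee]
  have "nu r * nr (adR r) = nr r * (nr r * nr (adR r) + d * ni r * ni (adR r)) - d * ni r * (nr r * ni (adR r) + ni r * nr (adR r))"
    unfolding nu_def by algebra
  also have "\<dots> = nu r * (nr r ^ 2 + d * ni r ^ 2)" unfolding e[symmetric] nu_def by algebra
  finally show "nr (adR r) = nr r ^ 2 + d * ni r ^ 2" by (rule mult_cancelI[OF assms(2)])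
  have "nu r * ni (adR r) = nr r * (nr r * ni (adR r) + ni r * nr (adR r)) - ni r * (nr r * nr (adR r) + d * ni r * ni (adR r))"
    unfolding nu_def by algebra
  also have "\<dots> = nu r * (2 * nr r * ni r)" unfolding e[symmetric] nu_def by algebra
  finally show "ni (adR r) = 2 * nr r * ni r" by (rule mult_cancelI[OF assms(2)])
qed

text \<open>The relation \<open>P + P\<^sup>* = 2 g u\<close> makes \<open>w = P P\<^sup>*\<inverse>\<close> unitary for the involution twisted by \<open>u\<close>.\<close>
lemma twisted_unitary:
  assumes P: "P \<in> R" "nu P \<noteq> 0" and u: "u \<in> B" "u \<noteq> 0" and fst: "fst P = sc g u"
  defines "w \<equiv> mul P (invR (star P))"
  shows "w \<in> R" "mul w (star P) = P" "mul w (mul (inc u) (star w)) = inc u"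
proof -
  have P': "star P \<in> R" "nu (star P) \<noteq> 0" using P by (simp_all add: nu_star)
  show w: "w \<in> R" using P P' by (simp add: w_def)
  show "mul w (star P) = P"
    by (rule app_unique) (use P P' w in \<open>simp_all add: app_mul w_def app_invR\<close>)
  define w' where "w' = mul (invR P) (star P)"
  have w': "w' \<in> R" using P by (simp add: w'_def)
  have sw: "star w = w'"
  proof (rule star_eqI[OF w w'])
    fix x y assume xy: "x \<in> C" "y \<in> C"
    define z where "z = app w' y"
    have zC: "z \<in> C" using w' xy by (simp add: z_def)
    have Pz: "app P z = app (star P) y" unfolding z_def w'_def using P P' xy by (simp add: app_mul app_invR)
    let ?x = "app (invR (star P)) x"
    have xC: "?x \<in> C" using P' xy by simp
    have "t (app w x) y = t (app P ?x) y" using P P' xy by (simp add: w_def app_mul)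
    also have "\<dots> = t ?x (app P z)" unfolding Pz by (rule app_star[OF P(1) xC xy(2)])
    also have "\<dots> = t (app (star P) ?x) z" using app_star[OF P'(1) xC zC] by simp
    also have "\<dots> = t x z" using P' xy by (simp add: app_invR)
    finally show "t (app w x) y = t x (app w' y)" by (simp add: z_def)
  qed
  show "mul w (mul (inc u) (star w)) = inc u"
  proof (rule app_unique)
    fix c assume c: "c \<in> C"
    define d1 where "d1 = app w' c"
    define x where "x = app (invR P) (u \<rhd> c)"
    have dC: "d1 \<in> C" and xC: "x \<in> C" using w' P u c by (simp_all add: d1_def x_def)
    have Pd: "app P d1 = app (star P) c" unfolding d1_def w'_def using P P' c by (simp add: app_mul app_invR)
    have Px: "app P x = u \<rhd> c" unfolding x_def using P u c by (simp add: app_invR)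
    have S: "app (star P) y = sc (2 * g) (u \<rhd> y) - app P y" for y
      unfolding app_def star_def fst fst_conv snd_conv
      by (rule vec_eqI) (simp only: lin_simps act_linear E_linear, algebra)
    \<comment> \<open>With ad u standing for N(u) times the inverse of u, this says that P u^-1
      (star P) and (star P) u^-1 P agree; both are 2 g P - P u^-1 P.\<close>
    have "app P (ad u \<rhd> app (star P) x) = app (star P) (ad u \<rhd> app P x)"
      unfolding S using act_ad[OF u(1)] xC P u by (simp add: act_linear app_linear)
    also have "\<dots> = sc (N u) (app P d1)" unfolding Px Pd using act_ad(2)[OF u(1) c] by (simp add: app_linear)
    finally have "app P (ad u \<rhd> app (star P) x) = app P (sc (N u) d1)" by (simp add: app_linear)
    then have "app (invR P) (app P (ad u \<rhd> app (star P) x)) = app (invR P) (app P (sc (N u) d1))" by simp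
    then have "ad u \<rhd> app (star P) x = sc (N u) d1" using P P' u xC dC by (simp add: app_invR)
    then have "u \<rhd> ad u \<rhd> app (star P) x = sc (N u) (u \<rhd> d1)" by (simp add: act_linear)
    then have ud: "app (star P) x = u \<rhd> d1" using act_ad(1)[OF u(1), of "app (star P) x"] P' xC u by simp
    have "app (mul w (mul (inc u) (star w))) c = app P (app (invR (star P)) (u \<rhd> d1))"
      unfolding sw using P P' w w' u c dC by (simp add: app_mul app_inc w_def flip: d1_def)
    also have "\<dots> = u \<rhd> c" using P' xC Px by (simp add: app_invR flip: ud)
    finally show "app (mul w (mul (inc u) (star w))) c = app (inc u) c" by (simp add: app_inc)
  qed (use w u in simp_all)
qed

lemma fst_mul_inc_linear: assumes "b \<in> R" "h \<in> B" "h' \<in> B"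
  shows "fst (mul b (inc (h + h'))) = fst (mul b (inc h)) + fst (mul b (inc h'))"
    "fst (mul b (inc (sc k h))) = sc k (fst (mul b (inc h)))"
proof -
  let ?r = "mul b (inc h)" and ?s = "mul b (inc h')"
  have R: "?r \<in> R" "?s \<in> R" using assms by simp_all
  have "mul b (inc (h + h')) = (fst ?r + fst ?s, snd ?r + snd ?s)"
  proof (rule app_unique)
    fix c assume c: "c \<in> C"
    have "app (fst ?r + fst ?s, snd ?r + snd ?s) c = app ?r c + app ?s c" by (simp add: app_def act_linear E_linear)
    then show "app (mul b (inc (h + h'))) c = app (fst ?r + fst ?s, snd ?r + snd ?s) c"
      using assms c by (simp add: app_mul app_inc app_linear act_linear)
  qed (use assms in \<open>simp\<close>, use R in \<open>simp add: mem_Times_iff\<close>)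
  then show "fst (mul b (inc (h + h'))) = fst ?r + fst ?s" by simp
  have "mul b (inc (sc k h)) = (sc k (fst ?r), sc k (snd ?r))"
  proof (rule app_unique)
    fix c assume c: "c \<in> C"
    have "app (sc k (fst ?r), sc k (snd ?r)) c = sc k (app ?r c)" by (simp add: app_def act_linear E_linear scale_right_distrib)
    then show "app (mul b (inc (sc k h))) c = app (sc k (fst ?r), sc k (snd ?r)) c"
      using assms c by (simp add: app_mul app_inc app_linear act_linear)
  qed (use assms in \<open>simp\<close>, use R in \<open>simp add: mem_Times_iff\<close>)
  then show "fst (mul b (inc (sc k h))) = sc k (fst ?r)" by simp
qed

text \<open>The linear map h \<mapsto> fst (mul b (inc h)) of \<open>B\<close> to itself, half of b
  h + h (star b), either has a kernel, where g = 0 will do, or is onto and reaches u.\<close>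

lemma solve_h: assumes b: "b \<in> R" and u: "u \<in> B" "u \<noteq> 0"
  shows "\<exists>h\<in>B. h \<noteq> 0 \<and> (\<exists>g. fst (mul b (inc h)) = sc g u)"
proof (cases "\<exists>h\<in>B. h \<noteq> 0 \<and> fst (mul b (inc h)) = 0")
  case True then show ?thesis by (metis scale_zero_left)
next
  case False
  let ?g = "\<lambda>x. fst (mul b (inc (piB x)))"
  have lin: "Vector_Spaces.linear sc sc ?g"
    unfolding linear_iff' using fst_mul_inc_linear[OF b piB(1) piB(1)] by (simp add: piB_linear)
  have gB: "?g ` B \<subseteq> B"
  proof
    fix z assume "z \<in> ?g ` B"
    then obtain x where "z = ?g x" by blast
    moreover have "mul b (inc (piB x)) \<in> R" using b piB(1) by simp
    ultimately show "z \<in> B" by (simp add: mem_Times_iff)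
  qed
  have "dim (?g ` B) = dim B"
    by (rule dim_linear_image[OF B_subspace lin]) (use False piB_B in auto)
  then have "?g ` B = B" by (intro subspace_dim_equal subspace_linear_image[OF B_subspace lin] B_subspace gB) simp
  then have "u \<in> ?g ` B" using u by blast
  then obtain h where "h \<in> B" "u = ?g h" by blast
  then have h: "h \<in> B" "u = fst (mul b (inc h))" using piB_B by simp_all
  have "h \<noteq> 0"
  proof
    assume "h = 0"
    have "fst (mul b (inc (sc 0 0))) = sc 0 (fst (mul b (inc 0)))" by (rule fst_mul_inc_linear(2)[OF b, of 0 0]) simp_all
    then show False using h u \<open>h = 0\<close> by simp
  qed
  then show ?thesis using h by (metis scale_one)
qed

text \<open>By \<open>N_sum\<close> the norm has to be followed only on \<open>B\<close>, on
  \<open>C\<close> and in the pairing t (a \<rhd> c) c. The map on \<open>C\<close> is well defined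
  because every vector is app r c0 for exactly one r in \<open>R\<close>.\<close>

lemma similarity:
  assumes b: "b \<in> R" "nu b \<noteq> 0" and dimC: "dim C = dim B + dim B"
  shows "\<exists>s. Vector_Spaces.linear sc sc s \<and> (\<forall>x. N (s x) = nu b * N x) \<and>
     (\<forall>a\<in>B. s a \<in> B \<and> (\<forall>c\<in>C. s a \<rhd> c = app b (a \<rhd> app (star b) c)))"
proof -
  obtain c0 where f: "faithful c0" using faithful_exists by blast
  have c0: "c0 \<in> C" and inj: "\<And>r. r \<in> R \<Longrightarrow> app r c0 = 0 \<Longrightarrow> r = (0, 0)" using f by (auto simp: faithful_def)
  \<comment> \<open>Only the component in \<open>B\<close> matters for a \<mapsto> t (a \<rhd> c0)
    c0; the sign is that of the action.\<close>
  define u where "u = - piB (cr c0 c0)"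
  have u: "u \<in> B" using piB by (simp add: u_def)
  have tu: "t (a \<rhd> c0) c0 = t a u" if "a \<in> B" for a
  proof -
    have "t (a \<rhd> c0) c0 = - t a (cr c0 c0)" by (simp add: act_def bilin t_cr)
    also have "cr c0 c0 = (cr c0 c0 - piB (cr c0 c0)) + piB (cr c0 c0)" by simp
    also have "t a \<dots> = t a (piB (cr c0 c0))" using piB(2) that by (simp only: t_add_right C_D) simp
    finally show ?thesis by (simp add: u_def bilin)
  qed
  have L1: "t (app q c0) c0 = tr (mul q (inc u))" if q: "q \<in> R" for q
  proof -
    have B: "fst q \<in> B" "snd q \<in> B" using q by auto
    have "t (E (snd q \<rhd> c0)) c0 = - t (E (snd q \<rhd> c0)) c0"
      using E_adjoint[of "snd q \<rhd> c0" c0] B c0 by (metis E_act act_adjoint act_closed t_commute)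
    then have "2 * t (E (snd q \<rhd> c0)) c0 = 0" by simp
    then have "t (E (snd q \<rhd> c0)) c0 = 0" using two by (metis mult_eq_0_iff)
    then show ?thesis using q u B by (simp add: tr_mul app_def bilin tu inc_def)
  qed
  \<comment> \<open>Otherwise t would vanish on R c0, which is all of \<open>C\<close>, against
    nondegeneracy.\<close>
  have u0: "u \<noteq> 0"
  proof
    assume z: "u = 0"
    have "x0 = 0"
    proof (rule C_eqI[OF x0])
      fix y assume y: "y \<in> C"
      obtain r where r: "r \<in> R" "x0 = app r c0" using faithful_cyclic[OF f dimC x0] by blast
      obtain s where s: "s \<in> R" "y = app s c0" using faithful_cyclic[OF f dimC y] by blast
      have "t x0 y = t (app (mul (star s) r) c0) c0"
        using r s c0 app_star[of "star s" "app r c0" c0] by (simp add: app_mul)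
      also have "\<dots> = 0" unfolding L1[OF mul_R[OF star_R[OF s(1)] r(1)]] using r s by (subst tr_mul) (simp_all add: z inc_def bilin)
      finally show "t x0 y = t 0 y" by (simp add: bilin)
    qed simp
    then show False using x0_nonzero by simp
  qed
  obtain h g where h: "h \<in> B" "h \<noteq> 0" "fst (mul b (inc h)) = sc g u" using solve_h[OF b(1) u u0] by blast
  define P where "P = mul b (inc h)"
  have P: "P \<in> R" using b h by (simp add: P_def)
  have nP: "nr P = nr b * N h" "ni P = ni b * N h" using b h by (simp_all add: P_def nn_mul nn_inc)
  have nuP: "nu P \<noteq> 0" unfolding P_def using b h nu_mul[of b "inc h"] by (simp add: nu_def[of "inc h"] nn_inc)
  define w where "w = mul P (invR (star P))"
  note tw = twisted_unitary[OF P nuP u u0 h(3)[folded P_def], folded w_def]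
  have w: "w \<in> R" by (rule tw(1))
  define c1 where "c1 = app w c0"
  have c1: "c1 \<in> C" using w c0 by (simp add: c1_def)
  \<comment> \<open>Cyclicity of the trace moves star w behind u, where the unitarity relation of w
    removes both factors.\<close>
  have W1: "t (app q c1) c1 = t (app q c0) c0" if q: "q \<in> R" for q
  proof -
    have "t (app q c1) c1 = t (app (mul (star w) (mul q w)) c0) c0"
      using q w c0 app_star[of "star w" "app q c1" c0] c1 by (simp add: app_mul c1_def)
    also have "\<dots> = tr (mul (mul (star w) (mul q w)) (inc u))" using q w by (intro L1) simp
    also have "\<dots> = tr (mul (star w) (mul (mul q w) (inc u)))" using q w u by (simp add: mul_assoc)
    also have "\<dots> = tr (mul (mul (mul q w) (inc u)) (star w))" using q w u by (intro tr_commute) simp_all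
    also have "\<dots> = tr (mul q (mul w (mul (inc u) (star w))))" using q w u by (simp add: mul_assoc)
    also have "\<dots> = t (app q c0) c0" unfolding tw(3) using L1[OF q] by simp
    finally show ?thesis .
  qed
  \<comment> \<open>The two components of n(w) n(star b) = n(b), from mul w (star P) = P after
    cancelling N(h).\<close>
  have nw: "nr w * nr b - d * ni w * ni b = nr b" "ni w * nr b - nr w * ni b = ni b"
  proof -
    note e = nn_mul[OF w star_R[OF P], unfolded tw(2) nn_star nP]
    have "N h * (nr w * nr b - d * ni w * ni b) = N h * nr b" using e(1) by (simp add: algebra_simps)
    then show "nr w * nr b - d * ni w * ni b = nr b" using h by simp
    have "N h * (ni w * nr b - nr w * ni b) = N h * ni b" using e(2) by (simp add: algebra_simps)
    then show "ni w * nr b - nr w * ni b = ni b" using h by simp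
  qed
  define rr where "rr c = (THE r. r \<in> R \<and> app r c0 = c)" for c
  have rr_unique: "rr c = r" if "r \<in> R" "app r c0 = c" for r c
  proof -
    have "r' = r" if r': "r' \<in> R" "app r' c0 = c" for r'
    proof -
      have "app (fst r' - fst r, snd r' - snd r) c0 = 0"
        using r' \<open>app r c0 = c\<close> unfolding app_def by (simp add: act_linear E_linear algebra_simps)
      moreover have "(fst r' - fst r, snd r' - snd r) \<in> R" using r' \<open>r \<in> R\<close> by (auto simp: mem_Times_iff)
      ultimately show ?thesis using inj by (fastforce simp: prod_eq_iff)
    qed
    then show ?thesis unfolding rr_def using that by (intro the_equality) blast+
  qed
  have rr: "rr c \<in> R" "app (rr c) c0 = c" if c: "c \<in> C" for c
  proof -
    obtain r where "r \<in> R" "c = app r c0" using faithful_cyclic[OF f dimC c] by blast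
    then show "rr c \<in> R" "app (rr c) c0 = c" using rr_unique[of r c] by auto
  qed
  have rr_add: "app (rr (c + c')) c1 = app (rr c) c1 + app (rr c') c1" if "c \<in> C" "c' \<in> C" for c c'
  proof -
    have "rr (c + c') = (fst (rr c) + fst (rr c'), snd (rr c) + snd (rr c'))"
    proof (rule rr_unique)
      show "(fst (rr c) + fst (rr c'), snd (rr c) + snd (rr c')) \<in> R" using rr(1)[OF that(1)] rr(1)[OF that(2)] by (simp add: mem_Times_iff)
      have "app (fst (rr c) + fst (rr c'), snd (rr c) + snd (rr c')) c0 = app (rr c) c0 + app (rr c') c0"
        by (simp add: app_def act_linear E_linear)
      then show "app (fst (rr c) + fst (rr c'), snd (rr c) + snd (rr c')) c0 = c + c'" using rr(2) that by simp
    qed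
    then show ?thesis by (simp add: app_def act_linear E_linear)
  qed
  have rr_scale: "app (rr (sc k c)) c1 = sc k (app (rr c) c1)" if "c \<in> C" for k c
  proof -
    have "rr (sc k c) = (sc k (fst (rr c)), sc k (snd (rr c)))"
    proof (rule rr_unique)
      show "(sc k (fst (rr c)), sc k (snd (rr c))) \<in> R" using rr(1)[OF that] by (simp add: mem_Times_iff)
      have "app (sc k (fst (rr c)), sc k (snd (rr c))) c0 = sc k (app (rr c) c0)"
        by (simp add: app_def act_linear E_linear scale_right_distrib)
      then show "app (sc k (fst (rr c)), sc k (snd (rr c))) c0 = sc k c" using rr(2) that by simp
    qed
    then show ?thesis by (simp add: app_def act_linear E_linear scale_right_distrib)
  qed
  have sB_ex: "\<exists>a'\<in>B. mul b (mul (inc a) (star b)) = inc a'" if "a \<in> B" for a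
  proof -
    have "star (mul b (mul (inc a) (star b))) = mul b (mul (inc a) (star b))"
      using b that by (simp add: star_mul mul_assoc)
    then show ?thesis using self_adjoint[of "mul b (mul (inc a) (star b))"] b that by (metis inc_R mul_R star_R)
  qed
  define sB where "sB a = fst (mul b (mul (inc a) (star b)))" for a
  have sB: "sB a \<in> B" "mul b (mul (inc a) (star b)) = inc (sB a)" if "a \<in> B" for a
    using sB_ex[OF that] by (auto simp: sB_def inc_def)
  have sB_act: "sB a \<rhd> c = app b (a \<rhd> app (star b) c)" if "a \<in> B" "c \<in> C" for a c
  proof -
    have "sB a \<rhd> c = app (mul b (mul (inc a) (star b))) c" unfolding sB(2)[OF that(1)] by (simp add: app_inc)
    then show ?thesis using b that by (simp add: app_mul app_inc)
  qed
  have sB_eq: "a' = sB a" if "a \<in> B" "a' \<in> B" "\<And>c. c \<in> C \<Longrightarrow> a' \<rhd> c = app b (a \<rhd> app (star b) c)" for a a'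
  proof -
    have "inc a' = inc (sB a)" by (rule app_unique) (use that sB sB_act in \<open>simp_all add: app_inc\<close>)
    then show ?thesis by (simp add: inc_def)
  qed
  have sB_add: "sB (a + a') = sB a + sB a'" if "a \<in> B" "a' \<in> B" for a a'
    by (rule sB_eq[symmetric]) (use that sB b in \<open>simp_all add: act_linear sB_act app_linear\<close>)
  have sB_scale: "sB (sc k a) = sc k (sB a)" if "a \<in> B" for k a
    by (rule sB_eq[symmetric]) (use that sB b in \<open>simp_all add: act_linear sB_act app_linear\<close>)
  have N_sB: "N (sB a) = nu b * N a" if "a \<in> B" for a
  proof -
    have "N (sB a) = nr (mul b (mul (inc a) (star b)))" unfolding sB(2)[OF that] by (simp add: nn_inc)
    also have "\<dots> = nu b * N a" using b that by (simp add: nn_mul nn_inc nn_star nu_def power2_eq_square algebra_simps)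
    finally show ?thesis .
  qed
  define bs where "bs = adR (star b)"
  have bs: "bs \<in> R" using b by (simp add: bs_def)
  define tC where "tC c = app bs (app (rr c) c1)" for c
  have tC_C: "tC c \<in> C" if "c \<in> C" for c using bs rr[OF that] c1 by (simp add: tC_def)
  have N_tC: "N (tC c) = nu b * N c" if c: "c \<in> C" for c
  proof -
    let ?r = "rr c"
    have r: "?r \<in> R" by (rule rr(1)[OF c])
    define Z where "Z = mul bs (mul ?r w)"
    have Z: "Z \<in> R" using bs r w by (simp add: Z_def)
    have nbs: "nr bs = nr b ^ 2 + d * ni b ^ 2" "ni bs = - (2 * nr b * ni b)"
      unfolding bs_def using nn_adR[of "star b"] b by (simp_all add: nn_star nu_star)
    \<comment> \<open>Together with \<open>k2\<close>, the components of n(star b)^2 n(w) = nu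
      b.\<close>
    have k1: "(nr b ^ 2 + d * ni b ^ 2) * nr w - 2 * d * nr b * ni b * ni w = nu b"
    proof -
      have "(nr b ^ 2 + d * ni b ^ 2) * nr w - 2 * d * nr b * ni b * ni w =
        nr b * (nr w * nr b - d * ni w * ni b) - d * ni b * (ni w * nr b - nr w * ni b)" by algebra
      then show ?thesis unfolding nw nu_def by algebra
    qed
    have k2: "(nr b ^ 2 + d * ni b ^ 2) * ni w - 2 * nr b * ni b * nr w = 0"
    proof -
      have "(nr b ^ 2 + d * ni b ^ 2) * ni w - 2 * nr b * ni b * nr w =
        nr b * (ni w * nr b - nr w * ni b) - ni b * (nr w * nr b - d * ni w * ni b)" by algebra
      then show ?thesis unfolding nw by algebra
    qed
    have nZ: "nr Z = nu b * nr ?r" "ni Z = nu b * ni ?r"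
    proof -
      have "nr Z = nr ?r * ((nr b ^ 2 + d * ni b ^ 2) * nr w - 2 * d * nr b * ni b * ni w) + d * ni ?r * ((nr b ^ 2 + d * ni b ^ 2) * ni w - 2 * nr b * ni b * nr w)"
        unfolding Z_def nn_mul[OF bs mul_R[OF r w]] nn_mul[OF r w] nbs by algebra
      then show "nr Z = nu b * nr ?r" unfolding k1 k2 by simp
      have "ni Z = ni ?r * ((nr b ^ 2 + d * ni b ^ 2) * nr w - 2 * d * nr b * ni b * ni w) + nr ?r * ((nr b ^ 2 + d * ni b ^ 2) * ni w - 2 * nr b * ni b * nr w)"
        unfolding Z_def nn_mul[OF bs mul_R[OF r w]] nn_mul[OF r w] nbs by algebra
      then show "ni Z = nu b * ni ?r" unfolding k1 k2 by simp
    qed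
    have tZ: "tC c = app Z c0" unfolding tC_def Z_def c1_def using bs r w c0 by (simp add: app_mul)
    have "6 * N (tC c) = n3 (app Z c0) (app Z c0) (app Z c0)" unfolding tZ by (simp add: N_n3)
    also have "\<dots> = n3 c0 c0 (app (nn Z) c0)" by (rule n3_app_cube[OF Z c0 c0 c0])
    also have "\<dots> = nu b * n3 c0 c0 (app (nn ?r) c0)" unfolding nZ app_ee[OF c0] n3_linear by algebra
    also have "\<dots> = nu b * n3 (app ?r c0) (app ?r c0) (app ?r c0)" using n3_app_cube[OF r c0 c0 c0] by simp
    also have "\<dots> = 6 * (nu b * N c)" unfolding rr(2)[OF c] N_n3 by simp
    finally show ?thesis by (rule mult_cancelI[OF six])
  qed
  \<comment> \<open>The factor star b meets adj(star b), and b meets its adjoint adj b; what remains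
    is n(b) n(star b) = nu b, and \<open>W1\<close> absorbs w.\<close>
  have pair: "t (sB a \<rhd> tC c) (tC c) = nu b * t (a \<rhd> c) c" if a: "a \<in> B" and c: "c \<in> C" for a c
  proof -
    let ?r = "rr c"
    have r: "?r \<in> R" by (rule rr(1)[OF c])
    define y where "y = app ?r c1"
    have y: "y \<in> C" using r c1 by (simp add: y_def)
    have 1: "app (star b) (tC c) = app (ee (nr b) (- ni b)) y"
      unfolding tC_def bs_def y_def[symmetric] using app_adR(1)[OF star_R[OF b(1)] y] by (simp add: nn_star)
    let ?z = "a \<rhd> app (ee (nr b) (- ni b)) y"
    have zC: "?z \<in> C" using a y by simp
    have "t (sB a \<rhd> tC c) (tC c) = t (app b ?z) (app bs y)"
      unfolding sB_act[OF a tC_C[OF c]] 1 by (simp add: tC_def y_def)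
    also have "\<dots> = t (app bs y) (app b ?z)" by (rule t_commute)
    also have "\<dots> = t y (app (star bs) (app b ?z))" using bs y b zC by (intro app_star) simp_all
    also have "star bs = adR b" unfolding bs_def by (rule star_adR)
    also have "app (adR b) (app b ?z) = app (nn b) ?z" by (rule app_adR(2)[OF b(1) zC])
    also have "\<dots> = a \<rhd> app (nn b) (app (ee (nr b) (- ni b)) y)"
      using ee_central[of "inc a" "app (ee (nr b) (- ni b)) y" "nr b" "ni b"] a y by (simp add: app_inc)
    also have "app (nn b) (app (ee (nr b) (- ni b)) y) = sc (nu b) y"
      by (simp only: app_ee_ee[OF y]) (simp add: app_ee[OF y] nu_def power2_eq_square algebra_simps)
    also have "t y (a \<rhd> sc (nu b) y) = nu b * t (a \<rhd> y) y" by (simp add: act_linear bilin act_adjoint)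
    also have "t (a \<rhd> y) y = t (app (mul (star ?r) (mul (inc a) ?r)) c1) c1"
      unfolding y_def using app_star[of "star ?r" "a \<rhd> app ?r c1" c1] r a c1 by (simp add: app_mul app_inc)
    also have "\<dots> = t (app (mul (star ?r) (mul (inc a) ?r)) c0) c0" using r a by (intro W1) simp
    also have "\<dots> = t (a \<rhd> c) c"
      using app_star[of "star ?r" "a \<rhd> app ?r c0" c0] r a c c0 rr(2)[OF c] by (simp add: app_mul app_inc)
    finally show ?thesis .
  qed
  define s where "s x = sB (piB x) + tC (x - piB x)" for x
  have lin: "Vector_Spaces.linear sc sc s"
    unfolding linear_iff'
  proof (intro conjI allI)
    fix x y k
    have e: "x + y - piB (x + y) = (x - piB x) + (y - piB y)" by (simp add: piB_linear)
    have "tC (x + y - piB (x + y)) = tC (x - piB x) + tC (y - piB y)"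
      unfolding e tC_def rr_add[OF piB(2) piB(2)] app_linear ..
    then show "s (x + y) = s x + s y" by (simp add: s_def piB_linear sB_add piB)
    have e: "sc k x - piB (sc k x) = sc k (x - piB x)" by (simp add: piB_linear scale_right_diff_distrib)
    have "tC (sc k x - piB (sc k x)) = sc k (tC (x - piB x))"
      unfolding e tC_def rr_scale[OF piB(2)] app_linear ..
    then show "s (sc k x) = sc k (s x)" by (simp add: s_def piB_linear sB_scale piB scale_right_distrib)
  qed
  have norm: "N (s x) = nu b * N x" for x
  proof -
    let ?a = "piB x" and ?c = "x - piB x"
    have "N (s x) = N (sB ?a) + N (tC ?c) - t (sB ?a \<rhd> tC ?c) (tC ?c) / 2"
      unfolding s_def by (rule N_sum) (use sB tC_C piB in blast)+
    also have "\<dots> = nu b * (N ?a + N ?c - t (?a \<rhd> ?c) ?c / 2)"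
      unfolding N_sB[OF piB(1)] N_tC[OF piB(2)] pair[OF piB] by (simp add: algebra_simps)
    also have "\<dots> = nu b * N (?a + ?c)" unfolding N_sum[OF piB(1) piB(2)] ..
    finally show ?thesis by simp
  qed
  have "s a \<in> B \<and> (\<forall>c\<in>C. s a \<rhd> c = app b (a \<rhd> app (star b) c))" if a: "a \<in> B" for a
  proof -
    have "tC 0 = 0" using rr_scale[of 0 0] by (simp add: tC_def app_linear)
    then have "s a = sB a" by (simp add: s_def piB_B[OF a])
    then show ?thesis using sB(1)[OF a] sB_act[OF a] by simp
  qed
  then show ?thesis using lin norm by blast
qed

end

context cubic_norm begin

lemma perp_mono: "S \<subseteq> S' \<Longrightarrow> perp S' \<subseteq> perp S" by (auto simp: perp_def)

lemma cubic_fields_similar: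
  assumes dimA: "dim (UNIV :: 'a set) = 27"
    and "cubic_field sc Bas cr t e L l" "dim L = 3"
    and "cubic_field sc Bas cr t e L' l'" "dim L' = 3"
    and eq: "T l' = T l" "T (ad l') = T (ad l)" "N l' = N l"
  shows "\<exists>B. norm_subalgebra sc Bas cr t e B \<and> dim B = 9 \<and> L \<subseteq> B \<and> L' \<subseteq> B \<and>
    (\<exists>s. Vector_Spaces.linear sc sc s \<and> bij s \<and> (\<exists>\<nu>. \<forall>x. N (s x) = \<nu> * N x) \<and> s ` B = B \<and> s ` L = L')"
proof -
  interpret L: cubic_field sc Bas cr t e L l by (rule assms(2))
  interpret L': cubic_field sc Bas cr t e L' l' by (rule assms(4))
  have dim0: "S = {0}" if "dim S = 0" "subspace S" for S using that subspace_0[of S] by auto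
  \<comment> \<open>The part of l' orthogonal to \<open>L\<close>, so that the subalgebra generated
    with it contains l'. If l' is already in \<open>L\<close>, any nonzero orthogonal vector
    serves.\<close>
  obtain v where v: "v \<in> perp L" "v \<noteq> 0" and vl: "\<exists>q k. q \<in> L \<and> l' = q + sc k v"
  proof (cases "l' \<in> L")
    case True
    have "dim (perp L) \<noteq> 0" using L.B_C_decomp(1) dimA \<open>dim L = 3\<close> by simp
    then obtain v where "v \<in> perp L" "v \<noteq> 0" by auto
    then show ?thesis using True by (intro that) (auto intro: exI[of _ l'] exI[of _ 0])
  next
    case False
    obtain q c where qc: "q \<in> L" "c \<in> perp L" "l' = q + c" using L.B_C_decomp(2) by blast
    then have "c \<noteq> 0" using False by auto
    show ?thesis by (rule that[OF qc(2) \<open>c \<noteq> 0\<close>]) (use qc in \<open>auto intro!: exI[of _ q] exI[of _ 1]\<close>)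
  qed
  obtain B where "norm_subalgebra sc Bas cr t e B" and dimB: "dim B = 9" and LB: "L \<subseteq> B" and vB: "v \<in> B"
    using L.nine_dimensional[OF v \<open>dim L = 3\<close>] by blast
  interpret B: norm_subalgebra sc Bas cr t e B by fact
  have l: "l \<in> B" using LB L.l_L by blast
  have l': "l' \<in> B" using vl LB vB by auto
  have L'B: "L' \<subseteq> B"
  proof
    fix x assume "x \<in> L'"
    then obtain a b c where "x = sc a e + sc b l' + sc c (ad l')" using L'.l_gen by blast
    then show "x \<in> B" using l' by simp
  qed
  have dimC: "dim (perp B) = dim B + dim B" using B.B_C_decomp(1) dimA dimB by simp
  then obtain c0 where c0: "c0 \<in> perp B" "c0 \<noteq> 0" using dimB by (metis dim0 B.C_subspace add_is_0 subspace_0 dim_eq_0 subsetI singletonI singleton_iff zero_neq_numeral)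
  obtain x where x: "x \<in> perp B" "B.cm l v x \<noteq> 0"
    using L.centralizer_trivial[OF B.norm_subalgebra_axioms LB vB v(1) c0] v(2) unfolding B.cm_def by force
  \<comment> \<open>By \<open>centralizer_trivial\<close> such a vector does not commute with l' on
    perp B, which the intertwiner requires on the side of \<open>L'\<close>.\<close>
  obtain w where w: "w \<in> B" "w \<in> perp L'" "w \<noteq> 0"
  proof -
    have "\<not> B \<subseteq> L'" using dim_subset[of B L'] dimB \<open>dim L' = 3\<close> by auto
    then obtain z where z: "z \<in> B" "z \<notin> L'" by blast
    obtain q c where qc: "q \<in> L'" "c \<in> perp L'" "z = q + c" using L'.B_C_decomp(2) by blast
    have "c = z - q" using qc by simp
    then have "c \<in> B" using z qc L'B by (metis B.B_closed(2) subsetD)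
    moreover have "c \<noteq> 0" using qc z by auto
    ultimately show ?thesis using that qc by blast
  qed
  obtain x' where x': "x' \<in> perp B" "B.cm l' w x' \<noteq> 0"
    using L'.centralizer_trivial[OF B.norm_subalgebra_axioms L'B w(1,2) c0] w(3) unfolding B.cm_def by force
  interpret E: envelope sc Bas cr t e B l v x
    by unfold_locales (use l vB x in auto)
  obtain b where b: "b \<in> B \<times> B" "E.nu b \<noteq> 0" "\<And>c. c \<in> perp B \<Longrightarrow> E.app b (l \<rhd> c) = l' \<rhd> E.app b c"
    using E.intertwiner[OF l l' eq vB x w(1) x'] by blast
  obtain s where s: "Vector_Spaces.linear sc sc s" "\<And>x. N (s x) = E.nu b * N x"
      "\<And>a. a \<in> B \<Longrightarrow> s a \<in> B" "\<And>a c. a \<in> B \<Longrightarrow> c \<in> perp B \<Longrightarrow> s a \<rhd> c = E.app b (a \<rhd> E.app (E.star b) c)"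
    using E.similarity[OF b(1,2) dimC] by blast
  interpret s: Vector_Spaces.linear sc sc s by (rule s(1))
  have sz: "x = 0" if "s x = 0" for x using s(2)[of x] that b(2) by simp
  have inj: "inj s" unfolding s.inj_iff_eq_0 using sz by blast
  have bij: "bij s" using inj linear_inj_imp_surj[OF s(1) inj] by (simp add: bij_def)
  have sB: "s ` B = B"
    by (intro subspace_dim_equal subspace_linear_image[OF B.B_subspace s(1)] B.B_subspace)
      (use s(3) dim_linear_image[OF B.B_subspace s(1)] sz in auto)
  have CL': "perp B \<subseteq> perp L'" by (rule perp_mono[OF L'B])
  define y where "y = s e"
  have yB: "y \<in> B" using s(3) by (simp add: y_def)
  have y: "y \<rhd> c = E.app b (E.app (E.star b) c)" if "c \<in> perp B" for c
    unfolding y_def using s(4)[OF B.e_B that] b(1) that by (simp add: B.act_e)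
  have sl: "s l \<rhd> c = l' \<rhd> y \<rhd> c" if "c \<in> perp B" for c
    unfolding s(4)[OF l that] using b that by (simp add: y)
  \<comment> \<open>s l acts as l' y and is self-adjoint, and the adjoint of l' y is y l'.\<close>
  have ly: "l' \<rhd> y \<rhd> c = y \<rhd> l' \<rhd> c" if c: "c \<in> perp B" for c
  proof (rule E.C_eqI)
    fix z assume z: "z \<in> perp B"
    have "t (l' \<rhd> y \<rhd> c) z = t (s l \<rhd> c) z" using sl[OF c] by simp
    also have "\<dots> = t c (l' \<rhd> y \<rhd> z)" using sl[OF z] by (simp add: act_adjoint)
    also have "\<dots> = t (y \<rhd> l' \<rhd> c) z" by (simp add: act_adjoint)
    finally show "t (l' \<rhd> y \<rhd> c) z = t (y \<rhd> l' \<rhd> c) z" .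
  qed (use l' yB c in simp_all)
  \<comment> \<open>The part of y orthogonal to \<open>L'\<close> still commutes with l', hence is
    0.\<close>
  have yL: "y \<in> L'"
  proof -
    obtain q c where qc: "q \<in> L'" "c \<in> perp L'" "y = q + c" using L'.B_C_decomp(2) by blast
    have "c = y - q" using qc by simp
    then have cB: "c \<in> B" using yB qc L'B by (metis B.B_closed(2) subsetD)
    have "c = 0"
    proof (rule L'.centralizer_trivial[OF B.norm_subalgebra_axioms L'B cB qc(2) c0])
      fix z assume z: "z \<in> perp B"
      show "l' \<rhd> c \<rhd> z = c \<rhd> l' \<rhd> z"
        unfolding \<open>c = y - q\<close> act_linear ly[OF z] using L'.act_commute[OF L'.l_L qc(1)] CL' z by (simp add: subset_iff)
    qed
    then show ?thesis using qc by simp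
  qed
  have sL: "s ` L \<subseteq> L'"
  proof
    fix z assume "z \<in> s ` L"
    then obtain x where x: "x \<in> L" "z = s x" by blast
    then obtain \<alpha> \<beta> \<gamma> where xe: "x = sc \<alpha> e + sc \<beta> l + sc \<gamma> (ad l)" using L.l_gen by blast
    define x' where "x' = sc \<alpha> e + sc \<beta> l' + sc \<gamma> (ad l')"
    have x'L: "x' \<in> L'" using L'.l_gen x'_def by blast
    have move: "E.app b (x \<rhd> c) = x' \<rhd> E.app b c" if c: "c \<in> perp B" for c
      unfolding xe x'_def using b c l l' by (simp add: act_linear E.app_linear B.act_e B.act_ad_expand eq)
    have "s x \<rhd> c0 = x' \<rhd> y \<rhd> c0"
      using s(4)[OF subsetD[OF LB x(1)] c0(1)] move y[OF c0(1)] b(1) c0 by simp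
    also have "\<dots> = jm x' y \<rhd> c0" using L'.act_mult[OF x'L yL] CL' c0 by (simp add: subset_iff)
    finally have "(s x - jm x' y) \<rhd> c0 = 0" by (simp add: act_linear)
    moreover have "s x - jm x' y \<in> B" using s(3) x LB x'L L'B yB by (simp add: subset_iff)
    ultimately have "s x - jm x' y = 0" using B.act_inj c0 by blast
    then show "z \<in> L'" using x x'L yL by simp
  qed
  have "s ` L = L'"
    by (intro subspace_dim_equal subspace_linear_image[OF L.B_subspace s(1)] L'.B_subspace sL)
      (use dim_linear_image[OF L.B_subspace s(1)] sz assms(3,5) in auto)
  then show ?thesis using B.norm_subalgebra_axioms dimB LB L'B s(1,2) bij sB by blast
qed

end

section \<open>Three-dimensional subspaces\<close>

lemma (in vector_space) dim_three_basis:
  assumes "subspace L" "dim L = 3" and "x \<in> L" "y \<in> L" "z \<in> L"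
    and ind: "\<And>a b c. scale a x + scale b y + scale c z = 0 \<Longrightarrow> a = 0 \<and> b = 0 \<and> c = 0"
  shows "w \<in> L \<longleftrightarrow> (\<exists>a b c. w = scale a x + scale b y + scale c z)"
proof
  assume w: "w \<in> L"
  have xy: "x \<noteq> y" using ind[of 1 "-1" 0] by auto
  have xz: "x \<noteq> z" using ind[of 1 0 "-1"] by auto
  have yz: "y \<noteq> z" using ind[of 0 1 "-1"] by auto
  have sp: "span {x, y, z} = {v. \<exists>a b c. v = scale a x + scale b y + scale c z}"
    unfolding span_insert span_empty by (auto simp: algebra_simps)
  have ind3: "independent {x, y, z}"
  proof (rule independent_if_scalars_zero)
    fix f v assume s: "(\<Sum>u\<in>{x, y, z}. scale (f u) u) = 0" and v: "v \<in> {x, y, z}"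
    have "scale (f x) x + scale (f y) y + scale (f z) z = 0" using s xy xz yz by (simp add: algebra_simps)
    from ind[OF this] v show "f v = 0" by auto
  qed simp
  have "w \<in> span {x, y, z}"
  proof (rule ccontr)
    assume nw: "w \<notin> span {x, y, z}"
    then have "independent (insert w {x, y, z})" using ind3 by (rule independent_insertI)
    moreover have "w \<notin> {x, y, z}" using nw span_superset[of "{x, y, z}"] by auto
    ultimately have c4: "card (insert w {x, y, z}) = 4" "independent (insert w {x, y, z})" using xy xz yz by simp_all
    obtain S where S: "S \<subseteq> L" "independent S" "L \<subseteq> span S" "card S = 3" using basis_exists[of L] assms(2) by metis
    have fS: "finite S" using S(4) by (metis card.infinite zero_neq_numeral)
    have "insert w {x, y, z} \<subseteq> span S" using S(3) w assms by auto
    from independent_span_bound[OF fS c4(2) this] c4(1) S(4) show False by simp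
  qed
  then show "\<exists>a b c. w = scale a x + scale b y + scale c z" unfolding sp by blast
next
  assume "\<exists>a b c. w = scale a x + scale b y + scale c z"
  then show "w \<in> L" using assms by (auto intro!: subspace_add subspace_scale)
qed

lemma (in vector_space) dim_three_extend:
  assumes "dim L = 3" "finite S" "card S < 3"
  shows "\<exists>x\<in>L. x \<notin> span S"
proof (rule ccontr)
  assume "\<not> ?thesis"
  then have "L \<subseteq> span S" by blast
  from dim_le_card[OF this assms(2)] assms show False by simp
qed

section \<open>The theorem\<close>

text \<open>Suppose every element satisfies a quadratic relation. In a basis e, x, y of
  \<open>L\<close> shift x to x' so that x' y lies in the span of e and x. The inverse z of x' lies
  in that span, and z x = e + \<gamma> z does too; hence so does y = z (x' y).\<close>

lemma cubic_subfield_generic: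
  fixes sc :: "'k::field \<Rightarrow> 'a::ab_group_add \<Rightarrow> 'a"
  assumes "vector_space sc" and bil: "bilinear_prod sc m" and comm: "\<And>x y. m x y = m y x" and unit: "\<And>x. m e x = x"
    and L: "sep_cubic_subfield sc m e L"
  shows "\<exists>x. \<forall>a b c. sc a e + sc b x + sc c (m x x) = 0 \<longrightarrow> c = 0"
proof (rule ccontr)
  interpret vector_space sc by fact
  assume "\<not> ?thesis"
  then have dep: "\<And>x. \<exists>a b c. sc a e + sc b x + sc c (m x x) = 0 \<and> c \<noteq> 0" by blast
  have sub: "subspace L" and eL: "e \<in> L" and mL: "\<And>x y. x \<in> L \<Longrightarrow> y \<in> L \<Longrightarrow> m x y \<in> L" and dimL: "dim L = 3"
    and assoc: "\<And>x y z. x \<in> L \<Longrightarrow> y \<in> L \<Longrightarrow> z \<in> L \<Longrightarrow> m (m x y) z = m x (m y z)"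
    and inverse: "\<And>x. x \<in> L \<Longrightarrow> x \<noteq> 0 \<Longrightarrow> \<exists>y\<in>L. m x y = e"
    using L by (auto simp: sep_cubic_subfield_def subalgebra_def)
  have lin: "m (x + y) z = m x z + m y z" "m z (x + y) = m z x + m z y" "m (sc c x) z = sc c (m x z)" "m z (sc c x) = sc c (m z x)" for x y z c
    using bil by (auto simp: bilinear_prod_def)
  have mminus: "m z (- x) = - m z x" "m (- x) z = - m x z" for x z using lin(4)[of z "-1" x] lin(3)[of "-1" x z] by simp_all
  have mdiff: "m z (x - y) = m z x - m z y" "m (x - y) z = m x z - m y z" for x y z
    using lin(2)[of z x "-y"] lin(1)[of x "-y" z] by (simp_all add: mminus)
  obtain x where x: "x \<in> L" "x \<notin> span {e}" using dim_three_extend[OF dimL, of "{e}"] by auto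
  have "card {e, x} < 3" by (cases "e = x") auto
  then obtain y where y: "y \<in> L" "y \<notin> span {e, x}" using dim_three_extend[OF dimL, of "{e, x}"] by auto
  have e_span: "e \<in> span {e, x}" "x \<in> span {e, x}" by (auto intro: span_base)
  have ind: "a = 0 \<and> b = 0 \<and> c = 0" if "sc a e + sc b x + sc c y = 0" for a b c
  proof -
    have c: "c = 0"
    proof (rule ccontr)
      assume c: "c \<noteq> 0"
      have "sc c y = sc (- a) e + sc (- b) x" using that by (simp add: add_eq_0_iff2) (simp add: algebra_simps eq_neg_iff_add_eq_0)
      then have "sc (1 / c) (sc c y) \<in> span {e, x}" using e_span by (simp add: span_scale span_add span_diff span_neg)
      then show False using y c by simp
    qed
    have b: "b = 0"
    proof (rule ccontr)
      assume b: "b \<noteq> 0"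
      have "sc b x = sc (- a) e" using that c by (simp add: eq_neg_iff_add_eq_0 add.commute)
      then have "sc (1 / b) (sc b x) \<in> span {e}" by (simp add: span_scale span_base span_neg)
      then show False using x b by simp
    qed
    have "e \<noteq> 0"
    proof
      assume "e = 0"
      then have "x = 0" using unit[of x] lin(3)[of 0 0 x] by simp
      then show False using x span_zero by blast
    qed
    then show ?thesis using that b c by simp
  qed
  obtain \<alpha> \<beta> \<gamma> where xy: "m x y = sc \<alpha> e + sc \<beta> x + sc \<gamma> y"
    using dim_three_basis[OF sub dimL eL x(1) y(1) ind] mL[OF x(1) y(1)] by blast
  define x' where "x' = x - sc \<gamma> e"
  have x'L: "x' \<in> L" using x eL sub by (simp add: x'_def subspace_diff subspace_scale)
  have x'0: "x' \<notin> span {e}"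
  proof
    assume "x' \<in> span {e}"
    then have "x' + sc \<gamma> e \<in> span {e}" by (simp add: span_add span_scale span_base)
    then show False using x by (simp add: x'_def)
  qed
  then have "x' \<noteq> 0" using span_zero by blast
  then obtain z where z: "z \<in> L" "m x' z = e" using inverse[OF x'L] by blast
  have zx': "m z x' = e" using z comm by simp
  have x'y: "m x' y = sc \<alpha> e + sc \<beta> x" by (simp add: x'_def mdiff lin unit xy)
  obtain a b c where abc: "sc a e + sc b x' + sc c (m x' x') = 0" "c \<noteq> 0" using dep by blast
  have "m z (sc a e + sc b x' + sc c (m x' x')) = 0" unfolding abc using lin(4)[of z 0 0] by simp
  moreover have "m z (m x' x') = x'" using assoc[OF z(1) x'L x'L] zx' unit by simp
  ultimately have rel: "sc a z + sc b e + sc c x' = 0" using comm[of z e] by (simp add: lin zx' unit)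
  have a: "a \<noteq> 0"
  proof
    assume "a = 0"
    then have "sc c x' = sc (- b) e" using rel by (simp add: eq_neg_iff_add_eq_0 add.commute)
    then have "sc (1 / c) (sc c x') \<in> span {e}" by (simp add: span_scale span_base span_neg)
    then show False using x'0 abc(2) by simp
  qed
  have x'_span: "x' \<in> span {e, x}" using e_span by (simp add: x'_def span_diff span_scale)
  have "sc a z = sc (- b) e + sc (- c) x'" using rel by (simp add: add.assoc add_eq_0_iff2)
  then have "sc (1 / a) (sc a z) \<in> span {e, x}" using e_span x'_span by (simp add: span_scale span_add span_diff span_neg)
  then have z_span: "z \<in> span {e, x}" using a by simp
  have "y = m z (m x' y)" using assoc[OF z(1) x'L y(1)] zx' unit by simp
  also have "\<dots> = sc \<alpha> z + sc \<beta> (m z x)" unfolding x'y using comm[of z e] unit by (simp add: lin)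
  also have "m z x = e + sc \<gamma> z"
  proof -
    have "x = x' + sc \<gamma> e" by (simp add: x'_def)
    then show ?thesis using zx' comm[of z e] unit by (simp add: lin)
  qed
  finally have "y \<in> span {e, x}" using z_span e_span by (simp add: span_add span_scale)
  with y show False by simp
qed

context cubic_jordan begin

text \<open>The polarisation of \<open>sharp\<close>; it serves as the cross product of the cubic
  norm structure.\<close>

definition cross where "cross x y = sc 2 (x \<odot> y) - sc (T x) y - sc (T y) x + sc (2 * Q x y) e"

lemma cross_self: "sc (1/2) (cross x x) = sharp x"
proof -
  have "cross x x = sc 2 (sharp x)"
    by (rule vec_eqI) (simp only: cross_def sharp_def lin_simps, algebra)
  then show ?thesis by simp
qed

lemma cubic_norm:
  assumes "finite_dimensional_vector_space sc Bas"
  shows "cubic_norm sc Bas cross (\<lambda>x y. T (x \<odot> y)) e"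
proof -
  interpret finite_dimensional_vector_space sc Bas by fact
  show ?thesis
  proof
    show "(2::'k) \<noteq> 0" "(3::'k) \<noteq> 0" by simp_all
    fix x y z :: 'a and c :: 'k
    show "cross (x + y) z = cross x z + cross y z"
      by (rule vec_eqI) (simp only: cross_def lin_simps expand, algebra)
    show "cross (sc c x) y = sc c (cross x y)"
      by (rule vec_eqI) (simp only: cross_def lin_simps expand, algebra)
    show "cross x y = cross y x"
      unfolding cross_def mult_commute[of y x] Q_sym[of y x] by (simp add: algebra_simps)
    show "T ((x + y) \<odot> z) = T (x \<odot> z) + T (y \<odot> z)" "T (sc c x \<odot> y) = c * T (x \<odot> y)" by (simp_all add: expand)
    show "T (x \<odot> y) = T (y \<odot> x)" by (simp only: mult_commute[of x y])
    show "T (cross x y \<odot> z) = T (x \<odot> cross y z)"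
    proof -
      have "T ((x \<odot> y) \<odot> z) = T (x \<odot> (y \<odot> z))" using T_assoc[of z x y] mult_commute by metis
      then show ?thesis unfolding cross_def expand unit unit_right Q_polar
        by (simp add: algebra_simps)
    qed
    show "cross e x = sc (T (x \<odot> e)) e - x"
      by (rule vec_eqI) (simp only: cross_def lin_simps unit unit_right T_unit Q_unit', algebra)
    show "T (e \<odot> e) = 3" by simp
    show "sc (1/2) (cross (sc (1/2) (cross x x)) (sc (1/2) (cross x x))) = sc (T (sc (1/2) (cross x x) \<odot> x) / 3) x"
      unfolding cross_self sharp_sharp norm_linearised[symmetric] by simp
    show "x = 0" if "T (sc (1/2) (cross x x) \<odot> x) = 0"
      using that aniso[of x] unfolding cross_self norm_linearised[symmetric] by simp
  qed
qed

end

theorem mainTheorem14: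
  fixes sc :: "'k::field \<Rightarrow> 'a::ab_group_add \<Rightarrow> 'a"
    and m :: "'a \<Rightarrow> 'a \<Rightarrow> 'a" and e :: 'a and N :: "'a \<Rightarrow> 'k"
    and L L' :: "'a set"
  assumes "infinite (UNIV :: 'k set)" and "(2::'k) \<noteq> 0" and "(3::'k) \<noteq> 0"
    and "division_albert sc m e N"
    and "sep_cubic_subfield sc m e L" and "sep_cubic_subfield sc m e L'"
    and "iso_over_K sc m e L L'"
  shows "(\<exists>B. subalgebra sc m e B \<and> vector_space.dim sc B = 9 \<and> L \<subseteq> B \<and> L' \<subseteq> B \<and>
           (\<exists>s\<in>Str sc N. s ` B = B \<and> s ` L = L'))
         \<and> (\<exists>g\<in>Str sc N. g ` L = L')"
proof -
  note A = assms(4)[unfolded division_albert_def jordan_algebra_def]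
  interpret vector_space sc using A by blast
  have dimA: "dim (UNIV :: 'a set) = 27" using A by blast
  obtain Bas where Bas: "independent Bas" "UNIV \<subseteq> span Bas" "card Bas = 27"
    using basis_exists[of UNIV] dimA by metis
  have "finite Bas" using Bas(3) by (metis card.infinite zero_neq_numeral)
  have fd: "finite_dimensional_vector_space sc Bas"
    by unfold_locales (use Bas \<open>finite Bas\<close> in auto)
  have bil: "bilinear_prod sc m" and comm: "\<And>x y. m x y = m y x" and unit: "\<And>x. m e x = x" using A by auto
  obtain F where F: "\<forall>y z. linear_form sc (\<lambda>x. F x y z)" "\<forall>x y z. F x y z = F y x z \<and> F x y z = F x z y" "\<forall>x. N x = F x x x"
    using A unfolding cubic_form_def by blast
  obtain T S where TS: "linear_form sc T" "quadratic_form sc S" "\<forall>x. m x (m x x) - sc (T x) (m x x) + sc (S x) x - sc (N x) e = 0"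
    using A by blast
  obtain Q where Q: "\<forall>y. linear_form sc (\<lambda>x. Q x y)" "\<forall>x y. Q x y = Q y x" "\<forall>x. S x = Q x x"
    using TS(2) unfolding quadratic_form_def by blast
  interpret J: cubic_jordan sc m e F T Q
  proof
    fix x y z w :: 'a and c :: 'k
    show "m (x + y) z = m x z + m y z" "m (sc c x) y = sc c (m x y)" using bil by (auto simp: bilinear_prod_def)
    show "m x y = m y x" "m e x = x" by (fact comm unit)+
    show "m (m (m x x) y) x = m (m x x) (m y x)" using A by blast
    show "F (x + y) z w = F x z w + F y z w" "F (sc c x) z w = c * F x z w" using F(1) by (auto simp: linear_form_def)
    show "F x y z = F y x z" "F x y z = F x z y" using F(2) by blast+
    show "F e e e = 1" using A F(3) by simp
    show "T (x + y) = T x + T y" "T (sc c x) = c * T x" using TS(1) by (auto simp: linear_form_def)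
    show "Q (x + y) z = Q x z + Q y z" "Q (sc c x) z = c * Q x z" using Q(1) by (auto simp: linear_form_def)
    show "Q x y = Q y x" using Q(2) by blast
    show "m x (m x x) - sc (T x) (m x x) + sc (Q x x) x - sc (F x x x) e = 0" using TS(3) Q(3) F(3) by simp
    show "x = 0" if "F x x x = 0" using A F(3) that by simp
  qed (use assms(2,3) cubic_subfield_generic[OF vector_space_axioms bil comm unit assms(5)] in auto)
  interpret cubic_norm sc Bas J.cross "\<lambda>x y. T (m x y)" e by (rule J.cubic_norm[OF fd])
  have N_eq: "cubic_norm.N sc J.cross (\<lambda>x y. T (m x y)) x = N x" for x
    unfolding N_def ad_def J.cross_self J.norm_linearised[symmetric] using F(3) by simp
  have T_eq: "cubic_norm.T (\<lambda>x y. T (m x y)) e x = T x" for x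
    unfolding T_def by simp
  \<comment> \<open>The product rebuilt from the norm structure is the given one, so the subalgebra
    found there is a subalgebra for \<open>m\<close>.\<close>
  have jm_eq: "jm x y = m x y" for x y
  proof -
    have "jm x y = sc (1/2) (sc 2 (m x y))"
      unfolding jm_def T_eq J.cross_def J.Q_polar by simp
    then show ?thesis by simp
  qed
  have cross_eq: "J.cross x y = sc 2 (m x y) - sc (T x) y - sc (T y) x + sc (2 * Q x y) e" for x y
    by (simp add: J.cross_def)
  have field: "norm_subalgebra sc Bas J.cross (\<lambda>x y. T (m x y)) e K" if "sep_cubic_subfield sc m e K" for K
  proof
    show "subspace K" "e \<in> K" using that by (auto simp: sep_cubic_subfield_def subalgebra_def)
    show "J.cross a b \<in> K" if "a \<in> K" "b \<in> K" for a b
      using that \<open>sep_cubic_subfield sc m e K\<close> unfolding cross_eq sep_cubic_subfield_def subalgebra_def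
      by (auto intro!: subspace_add subspace_diff subspace_scale)
  qed
  have gen: "cubic_field sc Bas J.cross (\<lambda>x y. T (m x y)) e K k" if K: "sep_cubic_subfield sc m e K" and k: "k \<in> K" "\<And>c. k \<noteq> sc c e" for K k
  proof -
    interpret K: norm_subalgebra sc Bas J.cross "\<lambda>x y. T (m x y)" e K by (rule field[OF K])
    show ?thesis
    proof
      show "k \<noteq> sc c e" for c by (rule k)
      show "x \<in> K \<longleftrightarrow> (\<exists>a b c. x = sc a e + sc b k + sc c (ad k))" for x
      proof (rule dim_three_basis[OF K.B_subspace _ K.e_B k(1) K.ad_B[OF k(1)]])
        show "dim K = 3" using K unfolding sep_cubic_subfield_def by blast
        show "a = 0 \<and> b = 0 \<and> c = 0" if "sc a e + sc b k + sc c (ad k) = 0" for a b c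
          by (rule degree_three[OF k(2) that])
      qed
    qed
  qed
  have dimL: "dim L = 3" "dim L' = 3" using assms(5,6) unfolding sep_cubic_subfield_def by blast+
  interpret L: norm_subalgebra sc Bas J.cross "\<lambda>x y. T (m x y)" e L by (rule field[OF assms(5)])
  obtain l where l: "l \<in> L" "l \<notin> span {e}" using dim_three_extend[OF dimL(1), of "{e}"] by auto
  have l_gen: "l \<noteq> sc c e" for c using l(2) by (metis insertI1 span_base span_scale)
  obtain \<phi> where \<phi>: "bij_betw \<phi> L L'" "\<phi> e = e" "\<And>x y. x \<in> L \<Longrightarrow> y \<in> L \<Longrightarrow> \<phi> (x + y) = \<phi> x + \<phi> y"
      "\<And>x y. x \<in> L \<Longrightarrow> y \<in> L \<Longrightarrow> \<phi> (m x y) = m (\<phi> x) (\<phi> y)" "\<And>c x. x \<in> L \<Longrightarrow> \<phi> (sc c x) = sc c (\<phi> x)"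
    using assms(7) unfolding iso_over_K_def by blast
  define l' where "l' = \<phi> l"
  have l': "l' \<in> L'" unfolding l'_def by (rule bij_betwE[OF \<phi>(1), rule_format, OF l(1)])
  have l'_gen: "l' \<noteq> sc c e" for c
  proof
    assume "l' = sc c e"
    then have "\<phi> l = \<phi> (sc c e)" using \<phi>(2,5) L.e_B by (simp add: l'_def)
    moreover have "inj_on \<phi> L" using \<phi>(1) by (simp add: bij_betw_def)
    moreover have "sc c e \<in> L" by (rule L.B_closed(4)[OF L.e_B])
    ultimately have "l = sc c e" using l(1) by (simp add: inj_on_eq_iff)
    then show False using l_gen by blast
  qed
  have mL: "m x y \<in> L" if "x \<in> L" "y \<in> L" for x y using L.jm_B[OF that] by (simp add: jm_eq)
  have cube: "m l (m l l) = sc (T l) (m l l) + sc (- Q l l) l + sc (F l l l) e"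
    by (rule vec_eqI1[OF J.char_eq[of l], where k = 1]) (simp only: lin_simps, algebra)
  \<comment> \<open>\<phi> carries the characteristic equation of l to l'. As l' is not a multiple
    of e, independence of e, l' and its square identifies the coefficients with those of its own
    equation.\<close>
  have cube': "m l' (m l' l') = sc (T l) (m l' l') + sc (- Q l l) l' + sc (F l l l) e"
  proof -
    have "m l' (m l' l') = \<phi> (m l (m l l))" using l mL by (simp add: \<phi>(4) l'_def)
    also have "\<dots> = \<phi> (sc (T l) (m l l)) + \<phi> (sc (- Q l l) l) + \<phi> (sc (F l l l) e)"
    proof -
      have "sc (T l) (m l l) \<in> L" "sc (- Q l l) l \<in> L" "sc (F l l l) e \<in> L"
        using l(1) mL[OF l(1) l(1)] by (simp_all only: L.B_closed)
      then show ?thesis unfolding cube by (simp only: \<phi>(3) L.B_closed)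
    qed
    also have "\<dots> = sc (T l) (m l' l') + sc (- Q l l) l' + sc (F l l l) e"
      unfolding \<phi>(5)[OF mL[OF l(1) l(1)]] \<phi>(5)[OF l(1)] \<phi>(5)[OF L.e_B] \<phi>(4)[OF l(1) l(1)] \<phi>(2) l'_def ..
    finally show ?thesis .
  qed
  have "sc (F l l l - F l' l' l') e + sc (Q l' l' - Q l l) l' + sc (T l - T l') (m l' l') = 0"
    by (rule vec_eqI2[OF J.char_eq[of l'] cube', where k = 1 and k' = "-1"]) (simp only: lin_simps, algebra)
  from J.degree_three[OF l'_gen this] have inv: "F l' l' l' = F l l l" "Q l' l' = Q l l" "T l' = T l" by auto
  have "T (ad x) = Q x x" for x unfolding ad_def J.cross_self by (rule J.sharp_invariants)
  then have "\<exists>B. norm_subalgebra sc Bas J.cross (\<lambda>x y. T (m x y)) e B \<and> dim B = 9 \<and> L \<subseteq> B \<and> L' \<subseteq> B \<and>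
    (\<exists>s. Vector_Spaces.linear sc sc s \<and> bij s \<and> (\<exists>\<nu>. \<forall>x. N (s x) = \<nu> * N x) \<and> s ` B = B \<and> s ` L = L')"
    using cubic_fields_similar[OF dimA gen[OF assms(5) l(1) l_gen] dimL(1) gen[OF assms(6) l' l'_gen] dimL(2)] inv F(3)
    unfolding N_eq T_eq by simp
  then obtain B s where B: "norm_subalgebra sc Bas J.cross (\<lambda>x y. T (m x y)) e B" "dim B = 9" "L \<subseteq> B" "L' \<subseteq> B"
    and s: "Vector_Spaces.linear sc sc s" "bij s" "\<exists>\<nu>. \<forall>x. N (s x) = \<nu> * N x" "s ` B = B" "s ` L = L'" by blast
  interpret B: norm_subalgebra sc Bas J.cross "\<lambda>x y. T (m x y)" e B by (rule B(1))
  have "subalgebra sc m e B" unfolding subalgebra_def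
    using B.B_subspace B.e_B B.jm_B by (auto simp: jm_eq)
  moreover have "s \<in> Str sc N" using s by (auto simp: Str_def)
  ultimately show ?thesis using B s by blast
qed

end
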